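(* Let $N\ge 1$, $\alpha\in(0,N)$, $s\in(0,2)$ and $s<N$. Then \[ \sup_{\substack{\varphi\in\dot H^{s/2}(\mathbb{R}^N)\\ \|\varphi\|_{\dot H^{s/2}}\le 1}}\ \int_{\mathbb{R}^N}\int_{\mathbb{R}^N} \frac{\varphi(x)}{|x|^{\frac{\alpha+s}{2}}}\, I_\alpha(x-y)\, \frac{\varphi(y)}{|y|^{\frac{\alpha+s}{2}}}\,dx\,dy = \frac{1}{2^{\alpha+s}}\left(\frac{\Gamma\bigl(\frac{N-s}{4}\bigr)\Gamma\bigl(\frac{N-\alpha}{4}\bigr)}{\Gamma\bigl(\frac{N+s}{4}\bigr)\Gamma\bigl(\frac{N+\alpha}{4}\bigr)}\right)^2 . \]
   Context: All functions are real-valued. For $\alpha\in(0,N)$ the Riesz potential is the function $I_\alpha:\mathbb{R}^N\setminus\{0\}\to\mathbb{R}$, \[ I_\alpha(x)=\frac{\mathcal{A}_\alpha}{|x|^{N-\alpha}},\qquad \mathcal{A}_\alpha=\frac{\Gamma\bigl(\frac{N-\alpha}{2}\bigr)}{2^\alpha\pi^{N/2}\Gamma\bigl(\frac\alpha2\bigr)}, \] where $\Gamma$ is Euler's Gamma function. For $s\in(0,2)$ with $s<N$, the homogeneous Sobolev space $\dot H^{s/2}(\mathbb{R}^N)$ is the completion of $C^\infty_c(\mathbb{R}^N)$ with respect to the norm $\|\cdot\|_{\dot H^{s/2}}$ defined by \[ \|\varphi\|_{\dot H^{s/2}}^2=\mathcal{D}_{N,s}\int_{\mathbb{R}^N}\int_{\mathbb{R}^N}\frac{|\varphi(x)-\varphi(y)|^2}{|x-y|^{N+s}}\,dx\,dy,\qquad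 \mathcal{D}_{N,s}=\frac{\Gamma\bigl(\frac{N+s}{2}\bigr)\,s}{2^{2-s}\pi^{N/2}\Gamma\bigl(1-\frac s2\bigr)} . \] *)

theory Defs
  imports "HOL-Analysis.Analysis"
begin

text \<open>
  Euclidean space of dimension \<open>N \<ge> 1\<close> is a type of class \<open>euclidean_space\<close>, with
  \<open>N = DIM('a)\<close>. Kernels singular at the origin take the value \<open>0\<close> there (as \<open>0 powr a = 0\<close>
  and \<open>c / 0 = 0\<close>); this only affects null sets of integration.
\<close>

fun C_k :: "nat \<Rightarrow> ('a::euclidean_space \<Rightarrow> real) \<Rightarrow> bool" where
  "C_k 0 f \<longleftrightarrow> continuous_on UNIV f"
| "C_k (Suc k) f \<longleftrightarrow>
     (\<forall>x. f differentiable (at x)) \<and> (\<forall>v. C_k k (\<lambda>x. frechet_derivative f (at x) v))"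

definition test_functions :: "('a::euclidean_space \<Rightarrow> real) set" where
  "test_functions = {f. (\<forall>k. C_k k f) \<and> compact (closure (support_on UNIV f))}"

definition riesz_const :: "nat \<Rightarrow> real \<Rightarrow> real" where
  "riesz_const N \<alpha> =
     Gamma ((real N - \<alpha>) / 2) / (2 powr \<alpha> * pi powr (real N / 2) * Gamma (\<alpha> / 2))"

definition riesz_potential :: "real \<Rightarrow> 'a::euclidean_space \<Rightarrow> real" where
  "riesz_potential \<alpha> x = riesz_const DIM('a) \<alpha> / norm x powr (real DIM('a) - \<alpha>)"

definition sobolev_const :: "nat \<Rightarrow> real \<Rightarrow> real" where
  "sobolev_const N s =
     Gamma ((real N + s) / 2) * s / (2 powr (2 - s) * pi powr (real N / 2) * Gamma (1 - s / 2))"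

text \<open>The squared norm, as a possibly infinite quantity for arbitrary functions.\<close>

definition hs_energy :: "real \<Rightarrow> ('a::euclidean_space \<Rightarrow> real) \<Rightarrow> ennreal" where
  "hs_energy s \<phi> = ennreal (sobolev_const DIM('a) s) *
     (\<integral>\<^sup>+ y. \<integral>\<^sup>+ x. ennreal (\<bar>\<phi> x - \<phi> y\<bar>\<^sup>2 / norm (x - y) powr (real DIM('a) + s))
        \<partial>lborel \<partial>lborel)"

text \<open>
  The completion of the test functions, realised as a space of (Borel representatives of)
  functions: \<open>\<phi>\<close> represents the class of a Cauchy sequence of test functions that converges to
  it both in norm and almost everywhere. For \<open>s < N\<close> every Cauchy sequence has such a limit
  along a subsequence, by the Sobolev inequality. Convergence in norm alone would not determine
  \<open>\<phi>\<close>, since the energy does not see additive constants.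
\<close>

definition hom_sobolev :: "real \<Rightarrow> ('a::euclidean_space \<Rightarrow> real) set" where
  "hom_sobolev s = {\<phi>. \<phi> \<in> borel_measurable borel \<and>
     (\<exists>u. (\<forall>n. u n \<in> test_functions) \<and>
          (\<lambda>n. hs_energy s (\<lambda>x. u n x - \<phi> x)) \<longlonglongrightarrow> 0 \<and>
          (AE x in lborel. (\<lambda>n. u n x) \<longlonglongrightarrow> \<phi> x))}"

text \<open>
  Meaningful on \<open>hom_sobolev s\<close>, where the energy is finite and is the limit of the energies of
  an approximating sequence; elsewhere an infinite energy is mapped to \<open>0\<close>.
\<close>

definition hs_norm :: "real \<Rightarrow> ('a::euclidean_space \<Rightarrow> real) \<Rightarrow> real" where
  "hs_norm s \<phi> = sqrt (enn2real (hs_energy s \<phi>))"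

definition weighted_riesz_kernel ::
    "real \<Rightarrow> real \<Rightarrow> ('a::euclidean_space \<Rightarrow> real) \<Rightarrow> 'a \<Rightarrow> 'a \<Rightarrow> real" where
  "weighted_riesz_kernel \<alpha> s \<phi> x y =
     \<phi> x / norm x powr ((\<alpha> + s) / 2) * riesz_potential \<alpha> (x - y) *
       (\<phi> y / norm y powr ((\<alpha> + s) / 2))"

end

theory Submission
  imports Defs "HOL-Probability.Distributions" "HOL-Real_Asymp.Real_Asymp"
begin

text \<open>
  The quadratic form is bounded by two sharp inequalities that share the virtual ground state
  \<open>w(x) = |x|\<close> to the power \<open>-(N - s)/2\<close>. A Schur test with \<open>w\<close> (Stein--Weiss) bounds the form by
  \<open>\<integral> \<phi>\<^sup>2 / |x|\<close> to the power \<open>s\<close>, and Picone's inequality with \<open>w\<close> (fractional Hardy) bounds that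
  integral by the energy. To avoid principal values, the singular kernel of the energy is written as a mixture of
  Gaussian kernels \<open>exp (-t |x - y|\<^sup>2)\<close>, Picone's inequality is applied for each fixed \<open>t\<close>, and the
  common divergent part is cancelled before integrating in \<open>t\<close>.

  For optimality, \<open>w\<close> itself is a mixture of the Gaussians \<open>exp (-u |x|\<^sup>2)\<close>, \<open>u > 0\<close>. Restricting the mixing
  variable to \<open>1 \<le> u \<le> M\<close> gives smooth trial functions for which both the energy and the form are double integrals
  of homogeneous kernels, so that both grow like \<open>ln M\<close>; the quotient of the two slopes is the constant.
\<close>

section \<open>Integrals over the half-line\<close>

text \<open>The power \<open>w\<close> fits both inequalities because it is formally an
  eigenfunction of each. Multiplied by the weight of the form it becomes the power
  \<open>-(N + \<alpha>)/2\<close>, whose Riesz potential is a multiple of the power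
  \<open>-(N - \<alpha>)/2\<close>; and the fractional Laplacian of order \<open>s\<close> maps
  \<open>w\<close> to a multiple of \<open>w / |x|^s\<close>. The sharp constant is therefore a
  product, one factor for \<open>\<alpha>\<close> and one for \<open>s\<close>. The function
  \<open>w\<close> itself is no maximiser, since the integral of \<open>w^2 / |x|^s\<close> diverges
  logarithmically at 0 and at infinity.

  Integrals are evaluated in \<open>ennreal\<close>, where exchanging them costs only measurability
  but subtraction is lost. Differences therefore appear as nonnegative pieces that are added up, and
  each cancellation needs a finiteness argument. This is why Hardy's inequality is first shown for
  functions with finite L2 norm and finite weighted integral, and reaches the completion by Fatou's
  lemma. Powers of the norm are always expanded into Gaussians, so every constant comes from
  one-dimensional Gamma and Beta integrals, with neither polar coordinates nor the Fourier
  transform.\<close>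

definition lpos :: "real measure" where
  "lpos = density lborel (indicator {0<..})"

lemma sets_lpos [simp, measurable_cong]: "sets lpos = sets borel"
  by (simp add: lpos_def)

lemma space_lpos [simp]: "space lpos = UNIV"
  by (simp add: lpos_def)

lemma sigma_finite_lpos: "sigma_finite_measure lpos"
  unfolding lpos_def
  by (subst sigma_finite_measure.sigma_finite_iff_density_finite[OF sigma_finite_lborel]) (auto simp: indicator_def)

abbreviation nn_lborel :: "('a::euclidean_space \<Rightarrow> ennreal) \<Rightarrow> ennreal" (binder "NBINT " 10) where
  "nn_lborel f \<equiv> integral\<^sup>N lborel f"

abbreviation nn_lpos :: "(real \<Rightarrow> ennreal) \<Rightarrow> ennreal" (binder "NPINT " 10) where
  "nn_lpos f \<equiv> integral\<^sup>N lpos f"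

interpretation lpos: sigma_finite_measure lpos
  by (rule sigma_finite_lpos)

interpretation lpos_lborel: pair_sigma_finite lpos "lborel :: 'a::euclidean_space measure"
  by unfold_locales
interpretation lpos_lpos: pair_sigma_finite lpos lpos
  by unfold_locales

lemma AE_lpos: "AE t in lpos. 0 < t"
  unfolding lpos_def by (subst AE_density) (auto simp: indicator_def)

text \<open>The space of \<open>lpos\<close> is the whole line, so that it shares its measurable
  sets with \<open>borel\<close>; positivity of the variable is therefore only an almost everywhere
  fact, supplied here once and for all.\<close>

lemma nn_lpos_cong:
  assumes "\<And>t. 0 < t \<Longrightarrow> f t = g t"
  shows "(NPINT t. f t) = (NPINT t. g t)"
  by (rule nn_integral_cong_AE, rule AE_mp[OF AE_lpos]) (use assms in auto)

lemma nn_lpos_mono: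
  assumes "\<And>t. 0 < t \<Longrightarrow> f t \<le> g t"
  shows "(NPINT t. f t) \<le> (NPINT t. g t)"
  by (rule nn_integral_mono_AE, rule AE_mp[OF AE_lpos]) (use assms in auto)

lemma nn_lpos_eq:
  assumes [measurable]: "f \<in> borel_measurable borel"
  shows "(NPINT t. f t) = (NBINT t. f t * indicator {0<..} t)"
  unfolding lpos_def by (subst nn_integral_density) (auto simp: mult.commute)

lemma nn_lpos_scale:
  assumes [measurable]: "f \<in> borel_measurable borel" and c: "0 < c"
  shows "(NPINT t. f t) = ennreal c * (NPINT t. f (c * t))"
proof -
  have "(NPINT t. f t) = (NBINT t. f t * indicator {0<..} t)"
    by (simp add: nn_lpos_eq)
  also have "\<dots> = ennreal c * (NBINT t. f (c * t) * indicator {0<..} (c * t))"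
    using c by (subst nn_integral_real_affine[where c=c and t=0]) auto
  also have "(NBINT t. f (c * t) * indicator {0<..} (c * t)) = (NBINT t. f (c * t) * indicator {0<..} t)"
    using c by (intro nn_integral_cong) (auto simp: indicator_def zero_less_mult_iff)
  also have "\<dots> = (NPINT t. f (c * t))"
    by (simp add: nn_lpos_eq)
  finally show ?thesis .
qed

lemma nn_Gamma:
  assumes a: "0 < a" and c: "0 < c"
  shows "(NPINT t. ennreal (t powr (a - 1) * exp (- (c * t)))) = ennreal (Gamma a * c powr (- a))"
proof -
  have G: "(NPINT t. ennreal (t powr (a - 1) * exp (- t))) = ennreal (Gamma a)"
    unfolding Gamma_conv_nn_integral_real[OF a]
    by (subst nn_lpos_eq, simp, rule nn_integral_cong)
      (auto simp: indicator_def exp_minus divide_inverse le_less)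
  let ?h = "\<lambda>t. ennreal ((c * t) powr (a - 1) * exp (- (c * t)))"
  have "(NPINT t. ennreal (t powr (a - 1) * exp (- (c * t)))) = (NPINT t. ennreal (c powr (1 - a)) * ?h t)"
  proof (rule nn_lpos_cong)
    fix t :: real assume "0 < t"
    have "c powr (1 - a) * (c * t) powr (a - 1) = (c powr (1 - a) * c powr (a - 1)) * t powr (a - 1)"
      using c \<open>0 < t\<close> by (simp add: powr_mult mult_ac)
    also have "\<dots> = t powr (a - 1)"
      using c by (subst powr_add[symmetric]) simp
    finally show "ennreal (t powr (a - 1) * exp (- (c * t))) = ennreal (c powr (1 - a)) * ?h t"
      by (simp add: ennreal_mult[symmetric] mult.assoc[symmetric])
  qed
  also have "\<dots> = ennreal (c powr (1 - a)) * (NPINT t. ?h t)"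
    by (rule nn_integral_cmult) simp
  also have "(NPINT t. ?h t) = ennreal (Gamma a * c powr (-1))"
  proof -
    have "ennreal (Gamma a) = ennreal c * (NPINT t. ?h t)"
      unfolding G[symmetric] using c by (subst nn_lpos_scale[where c = c]) auto
    then have "ennreal (1 / c) * ennreal (Gamma a) = ennreal (1 / c) * ennreal c * (NPINT t. ?h t)"
      by (simp add: mult.assoc)
    also have "ennreal (1 / c) * ennreal c = 1"
      using c by (simp add: ennreal_mult[symmetric])
    finally show ?thesis using c a by (simp add: ennreal_mult[symmetric] powr_minus field_simps)
  qed
  also have "ennreal (c powr (1 - a)) * ennreal (Gamma a * c powr (-1)) = ennreal (Gamma a * c powr (- a))"
    using a c by (simp add: ennreal_mult[symmetric] powr_minus powr_diff field_simps)
  finally show ?thesis .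
qed

text \<open>Expanding the power of \<open>1 + v\<close> as a Gamma integral in \<open>t\<close>
  makes the exponent linear in \<open>v\<close>; in the exchanged order both integrations are of
  Gamma type.\<close>

lemma nn_Beta:
  assumes p: "0 < p" and q: "0 < q"
  shows "(NPINT v. ennreal (v powr (p - 1) * (1 + v) powr (- (p + q)))) = ennreal (Gamma p * Gamma q / Gamma (p + q))"
proof -
  have pos: "0 < Gamma (p + q)" "0 < Gamma p" "0 < Gamma q" using p q by auto
  then have nz: "Gamma (p + q) \<noteq> 0" by linarith
  let ?h1 = "\<lambda>v t. ennreal (v powr (p - 1) * (t powr (p + q - 1) * exp (- ((1 + v) * t))))"
  let ?h2 = "\<lambda>t. ennreal (t powr (p + q - 1) * exp (- t) / Gamma (p + q))"
  let ?h3 = "\<lambda>v. ennreal (v powr (p - 1) * (1 + v) powr (- (p + q)))"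
  let ?h4 = "\<lambda>t. ennreal (t powr (q - 1) * exp (- (1 * t)))"
  have "(NPINT v. ?h3 v) = (NPINT v. NPINT t. ennreal (1 / Gamma (p + q)) * ?h1 v t)"
  proof (rule nn_lpos_cong)
    fix v :: real assume v: "0 < v"
    have "(NPINT t. ennreal (1 / Gamma (p + q)) * ?h1 v t)
      = ennreal (1 / Gamma (p + q)) * (ennreal (v powr (p - 1)) * (NPINT t. ennreal (t powr (p + q - 1) * exp (- ((1 + v) * t)))))"
      by (subst nn_integral_cmult, simp, subst ennreal_mult, simp, simp, subst nn_integral_cmult, simp, simp)
    also have "\<dots> = ?h3 v"
      using v p q pos nz by (subst nn_Gamma) (auto simp: ennreal_mult[symmetric])
    finally show "?h3 v = (NPINT t. ennreal (1 / Gamma (p + q)) * ?h1 v t)" ..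
  qed
  also have "\<dots> = (NPINT t. NPINT v. ennreal (1 / Gamma (p + q)) * ?h1 v t)"
    by (rule lpos_lpos.Fubini') measurable
  also have "\<dots> = (NPINT t. ennreal (Gamma p / Gamma (p + q)) * ?h4 t)"
  proof (rule nn_lpos_cong)
    fix t :: real assume t: "0 < t"
    have "(NPINT v. ennreal (1 / Gamma (p + q)) * ?h1 v t) = (NPINT v. ?h2 t * ennreal (v powr (p - 1) * exp (- (t * v))))"
    proof (rule nn_integral_cong)
      fix v :: real
      have "exp (- ((1 + v) * t)) = exp (- t) * exp (- (t * v))"
        by (simp add: exp_add[symmetric] algebra_simps)
      then show "ennreal (1 / Gamma (p + q)) * ?h1 v t = ?h2 t * ennreal (v powr (p - 1) * exp (- (t * v)))"
        using pos by (simp add: ennreal_mult[symmetric] mult_ac)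
    qed
    also have "\<dots> = ?h2 t * ennreal (Gamma p * t powr (- p))"
      by (subst nn_integral_cmult, simp, subst nn_Gamma) (use t p in auto)
    also have "\<dots> = ennreal (Gamma p / Gamma (p + q)) * ?h4 t"
    proof -
      have "t powr (q - 1) = t powr (p + q - 1) * t powr (- p)"
        using t by (simp add: powr_add[symmetric])
      then show ?thesis
        using pos by (simp add: ennreal_mult[symmetric] mult_ac del: powr_minus)
    qed
    finally show "(NPINT v. ennreal (1 / Gamma (p + q)) * ?h1 v t) = ennreal (Gamma p / Gamma (p + q)) * ?h4 t" .
  qed
  also have "\<dots> = ennreal (Gamma p / Gamma (p + q)) * ennreal (Gamma q)"
    by (subst nn_integral_cmult, simp, subst nn_Gamma) (use q in auto)
  also have "\<dots> = ennreal (Gamma p * Gamma q / Gamma (p + q))"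
    using pos by (simp add: ennreal_mult[symmetric])
  finally show ?thesis .
qed

lemma powr_exponent_cong: "a = b \<Longrightarrow> x powr a = x powr b"
  by simp

lemma norm_square_powr: "((norm x)\<^sup>2) powr a = norm x powr (2 * a)"
  for x :: "'a::real_normed_vector"
proof (cases "x = 0")
  case False
  then have "(norm x)\<^sup>2 = norm x powr 2" by simp
  then show ?thesis by (simp only: powr_powr)
qed simp

lemma nn_cmult_real:
  assumes "0 \<le> c" and [measurable]: "f \<in> borel_measurable M"
  shows "(\<integral>\<^sup>+ x. ennreal (c * f x) \<partial>M) = ennreal c * (\<integral>\<^sup>+ x. ennreal (f x) \<partial>M)"
  using assms by (simp add: ennreal_mult' nn_integral_cmult)

lemma nn_lborel_cong:
  fixes f g :: "'a::euclidean_space \<Rightarrow> ennreal"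
  assumes "\<And>x. x \<noteq> c \<Longrightarrow> f x = g x"
  shows "(NBINT x. f x) = (NBINT x. g x)"
  by (rule nn_integral_cong_AE, rule AE_mp[OF AE_lborel_singleton[of c]], rule AE_I2) (blast intro: assms)

lemma nn_Gamma_diff:
  assumes a: "0 < a" and c: "0 < c" "c \<le> d"
  shows "(NPINT t. ennreal (t powr (a - 1) * (exp (- (c * t)) - exp (- (d * t))))) = ennreal (Gamma a * (c powr (- a) - d powr (- a)))"
proof -
  let ?h1 = "\<lambda>t. ennreal (t powr (a - 1) * exp (- (d * t)))"
  let ?h2 = "\<lambda>t. ennreal (t powr (a - 1) * exp (- (c * t)))"
  have "(NPINT t. ennreal (t powr (a - 1) * (exp (- (c * t)) - exp (- (d * t))))) = (NPINT t. ?h2 t - ?h1 t)"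
    by (intro nn_lpos_cong) (simp add: ennreal_minus right_diff_distrib)
  also have "\<dots> = (NPINT t. ?h2 t) - (NPINT t. ?h1 t)"
  proof (rule nn_integral_diff)
    show "(NPINT t. ?h1 t) \<noteq> \<infinity>"
      using a c by (subst nn_Gamma) auto
    show "AE t in lpos. ?h1 t \<le> ?h2 t"
      by (rule AE_mp[OF AE_lpos]) (use c in \<open>auto intro!: AE_I2 ennreal_leI mult_left_mono mult_right_mono\<close>)
  qed auto
  also have "\<dots> = ennreal (Gamma a * (c powr (- a) - d powr (- a)))"
    using a c by (simp add: nn_Gamma ennreal_minus right_diff_distrib)
  finally show ?thesis .
qed

text \<open>The quotient \<open>(1 - exp (- (t * y))) / y\<close> is the integral of
  \<open>exp (- (x * y))\<close> over \<open>x\<close> in \<open>{0..t}\<close>; exchanging leaves a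
  Gamma integral of order \<open>1 - h\<close> and then a power of \<open>x\<close>. Convergence at
  \<open>y = 0\<close> is the condition \<open>h < 1\<close>, which for \<open>h = s / 2\<close>
  reads \<open>s < 2\<close>.\<close>

lemma nn_one_minus_exp:
  assumes h: "0 < h" "h < 1" and t: "0 < t"
  shows "(NPINT y. ennreal (y powr (- h - 1) * (1 - exp (- (t * y))))) = ennreal (Gamma (1 - h) / h * t powr h)"
proof -
  let ?h = "\<lambda>y. NBINT x. ennreal (y powr (- h) * exp (- (x * y))) * indicator {0..t} x"
  have "(NPINT y. ennreal (y powr (- h - 1) * (1 - exp (- (t * y))))) = (NPINT y. ?h y)"
  proof (rule nn_lpos_cong)
    fix y :: real assume y: "0 < y"
    have "(?h y) = ennreal (- (y powr (- h - 1) * exp (- (t * y))) - - (y powr (- h - 1) * exp (- (0 * y))))"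
    proof (rule nn_integral_FTC_Icc)
      show "((\<lambda>x. - (y powr (- h - 1) * exp (- (x * y)))) has_real_derivative y powr (- h) * exp (- (x * y))) (at x)" for x
        using y by (auto intro!: derivative_eq_intros simp: powr_diff powr_minus)
    qed (use t in auto)
    then show "ennreal (y powr (- h - 1) * (1 - exp (- (t * y)))) = ?h y"
      by (simp add: algebra_simps)
  qed
  also have "\<dots> = (NBINT x. NPINT y. ennreal (y powr (- h) * exp (- (x * y))) * indicator {0..t} x)"
    by (rule lpos_lborel.Fubini'[symmetric]) measurable
  also have "\<dots> = (NBINT x. ennreal (Gamma (1 - h) * x powr (h - 1)) * indicator {0..t} x)"
  proof (rule nn_lborel_cong)
    fix x :: real assume "x \<noteq> 0"
    then show "(NPINT y. ennreal (y powr (- h) * exp (- (x * y))) * indicator {0..t} x) =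
        ennreal (Gamma (1 - h) * x powr (h - 1)) * indicator {0..t} x"
    proof (cases "x \<in> {0..t}")
      case True
      then have "0 < x" using \<open>x \<noteq> 0\<close> by simp
      have "(NPINT y. ennreal (y powr (1 - h - 1) * exp (- (x * y)))) = ennreal (Gamma (1 - h) * x powr (- (1 - h)))"
        by (rule nn_Gamma) (use h \<open>0 < x\<close> in auto)
      moreover have "1 - h - 1 = - h" "- (1 - h) = h - 1" by auto
      ultimately show ?thesis
        using True by (simp only: indicator_simps mult_1_right)
    next
      case False
      then show ?thesis by (simp del: atLeastAtMost_iff)
    qed
  qed
  also have "\<dots> = ennreal (Gamma (1 - h) * (t powr (h - 1 + 1) / (h - 1 + 1)))"
  proof (rule nn_integral_has_integral_lebesgue')
    show "((\<lambda>x. Gamma (1 - h) * x powr (h - 1)) has_integral Gamma (1 - h) * (t powr (h - 1 + 1) / (h - 1 + 1))) {0..t}"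
      using has_integral_mult_right[OF has_integral_powr_from_0[of "h - 1" t], of "Gamma (1 - h)"] h t by simp
    show "0 \<le> Gamma (1 - h) * x powr (h - 1)" for x
      using h by simp
  qed
  finally show ?thesis by simp
qed

text \<open>The difference \<open>1 - (1 + y) powr (- p)\<close> is a Gamma mixture in
  \<open>t\<close> of \<open>exp (- t) * (1 - exp (- (t * y)))\<close>, which reduces the claim to
  \<open>nn_one_minus_exp\<close>. The value produces the constant of Hardy's inequality.\<close>

lemma nn_one_minus_powr:
  assumes h: "0 < h" "h < 1" and p: "0 < p"
  shows "(NPINT y. ennreal (y powr (- h - 1) * (1 - (1 + y) powr (- p)))) = ennreal (Gamma (1 - h) / h * (Gamma (p + h) / Gamma p))"
proof -
  have G: "0 < Gamma p" "0 < Gamma (p + h)" "0 < Gamma (1 - h)" using p h by auto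
  let ?h1 = "\<lambda>y t. ennreal (y powr (- h - 1) / Gamma p * (t powr (p - 1) * (exp (- (1 * t)) - exp (- ((1 + y) * t)))))"
  let ?h2 = "\<lambda>t. ennreal (Gamma (1 - h) / h / Gamma p * (t powr (p + h - 1) * exp (- (1 * t))))"
  let ?h3 = "\<lambda>y. ennreal (y powr (- h - 1) * (1 - (1 + y) powr (- p)))"
  have "(NPINT y. ?h3 y) = (NPINT y. NPINT t. ?h1 y t)"
  proof (rule nn_lpos_cong)
    fix y :: real assume y: "0 < y"
    have "(NPINT t. ?h1 y t) = ennreal (y powr (- h - 1) / Gamma p) * ennreal (Gamma p * (1 powr (- p) - (1 + y) powr (- p)))"
      using G p y by (subst nn_cmult_real, simp, simp, subst nn_Gamma_diff) auto
    also have "\<dots> = ?h3 y"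
      using G by (subst ennreal_mult'[symmetric]) auto
    finally show "?h3 y = (NPINT t. ?h1 y t)" ..
  qed
  also have "\<dots> = (NPINT t. NPINT y. ?h1 y t)"
    by (rule lpos_lpos.Fubini') measurable
  also have "\<dots> = (NPINT t. ?h2 t)"
  proof (rule nn_lpos_cong)
    fix t :: real assume t: "0 < t"
    have "y powr (- h - 1) / Gamma p * (t powr (p - 1) * (exp (- (1 * t)) - exp (- ((1 + y) * t)))) =
      t powr (p - 1) * exp (- t) / Gamma p * (y powr (- h - 1) * (1 - exp (- (t * y))))" for y
    proof -
      have "exp (- ((1 + y) * t)) = exp (- t) * exp (- (t * y))"
        by (simp add: exp_add[symmetric] algebra_simps)
      then show ?thesis by (simp add: algebra_simps)
    qed
    then have "(NPINT y. ?h1 y t) = (NPINT y. ennreal (t powr (p - 1) * exp (- t) / Gamma p * (y powr (- h - 1) * (1 - exp (- (t * y))))))"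
      by (simp only:)
    also have "\<dots> = ennreal (t powr (p - 1) * exp (- t) / Gamma p) * ennreal (Gamma (1 - h) / h * t powr h)"
      using G h t by (subst nn_cmult_real, simp, simp, subst nn_one_minus_exp) auto
    also have "\<dots> = ?h2 t"
    proof -
      have e: "t powr (p + h - 1) = t powr (p - 1) * t powr h"
        using t by (simp add: powr_add[symmetric] algebra_simps)
      show ?thesis unfolding e
        using G h by (subst ennreal_mult'[symmetric]) (auto simp: mult_ac)
    qed
    finally show "(NPINT y. ?h1 y t) = ?h2 t" .
  qed
  also have "\<dots> = ennreal (Gamma (1 - h) / h / Gamma p) * ennreal (Gamma (p + h) * 1 powr (- (p + h)))"
    using G h p by (subst nn_cmult_real, simp, simp, subst nn_Gamma) auto
  also have "\<dots> = ennreal (Gamma (1 - h) / h * (Gamma (p + h) / Gamma p))"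
    using G h by (subst ennreal_mult'[symmetric]) (auto simp: mult_ac)
  finally show ?thesis .
qed

text \<open>Only the difference is integrable: each term alone behaves like
  \<open>t powr (h - 1)\<close> at infinity. As a Laplace integral in \<open>v\<close> the
  difference carries the factor \<open>1 - exp (- (c * v))\<close>, and the
  \<open>t\<close>-integral becomes a Gamma integral.\<close>

lemma nn_powr_diff:
  assumes h: "0 < h" "h < 1" and p: "0 < p" and c: "0 < c"
  shows "(NPINT t. ennreal (t powr (p + h - 1) * (t powr (- p) - (t + c) powr (- p)))) =
         ennreal (Gamma (1 - h) / h * (Gamma (p + h) / Gamma p) * c powr h)"
proof -
  have G: "0 < Gamma p" "0 < Gamma (p + h)" "0 < Gamma (1 - h)" using p h by auto
  let ?h1 = "\<lambda>t v. ennreal (t powr (p + h - 1) / Gamma p * (v powr (p - 1) * (exp (- (t * v)) - exp (- ((t + c) * v)))))"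
  let ?h2 = "\<lambda>v. ennreal (Gamma (p + h) / Gamma p * (v powr (- h - 1) * (1 - exp (- (c * v)))))"
  let ?h3 = "\<lambda>t. ennreal (t powr (p + h - 1) * (t powr (- p) - (t + c) powr (- p)))"
  have "(NPINT t. ?h3 t) = (NPINT t. NPINT v. ?h1 t v)"
  proof (rule nn_lpos_cong)
    fix t :: real assume t: "0 < t"
    have "(NPINT v. ?h1 t v) = ennreal (t powr (p + h - 1) / Gamma p) * ennreal (Gamma p * (t powr (- p) - (t + c) powr (- p)))"
      using G p t c by (subst nn_cmult_real, simp, simp, subst nn_Gamma_diff) auto
    also have "\<dots> = ?h3 t"
      using G by (subst ennreal_mult'[symmetric]) auto
    finally show "?h3 t = (NPINT v. ?h1 t v)" ..
  qed
  also have "\<dots> = (NPINT v. NPINT t. ?h1 t v)"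
    by (rule lpos_lpos.Fubini') measurable
  also have "\<dots> = (NPINT v. ?h2 v)"
  proof (rule nn_lpos_cong)
    fix v :: real assume v: "0 < v"
    have ex: "exp (- (c * v)) \<le> 1" using c v by simp
    have "t powr (p + h - 1) / Gamma p * (v powr (p - 1) * (exp (- (t * v)) - exp (- ((t + c) * v)))) =
      v powr (p - 1) * (1 - exp (- (c * v))) / Gamma p * (t powr (p + h - 1) * exp (- (v * t)))" for t
    proof -
      have e: "exp (- ((t + c) * v)) = exp (- (v * t)) * exp (- (c * v))"
        by (simp add: exp_add[symmetric] algebra_simps)
      show ?thesis unfolding e by (simp add: algebra_simps diff_divide_distrib)
    qed
    then have "(NPINT t. ?h1 t v) = (NPINT t. ennreal (v powr (p - 1) * (1 - exp (- (c * v))) / Gamma p * (t powr (p + h - 1) * exp (- (v * t)))))"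
      by (simp only:)
    also have "\<dots> = ennreal (v powr (p - 1) * (1 - exp (- (c * v))) / Gamma p) * ennreal (Gamma (p + h) * v powr (- (p + h)))"
      using G h p v ex by (subst nn_cmult_real, simp, simp, subst nn_Gamma) auto
    also have "\<dots> = ?h2 v"
    proof -
      have e: "v powr (- h - 1) = v powr (p - 1) * v powr (- (p + h))"
        by (subst powr_add[symmetric]) (rule powr_exponent_cong, simp)
      show ?thesis unfolding e
        using G ex by (subst ennreal_mult'[symmetric]) (auto simp: mult_ac)
    qed
    finally show "(NPINT t. ?h1 t v) = ?h2 v" .
  qed
  also have "\<dots> = ennreal (Gamma (p + h) / Gamma p) * ennreal (Gamma (1 - h) / h * c powr h)"
    using G h p c by (subst nn_cmult_real, simp, simp, subst nn_one_minus_exp) auto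
  also have "\<dots> = ennreal (Gamma (1 - h) / h * (Gamma (p + h) / Gamma p) * c powr h)"
    using G h by (subst ennreal_mult'[symmetric]) (auto simp: mult_ac)
  finally show ?thesis .
qed

section \<open>Affine substitutions and Gaussian integrals on Euclidean space\<close>

lemma nn_lborel_affine:
  fixes t :: "'a::euclidean_space"
  assumes [measurable]: "f \<in> borel_measurable borel" and c: "c \<noteq> 0"
  shows "(NBINT x. f x) = ennreal (\<bar>c\<bar> ^ DIM('a)) * (NBINT x. f (t + c *\<^sub>R x))"
proof -
  have "(NBINT x. f x) = (\<integral>\<^sup>+ x. f x \<partial>density (distr lborel borel (\<lambda>x. t + c *\<^sub>R x)) (\<lambda>_. \<bar>c\<bar> ^ DIM('a)))"
    using lborel_affine[of c t] c by (metis less_irrefl)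
  also have "\<dots> = ennreal (\<bar>c\<bar> ^ DIM('a)) * (NBINT x. f (t + c *\<^sub>R x))"
    using c by (simp add: nn_integral_density nn_integral_distr nn_integral_cmult)
  finally show ?thesis .
qed

lemma nn_lborel_translate:
  fixes c :: "'a::euclidean_space"
  assumes "f \<in> borel_measurable borel"
  shows "(NBINT x. f (c + x)) = (NBINT x. f x)"
  using nn_lborel_affine[OF assms, of 1 c] by simp

lemma nn_lborel_reflect:
  fixes c :: "'a::euclidean_space"
  assumes "f \<in> borel_measurable borel"
  shows "(NBINT x. f (c - x)) = (NBINT x. f x)"
  using nn_lborel_affine[OF assms, of "-1" c] by simp

lemma nn_lborel_scale:
  assumes "f \<in> borel_measurable (borel :: 'a::euclidean_space measure)" and "0 < c"
  shows "(NBINT x. f x) = ennreal (c ^ DIM('a)) * (NBINT x. f (c *\<^sub>R x))"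
  using nn_lborel_affine[OF assms(1), of c 0] assms(2) by simp

lemma nn_gauss_real:
  assumes t: "0 < t"
  shows "(NBINT x. ennreal (exp (- (t * x\<^sup>2)))) = ennreal (sqrt (pi / t))"
proof -
  let ?h = "\<lambda>x. ennreal (indicator {0..} x * exp (- x\<^sup>2))"
  have H: "(NBINT x. ?h x) = ennreal (sqrt pi / 2)"
  proof -
    have "has_bochner_integral lborel (\<lambda>x. indicator {0..} x * exp (- x\<^sup>2)) (sqrt pi / 2)"
      using gaussian_moment_0 by simp
    then show ?thesis
      unfolding has_bochner_integral_iff
      by (subst nn_integral_eq_integral) (auto intro!: AE_I2 simp: indicator_def)
  qed
  \<comment> \<open>The known Gaussian moment covers the half-line \<open>{0..}\<close>; the other
    half is added by reflection, the common point 0 being a null set.\<close>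
  have "(NBINT x. ennreal (exp (- x\<^sup>2))) = (NBINT x. ?h x + ennreal (indicator {0..} (- x) * exp (- (- x)\<^sup>2)))"
  proof (rule nn_lborel_cong)
    fix x :: real assume "x \<noteq> 0"
    then consider "x < 0" | "0 < x" by linarith
    then show "ennreal (exp (- x\<^sup>2)) = ?h x + ennreal (indicator {0..} (- x) * exp (- (- x)\<^sup>2))"
      by cases auto
  qed
  also have "\<dots> = (NBINT x. ?h x) + (NBINT x. ennreal (indicator {0..} (0 - x) * exp (- (0 - x)\<^sup>2)))"
    by (subst nn_integral_add) auto
  also have "(NBINT x. ennreal (indicator {0..} (0 - x) * exp (- (0 - x)\<^sup>2))) = (\<integral>\<^sup>+ x. ?h x \<partial>(lborel :: real measure))"
    by (rule nn_lborel_reflect[of "\<lambda>x::real. ?h x" 0]) simp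
  finally have "(NBINT x. ennreal (exp (- x\<^sup>2))) = ennreal (sqrt pi)"
    unfolding H by (simp add: ennreal_plus[symmetric] del: ennreal_plus)
  then have "ennreal (sqrt pi) = ennreal (sqrt t) * (NBINT x. ennreal (exp (- (t * x\<^sup>2))))"
    using t by (subst (asm) nn_integral_real_affine[where c = "sqrt t" and t = 0]) (auto simp: power_mult_distrib)
  then have "ennreal (1 / sqrt t) * ennreal (sqrt pi) = ennreal (1 / sqrt t) * ennreal (sqrt t) * (NBINT x. ennreal (exp (- (t * x\<^sup>2))))"
    by (simp add: mult.assoc)
  also have "ennreal (1 / sqrt t) * ennreal (sqrt t) = 1"
    using t by (simp add: ennreal_mult'[symmetric])
  finally show ?thesis
    using t by (simp add: ennreal_mult'[symmetric] real_sqrt_divide)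
qed

abbreviation gauss :: "real \<Rightarrow> 'a::real_normed_vector \<Rightarrow> real" where
  "gauss t x \<equiv> exp (- (t * (norm x)\<^sup>2))"

lemma nn_gauss:
  assumes t: "0 < t"
  shows "(NBINT x. ennreal (gauss t (x :: 'a::euclidean_space))) = ennreal ((pi / t) powr (real DIM('a) / 2))"
proof -
  have "ennreal (gauss t x) = (\<Prod>b\<in>Basis. ennreal (exp (- (t * (x \<bullet> b)\<^sup>2))))" for x :: 'a
  proof -
    have "(norm x)\<^sup>2 = (\<Sum>b\<in>Basis. (x \<bullet> b)\<^sup>2)"
      unfolding power2_norm_eq_inner by (subst euclidean_inner) (simp add: power2_eq_square)
    then show ?thesis
      by (simp add: prod_ennreal exp_sum[symmetric] sum_distrib_left sum_negf)
  qed
  then have "(NBINT x. ennreal (gauss t (x :: 'a))) = (\<Prod>b\<in>(Basis :: 'a set). (NBINT x. ennreal (exp (- (t * x\<^sup>2)))))"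
    by (simp only:) (subst nn_integral_lborel_prod, auto)
  also have "\<dots> = ennreal (sqrt (pi / t) ^ DIM('a))"
    using t by (simp add: nn_gauss_real ennreal_power)
  also have "sqrt (pi / t) ^ DIM('a) = (pi / t) powr (real DIM('a) / 2)"
    using t by (simp add: powr_half_sqrt[symmetric] powr_realpow[symmetric] powr_powr)
  finally show ?thesis .
qed

lemma nn_gauss_conv:
  fixes x :: "'a::euclidean_space"
  assumes t: "0 < t" and u: "0 < u"
  shows "(NBINT y. ennreal (gauss t (x - y) * gauss u y)) = ennreal ((pi / (t + u)) powr (real DIM('a) / 2) * gauss (t * u / (t + u)) x)"
proof -
  \<comment> \<open>The point \<open>c\<close> minimises \<open>t |x - y|^2 + u |y|^2\<close> in
    \<open>y\<close>. After shifting the origin there, the mixed term has coefficient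
    \<open>u * w - t * k = 0\<close> and the square is complete.\<close>
  define w k where "w = t / (t + u)" and "k = u / (t + u)"
  define c where "c = w *\<^sub>R x"
  have wk: "w = 1 - k" "u * w = t * k"
    using t u by (auto simp: w_def k_def field_simps)
  have e: "gauss t (x - (c + y)) * gauss u (c + y) = gauss (t * u / (t + u)) x * gauss (t + u) y" for y
  proof -
    have 1: "x - (c + y) = k *\<^sub>R x - y"
      by (simp add: c_def wk algebra_simps)
    have "t * (norm (x - (c + y)))\<^sup>2 + u * (norm (c + y))\<^sup>2 =
      (t * k\<^sup>2 + u * w\<^sup>2) * (x \<bullet> x) + (t + u) * (y \<bullet> y) + 2 * (u * w - t * k) * (x \<bullet> y)"
      unfolding 1 unfolding c_def power2_norm_eq_inner
      by (simp add: inner_simps inner_commute power2_eq_square algebra_simps)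
    also have "t * k\<^sup>2 + u * w\<^sup>2 = t * k * (k + w)"
      using wk(2) by (simp add: power2_eq_square algebra_simps)
    also have "\<dots> = t * u / (t + u)"
      by (simp add: wk(1)) (simp add: k_def)
    also have "u * w - t * k = 0" using wk by simp
    finally show ?thesis
      by (simp add: exp_add[symmetric] power2_norm_eq_inner)
  qed
  have "(NBINT y. ennreal (gauss t (x - y) * gauss u y)) = (NBINT y. ennreal (gauss t (x - (c + y)) * gauss u (c + y)))"
    by (rule nn_lborel_translate[symmetric]) measurable
  also have "\<dots> = ennreal (gauss (t * u / (t + u)) x) * (NBINT y. ennreal (gauss (t + u) (y::'a)))"
    unfolding e by (rule nn_cmult_real) auto
  also have "\<dots> = ennreal ((pi / (t + u)) powr (real DIM('a) / 2) * gauss (t * u / (t + u)) x)"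
    using t u by (subst nn_gauss) (auto simp: ennreal_mult'[symmetric] mult_ac)
  finally show ?thesis .
qed

lemma norm_powr_subordination:
  fixes z :: "'a::real_normed_vector"
  assumes "0 < a" and z: "z \<noteq> 0"
  shows "ennreal (Gamma (a / 2) * norm z powr (- a)) = (NPINT t. ennreal (t powr (a / 2 - 1) * gauss t z))"
  using nn_Gamma[of "a / 2" "(norm z)\<^sup>2"] assms by (simp add: norm_square_powr mult.commute)

section \<open>Gaussian subordination and Riesz composition\<close>

lemma ennreal_eq_divideI:
  assumes "0 < G" "ennreal G * X = ennreal R"
  shows "X = ennreal (R / G)"
proof -
  have "X = ennreal (1 / G) * (ennreal G * X)"
    using assms(1) by (simp add: mult.assoc[symmetric] ennreal_mult'[symmetric])
  also have "\<dots> = ennreal (R / G)"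
    unfolding assms(2) using assms(1) by (simp add: ennreal_mult'[symmetric])
  finally show ?thesis .
qed

lemma powr_divide_eq:
  fixes x y a :: real
  assumes "0 \<le> x" "0 < y"
  shows "(x / y) powr a = x powr a * y powr (- a)"
  using assms by (simp add: powr_divide powr_minus_divide)

lemma norm_powr_subordination_mult:
  fixes z :: "'a::real_normed_vector"
  assumes "0 < a" and "z \<noteq> 0" and k: "0 \<le> k"
  shows "ennreal (k * (Gamma (a / 2) * norm z powr (- a))) = (NPINT t. ennreal (k * (t powr (a / 2 - 1) * gauss t z)))"
  unfolding ennreal_mult'[OF k] norm_powr_subordination[OF assms(1,2)]
  by (rule nn_integral_cmult[symmetric]) measurable

lemma nn_gauss_diff:
  assumes t: "0 < t" "t \<le> u"
  shows "(NBINT x. ennreal (gauss t (x :: 'a::euclidean_space) - gauss u x)) =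
         ennreal ((pi / t) powr (real DIM('a) / 2) - (pi / u) powr (real DIM('a) / 2))"
proof -
  have "(NBINT x. ennreal (gauss t (x :: 'a) - gauss u x)) = (NBINT x. ennreal (gauss t (x :: 'a)) - ennreal (gauss u x))"
    by (simp add: ennreal_minus)
  also have "\<dots> = (NBINT x. ennreal (gauss t (x :: 'a))) - (NBINT x. ennreal (gauss u (x :: 'a)))"
  proof (rule nn_integral_diff)
    show "(NBINT x. ennreal (gauss u (x :: 'a))) \<noteq> \<infinity>"
      using t by (subst nn_gauss) auto
    show "AE x in lborel. ennreal (gauss u (x :: 'a)) \<le> ennreal (gauss t x)"
      using t by (intro AE_I2 ennreal_leI) (simp add: mult_right_mono)
  qed auto
  also have "\<dots> = ennreal ((pi / t) powr (real DIM('a) / 2) - (pi / u) powr (real DIM('a) / 2))"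
    using t by (subst (1 2) nn_gauss) (auto simp: ennreal_minus)
  finally show ?thesis .
qed

text \<open>In place of polar coordinates, the power is expanded into Gaussians; the space integral
  is then a Gaussian convolution evaluated at 0, and the remaining \<open>t\<close>-integral is of
  Beta type.\<close>

lemma nn_norm_powr_gauss:
  assumes a: "0 < a" "a < real DIM('a::euclidean_space)"
  shows "(NBINT x. ennreal (norm (x :: 'a) powr (- a) * exp (- (norm x)\<^sup>2))) =
     ennreal (pi powr (real DIM('a) / 2) * Gamma ((real DIM('a) - a) / 2) / Gamma (real DIM('a) / 2))"
proof -
  define N where "N = real DIM('a)"
  have G: "0 < Gamma (a / 2)" "0 < Gamma ((N - a) / 2)" "0 < Gamma (N / 2)" using a by (auto simp: N_def)
  let ?h1 = "\<lambda>t (x :: 'a). ennreal (t powr (a / 2 - 1) * (gauss t (0 - x) * gauss 1 x))"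
  let ?h2 = "\<lambda>t. ennreal (pi powr (N / 2) * (t powr (a / 2 - 1) * (1 + t) powr (- (a / 2 + (N - a) / 2))))"
  let ?h3 = "Gamma (a / 2) * Gamma ((N - a) / 2) / Gamma (N / 2)"
  have "ennreal (Gamma (a / 2)) * (NBINT x. ennreal (norm (x :: 'a) powr (- a) * exp (- (norm x)\<^sup>2))) =
     (NBINT x. ennreal (Gamma (a / 2) * norm (x :: 'a) powr (- a) * exp (- (norm x)\<^sup>2)))"
    using G by (subst nn_cmult_real[symmetric]) (auto simp: mult.assoc)
  also have "\<dots> = (NBINT x. NPINT t. ?h1 t x)"
  proof (rule nn_lborel_cong)
    fix x :: 'a assume "x \<noteq> 0"
    show "ennreal (Gamma (a / 2) * norm x powr (- a) * exp (- (norm x)\<^sup>2)) = (NPINT t. ?h1 t x)"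
      using norm_powr_subordination_mult[OF a(1) \<open>x \<noteq> 0\<close>, of "exp (- (norm x)\<^sup>2)"] by (simp add: mult_ac)
  qed
  also have "\<dots> = (NPINT t. NBINT x. ?h1 t x)"
    by (rule lpos_lborel.Fubini') measurable
  also have "\<dots> = (NPINT t. ?h2 t)"
  proof (rule nn_lpos_cong)
    fix t :: real assume t: "0 < t"
    have "(NBINT x. ?h1 t x) = ennreal (t powr (a / 2 - 1)) * ennreal ((pi / (t + 1)) powr (real DIM('a) / 2) * gauss (t * 1 / (t + 1)) (0::'a))"
      using t by (subst nn_cmult_real, simp, simp, subst nn_gauss_conv) auto
    also have "\<dots> = ?h2 t"
    proof -
      have e: "- (a / 2 + (N - a) / 2) = - (N / 2)" by (simp add: field_simps)
      show ?thesis unfolding e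
        using t by (subst ennreal_mult'[symmetric]) (auto simp: N_def powr_divide_eq add.commute mult_ac)
    qed
    finally show "(NBINT x. ?h1 t x) = ?h2 t" .
  qed
  also have "\<dots> = ennreal (pi powr (N / 2)) * ennreal (Gamma (a / 2) * Gamma ((N - a) / 2) / Gamma (a / 2 + (N - a) / 2))"
    using a by (subst nn_cmult_real, simp, simp, subst nn_Beta) (auto simp: N_def)
  also have "a / 2 + (N - a) / 2 = N / 2" by (simp add: field_simps)
  also have "ennreal (pi powr (N / 2)) * ennreal ?h3 = ennreal (pi powr (N / 2) * ?h3)"
    by (simp add: ennreal_mult'[symmetric])
  finally have "(NBINT x. ennreal (norm (x :: 'a) powr (- a) * exp (- (norm x)\<^sup>2))) = ennreal (pi powr (N / 2) * ?h3 / Gamma (a / 2))"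
    using ennreal_eq_divideI G(1) by blast
  also have "pi powr (N / 2) * ?h3 / Gamma (a / 2) = pi powr (N / 2) * Gamma ((N - a) / 2) / Gamma (N / 2)"
    using G by simp
  finally show ?thesis by (simp add: N_def)
qed

text \<open>Under the expansion of the power, \<open>1 - gauss c\<close> turns each slice
  \<open>gauss t\<close> into \<open>gauss t - gauss (t + c)\<close>, whose mass is a difference of
  powers as in \<open>nn_powr_diff\<close>. This is the only place where the singular kernel of the
  energy is integrated exactly.\<close>

lemma nn_norm_powr_one_minus_gauss:
  assumes s: "0 < s" "s < 2" and c: "0 < c"
  shows "(NBINT z. ennreal (norm (z :: 'a::euclidean_space) powr (- (real DIM('a) + s)) * (1 - gauss c z))) =
     ennreal (2 / s * pi powr (real DIM('a) / 2) * Gamma (1 - s / 2) / Gamma (real DIM('a) / 2) * c powr (s / 2))"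
proof -
  define N where "N = real DIM('a)"
  have N: "0 < N" by (simp add: N_def)
  have G: "0 < Gamma ((N + s) / 2)" "0 < Gamma (1 - s / 2)" "0 < Gamma (N / 2)" using s N by auto
  let ?h1 = "\<lambda>t (z :: 'a). ennreal (t powr ((N + s) / 2 - 1) * (gauss t z - gauss (t + c) z))"
  let ?h2 = "Gamma (1 - s / 2) / (s / 2) * (Gamma (N / 2 + s / 2) / Gamma (N / 2)) * c powr (s / 2)"
  let ?h3 = "\<lambda>(z :: 'a). ennreal (Gamma ((N + s) / 2) * norm z powr (- (N + s)) * (1 - gauss c z))"
  let ?h4 = "\<lambda>t. ennreal (pi powr (N / 2) * (t powr (N / 2 + s / 2 - 1) * (t powr (- (N / 2)) - (t + c) powr (- (N / 2)))))"
  have "ennreal (Gamma ((N + s) / 2)) * (NBINT z. ennreal (norm (z :: 'a) powr (- (N + s)) * (1 - gauss c z))) = (NBINT z. ?h3 z)"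
    using G by (subst nn_cmult_real[symmetric]) (auto simp: mult.assoc)
  also have "\<dots> = (NBINT z. NPINT t. ?h1 t z)"
  proof (rule nn_lborel_cong)
    fix z :: 'a assume "z \<noteq> 0"
    have ex: "0 \<le> 1 - gauss c z" using c by simp
    have "?h3 z = ennreal ((1 - gauss c z) * (Gamma ((N + s) / 2) * norm z powr (- (N + s))))"
      by (simp only: mult_ac)
    also have "\<dots> = (NPINT t. ennreal ((1 - gauss c z) * (t powr ((N + s) / 2 - 1) * gauss t z)))"
      by (rule norm_powr_subordination_mult) (use N s ex \<open>z \<noteq> 0\<close> in auto)
    also have "\<dots> = (NPINT t. ?h1 t z)"
    proof (rule nn_integral_cong)
      fix t
      have "gauss (t + c) z = gauss t z * gauss c z"
        by (simp add: exp_add[symmetric] algebra_simps)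
      then show "ennreal ((1 - gauss c z) * (t powr ((N + s) / 2 - 1) * gauss t z)) = ?h1 t z"
        by (simp only:) (simp add: algebra_simps)
    qed
    finally show "?h3 z = \<dots>" .
  qed
  also have "\<dots> = (NPINT t. NBINT z. ?h1 t z)"
    by (rule lpos_lborel.Fubini') measurable
  also have "\<dots> = (NPINT t. ?h4 t)"
  proof (rule nn_lpos_cong)
    fix t :: real assume t: "0 < t"
    have "(NBINT z. ?h1 t z) =
      ennreal (t powr ((N + s) / 2 - 1)) * ennreal ((pi / t) powr (real DIM('a) / 2) - (pi / (t + c)) powr (real DIM('a) / 2))"
      using t c by (subst nn_cmult_real, simp, simp, subst nn_gauss_diff) auto
    also have "\<dots> = ?h4 t"
      using t c by (subst ennreal_mult'[symmetric]) (auto simp: N_def powr_divide_eq algebra_simps add_divide_distrib)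
    finally show "(NBINT z. ?h1 t z) = \<dots>" .
  qed
  also have "\<dots> = ennreal (pi powr (N / 2)) * ennreal ?h2"
    using s c N by (subst nn_cmult_real, simp, simp, subst nn_powr_diff) auto
  also have "\<dots> = ennreal (pi powr (N / 2) * ?h2)"
    by (simp add: ennreal_mult'[symmetric])
  finally have "(NBINT z. ennreal (norm (z :: 'a) powr (- (N + s)) * (1 - gauss c z))) = ennreal (pi powr (N / 2) * ?h2 / Gamma ((N + s) / 2))"
    using ennreal_eq_divideI G(1) by blast
  also have "pi powr (N / 2) * ?h2 / Gamma ((N + s) / 2) = 2 / s * pi powr (N / 2) * Gamma (1 - s / 2) / Gamma (N / 2) * c powr (s / 2)"
    using G by (simp add: add_divide_distrib[symmetric])
  finally show ?thesis by (simp add: N_def)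
qed

text \<open>Both powers are expanded into Gaussians, which convolve explicitly. By homogeneity the
  resulting double integral separates in the variables \<open>t\<close> and
  \<open>v = u / t\<close>: the \<open>t\<close>-integral gives the power of \<open>norm x\<close>,
  the \<open>v\<close>-integral a Beta value. The condition \<open>N < a + b\<close> is convergence
  at infinity and makes the exponent \<open>e\<close> positive.\<close>

lemma nn_riesz_composition:
  fixes x :: "'a::euclidean_space"
  assumes a: "0 < a" "a < real DIM('a)" and b: "0 < b" "b < real DIM('a)" and ab: "real DIM('a) < a + b" and x: "x \<noteq> 0"
  shows "(NBINT y. ennreal (norm (x - y) powr (- a) * norm y powr (- b))) = ennreal (pi powr (real DIM('a) / 2) *
      (Gamma ((real DIM('a) - a) / 2) * Gamma ((real DIM('a) - b) / 2) * Gamma ((a + b - real DIM('a)) / 2)) /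
      (Gamma (a / 2) * Gamma (b / 2) * Gamma (real DIM('a) - (a + b) / 2)) * norm x powr (real DIM('a) - a - b))"
proof -
  define N where "N = real DIM('a)"
  define e where "e = (a + b - N) / 2"
  have e: "0 < e" using ab by (simp add: e_def N_def)
  have G: "0 < Gamma (a / 2)" "0 < Gamma (b / 2)" using a b by auto
  let ?h1 = "\<lambda>v t. ennreal (pi powr (N / 2) * v powr (b / 2 - 1) * (1 + v) powr (- (N / 2)) * (t powr (e - 1) * exp (- (v / (1 + v) * (norm x)\<^sup>2 * t))))"
  let ?h2 = "\<lambda>t. NPINT u. ennreal (t powr (a / 2 - 1) * u powr (b / 2 - 1) * ((pi / (t + u)) powr (N / 2) * gauss (t * u / (t + u)) x))"
  let ?h3 = "\<lambda>t v. t powr (a / 2 - 1) * (t * v) powr (b / 2 - 1) * ((pi / (t + t * v)) powr (N / 2) * gauss (t * (t * v) / (t + t * v)) x)"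
  let ?h4 = "\<lambda>t u (y :: 'a). ennreal (t powr (a / 2 - 1) * u powr (b / 2 - 1) * (gauss t (x - y) * gauss u y))"
  let ?h5 = "\<lambda>v. v powr ((N - a) / 2 - 1) * (1 + v) powr (- ((N - a) / 2 + (N - b) / 2))"
  let ?h6 = "\<lambda>(y :: 'a). ennreal (Gamma (a / 2) * norm (x - y) powr (- a))"
  let ?h7 = "Gamma ((N - a) / 2) * Gamma ((N - b) / 2) / Gamma ((N - a) / 2 + (N - b) / 2)"
  let ?h8 = "\<lambda>(y :: 'a). ennreal (Gamma (b / 2) * norm y powr (- b))"
  have "ennreal (Gamma (a / 2) * Gamma (b / 2)) * (NBINT y. ennreal (norm (x - y) powr (- a) * norm y powr (- b))) = (NBINT y. ?h6 y * ?h8 y)"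
    using G by (subst nn_cmult_real[symmetric]) (auto simp: ennreal_mult'[symmetric] mult_ac)
  also have "\<dots> = (NBINT y. NPINT t. NPINT u. ?h4 t u y)"
  proof (rule nn_integral_cong_AE, rule AE_mp[OF AE_lborel_singleton[of 0]], rule AE_mp[OF AE_lborel_singleton[of x]], rule AE_I2, intro impI)
    fix y :: 'a assume y: "y \<noteq> x" "y \<noteq> 0"
    have "?h6 y * ?h8 y = (NPINT t. ennreal (t powr (a / 2 - 1) * gauss t (x - y))) * (NPINT u. ennreal (u powr (b / 2 - 1) * gauss u y))"
      using y a b by (subst (1 2) norm_powr_subordination) auto
    also have "\<dots> = (NPINT t. ennreal (t powr (a / 2 - 1) * gauss t (x - y)) * (NPINT u. ennreal (u powr (b / 2 - 1) * gauss u y)))"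
      by (rule nn_integral_multc[symmetric]) measurable
    also have "\<dots> = (NPINT t. NPINT u. ennreal (t powr (a / 2 - 1) * gauss t (x - y) * (u powr (b / 2 - 1) * gauss u y)))"
      by (intro nn_integral_cong nn_cmult_real[symmetric]) auto
    finally show "?h6 y * ?h8 y = (NPINT t. NPINT u. ?h4 t u y)"
      by (simp only: mult_ac)
  qed
  also have "\<dots> = (NPINT t. NBINT y. NPINT u. ?h4 t u y)"
    by (rule lpos_lborel.Fubini') measurable
  also have "\<dots> = (NPINT t. NPINT u. NBINT y. ?h4 t u y)"
    by (intro nn_integral_cong lpos_lborel.Fubini') measurable
  also have "\<dots> = (NPINT t. ?h2 t)"
    by (intro nn_lpos_cong, subst nn_cmult_real, simp, simp, subst nn_gauss_conv) (auto simp: N_def ennreal_mult'[symmetric])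
  also have "\<dots> = (NPINT t. NPINT v. ?h1 v t)"
  proof (rule nn_lpos_cong)
    fix t :: real assume t: "0 < t"
    have "(?h2 t) = ennreal t * (NPINT v. ennreal (?h3 t v))"
      using t by (subst nn_lpos_scale[of _ t]) auto
    also have "\<dots> = (NPINT v. ennreal (t * ?h3 t v))"
      using t by (subst nn_cmult_real) auto
    also have "\<dots> = (NPINT v. ?h1 v t)"
    proof (rule nn_lpos_cong)
      fix v :: real assume v: "0 < v"
      have tv: "t + t * v = t * (1 + v)" by (simp add: algebra_simps)
      have 1: "t * (t * v) / (t + t * v) * (norm x)\<^sup>2 = v / (1 + v) * (norm x)\<^sup>2 * t"
        unfolding tv using t v by simp
      have 2: "(pi / (t + t * v)) powr (N / 2) = pi powr (N / 2) * t powr (- (N / 2)) * (1 + v) powr (- (N / 2))"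
        unfolding tv using t v by (simp add: powr_divide_eq powr_mult)
      have 3: "t powr (e - 1) = t powr 1 * t powr (a / 2 - 1) * t powr (b / 2 - 1) * t powr (- (N / 2))"
        by (simp only: powr_add[symmetric]) (rule powr_exponent_cong, simp add: e_def field_simps)
      show "ennreal (t * ?h3 t v) = ?h1 v t"
        unfolding 1 2 3 using t v by (simp add: powr_mult mult_ac)
    qed
    finally show "(?h2 t) = \<dots>" .
  qed
  also have "\<dots> = (NPINT v. NPINT t. ?h1 v t)"
    by (rule lpos_lpos.Fubini') measurable
  also have "\<dots> = (NPINT v. ennreal (pi powr (N / 2) * Gamma e * norm x powr (N - a - b) * ?h5 v))"
  proof (rule nn_lpos_cong)
    fix v :: real assume v: "0 < v"
    have "(NPINT t. ?h1 v t)
      = ennreal (pi powr (N / 2) * v powr (b / 2 - 1) * (1 + v) powr (- (N / 2)) * (Gamma e * (v / (1 + v) * (norm x)\<^sup>2) powr (- e)))"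
      using v e x by (subst nn_cmult_real, simp, simp, subst nn_Gamma) (auto simp: ennreal_mult')
    also have "pi powr (N / 2) * v powr (b / 2 - 1) * (1 + v) powr (- (N / 2)) * (Gamma e * (v / (1 + v) * (norm x)\<^sup>2) powr (- e)) =
      pi powr (N / 2) * Gamma e * norm x powr (N - a - b) * ?h5 v"
    proof -
      have 1: "(v / (1 + v) * (norm x)\<^sup>2) powr (- e) = v powr (- e) * (1 + v) powr e * ((norm x)\<^sup>2) powr (- e)"
        using v by (simp add: powr_divide_eq powr_mult)
      have 2: "((norm x)\<^sup>2) powr (- e) = norm x powr (N - a - b)"
        unfolding norm_square_powr by (rule powr_exponent_cong) (simp add: e_def field_simps)
      have 3: "v powr ((N - a) / 2 - 1) = v powr (b / 2 - 1) * v powr (- e)"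
        by (simp only: powr_add[symmetric]) (rule powr_exponent_cong, simp add: e_def field_simps)
      have 4: "(1 + v) powr (- ((N - a) / 2 + (N - b) / 2)) = (1 + v) powr (- (N / 2)) * (1 + v) powr e"
        by (simp only: powr_add[symmetric]) (rule powr_exponent_cong, simp add: e_def field_simps)
      show ?thesis unfolding 1 2 3 4 by (simp only: mult_ac)
    qed
    finally show "(NPINT t. ?h1 v t) = ennreal (pi powr (N / 2) * Gamma e * norm x powr (N - a - b) * ?h5 v)" .
  qed
  also have "\<dots> = ennreal (pi powr (N / 2) * Gamma e * norm x powr (N - a - b) * ?h7)"
    using a b e by (subst nn_cmult_real, simp, simp, subst nn_Beta) (auto simp: N_def intro!: ennreal_mult'[symmetric, THEN trans])
  finally have "(NBINT y. ennreal (norm (x - y) powr (- a) * norm y powr (- b))) =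
     ennreal (pi powr (N / 2) * Gamma e * norm x powr (N - a - b) * ?h7 / (Gamma (a / 2) * Gamma (b / 2)))"
    by (rule ennreal_eq_divideI[rotated]) (use G in simp)
  moreover have "(N - a) / 2 + (N - b) / 2 = N - (a + b) / 2" by (simp add: field_simps)
  ultimately show ?thesis by (simp add: N_def e_def mult_ac)
qed

section \<open>The Stein--Weiss inequality\<close>

text \<open>Herbst's constant, the best one in the Hardy inequality of order \<open>a\<close>. With
  \<open>a = \<alpha>\<close> it is also the multiplier of the Riesz potential on its critical
  power, so one formula provides both factors of the final constant.\<close>

definition sharp_const :: "nat \<Rightarrow> real \<Rightarrow> real" where
  "sharp_const N a = 1 / 2 powr a * (Gamma ((real N - a) / 4) / Gamma ((real N + a) / 4))\<^sup>2"

lemma sharp_const_pos: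
  assumes "0 < a" "a < real N"
  shows "0 < sharp_const N a"
proof -
  have "0 < Gamma ((real N - a) / 4)" "0 < Gamma ((real N + a) / 4)" using assms by auto
  then show ?thesis unfolding sharp_const_def by simp
qed

lemma riesz_const_pos:
  assumes "0 < a" "a < real N"
  shows "0 < riesz_const N a"
  using assms unfolding riesz_const_def by (intro divide_pos_pos mult_pos_pos) auto

lemma sobolev_const_pos:
  assumes "0 < s" "s < 2"
  shows "0 < sobolev_const N s"
  using assms unfolding sobolev_const_def by (intro divide_pos_pos mult_pos_pos) auto

lemma riesz_potential_eq: "riesz_potential \<alpha> (z :: 'a::euclidean_space) = riesz_const DIM('a) \<alpha> * norm z powr (- (real DIM('a) - \<alpha>))"
  unfolding riesz_potential_def by (simp only: powr_minus divide_inverse)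

lemma riesz_potential_nonneg:
  assumes "0 < \<alpha>" "\<alpha> < real DIM('a)"
  shows "0 \<le> riesz_potential \<alpha> (z :: 'a::euclidean_space)"
  using riesz_const_pos[OF assms] unfolding riesz_potential_def by simp

lemma riesz_potential_minus: "riesz_potential \<alpha> (x - y) = riesz_potential \<alpha> (y - x)"
  unfolding riesz_potential_def by (simp add: norm_minus_commute)

lemma borel_measurable_riesz_potential [measurable]: "riesz_potential \<alpha> \<in> borel_measurable borel"
  unfolding riesz_potential_def[abs_def] by measurable

text \<open>The exponent \<open>(N + \<alpha>) / 2\<close> is the weight
  \<open>(\<alpha> + s) / 2\<close> plus the exponent \<open>(N - s) / 2\<close> of the ground
  state, so \<open>s\<close> drops out. It is the choice for which the Gamma factors of
  \<open>nn_riesz_composition\<close> coincide in pairs, whence the square in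
  \<open>sharp_const\<close>.\<close>

lemma nn_riesz_ground_state:
  fixes x :: "'a::euclidean_space"
  assumes \<alpha>: "0 < \<alpha>" "\<alpha> < real DIM('a)" and x: "x \<noteq> 0"
  shows "(NBINT y. ennreal (riesz_potential \<alpha> (x - y) * norm y powr (- ((real DIM('a) + \<alpha>) / 2)))) =
    ennreal (sharp_const DIM('a) \<alpha> * norm x powr (- ((real DIM('a) - \<alpha>) / 2)))"
proof -
  define N where "N = real DIM('a)"
  define C where "C = riesz_const DIM('a) \<alpha>"
  have C: "0 < C" using riesz_const_pos[OF \<alpha>] by (simp add: C_def)
  have aN: "\<alpha> < N" using \<alpha> by (simp add: N_def)
  have G: "0 < Gamma (\<alpha> / 2)" "0 < Gamma ((N - \<alpha>) / 2)" "0 < Gamma ((N + \<alpha>) / 4)" "0 < Gamma ((N - \<alpha>) / 4)"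
    using \<alpha> aN by auto
  have e: "(N - (N - \<alpha>)) / 2 = \<alpha> / 2" "(N - (N + \<alpha>) / 2) / 2 = (N - \<alpha>) / 4" "(N - \<alpha> + (N + \<alpha>) / 2 - N) / 2 = (N - \<alpha>) / 4"
    "(N + \<alpha>) / 2 / 2 = (N + \<alpha>) / 4" "N - (N - \<alpha> + (N + \<alpha>) / 2) / 2 = (N + \<alpha>) / 4" "N - (N - \<alpha>) - (N + \<alpha>) / 2 = - ((N - \<alpha>) / 2)"
    by (simp_all add: field_simps)
  have "(NBINT y. ennreal (riesz_potential \<alpha> (x - y) * norm y powr (- ((N + \<alpha>) / 2)))) =
     ennreal C * (NBINT y. ennreal (norm (x - y) powr (- (N - \<alpha>)) * norm y powr (- ((N + \<alpha>) / 2))))"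
    using C by (subst nn_cmult_real[symmetric]) (auto simp: riesz_potential_eq C_def N_def mult.assoc)
  also have "\<dots> = ennreal C * ennreal (pi powr (N / 2) * (Gamma (\<alpha> / 2) * Gamma ((N - \<alpha>) / 4) * Gamma ((N - \<alpha>) / 4)) /
      (Gamma ((N - \<alpha>) / 2) * Gamma ((N + \<alpha>) / 4) * Gamma ((N + \<alpha>) / 4)) * norm x powr (- ((N - \<alpha>) / 2)))"
    using nn_riesz_composition[of "N - \<alpha>" "(N + \<alpha>) / 2" x] \<alpha> aN x unfolding N_def[symmetric] e by simp
  also have "\<dots> = ennreal (sharp_const DIM('a) \<alpha> * norm x powr (- ((N - \<alpha>) / 2)))"
    using G C by (subst ennreal_mult'[symmetric])
      (auto simp: C_def riesz_const_def sharp_const_def N_def[symmetric] power2_eq_square)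
  finally show ?thesis by (simp add: N_def)
qed

lemma weighted_riesz_kernel_measurable [measurable]:
  assumes [measurable]: "\<phi> \<in> borel_measurable borel"
  shows "(\<lambda>(x, y). weighted_riesz_kernel \<alpha> s \<phi> x y) \<in> borel_measurable (borel \<Otimes>\<^sub>M borel)"
  unfolding weighted_riesz_kernel_def by measurable

text \<open>Pointwise form of the Schur test: the kernel is split as \<open>I * (X * Y)\<close> so
  that in \<open>X^2\<close> the variable \<open>y\<close> occurs only through the critical power of
  \<open>nn_riesz_ground_state\<close>, and symmetrically for \<open>Y^2\<close>; then
  \<open>2 * X * Y \<le> X^2 + Y^2\<close>.\<close>

lemma weighted_riesz_kernel_schur:
  fixes \<phi> :: "'a::euclidean_space \<Rightarrow> real" and \<alpha> s :: real
  assumes \<alpha>: "0 < \<alpha>" "\<alpha> < real DIM('a)"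
  defines "N \<equiv> real DIM('a)"
  defines "P \<equiv> \<lambda>x y. (\<phi> x)\<^sup>2 * norm x powr ((N - \<alpha>) / 2 - s) * (riesz_potential \<alpha> (x - y) * norm y powr (- ((N + \<alpha>) / 2)))"
  shows "2 * \<bar>weighted_riesz_kernel \<alpha> s \<phi> x y\<bar> \<le> P x y + P y x"
proof (cases "x = 0 \<or> y = 0")
  \<comment> \<open>At the origin the kernel divides by \<open>0 powr _ = 0\<close> and so has the
    default value 0.\<close>
  case True
  then show ?thesis
    using riesz_potential_nonneg[OF \<alpha>] by (auto simp: weighted_riesz_kernel_def P_def)
next
  case False
  then have p: "0 < norm x" "0 < norm y" by auto
  define I where "I = riesz_potential \<alpha> (x - y)"
  have I: "0 \<le> I" using riesz_potential_nonneg[OF \<alpha>] by (simp add: I_def)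
  define X Y where "X = \<bar>\<phi> x\<bar> * norm x powr ((N - \<alpha>) / 4 - s / 2) * norm y powr (- ((N + \<alpha>) / 4))"
    and "Y = \<bar>\<phi> y\<bar> * norm y powr ((N - \<alpha>) / 4 - s / 2) * norm x powr (- ((N + \<alpha>) / 4))"
  have e1: "norm x powr ((N - \<alpha>) / 2 - s) = (norm x powr ((N - \<alpha>) / 4 - s / 2))\<^sup>2"
       "norm y powr ((N - \<alpha>) / 2 - s) = (norm y powr ((N - \<alpha>) / 4 - s / 2))\<^sup>2"
    by (simp_all add: power2_eq_square powr_add[symmetric])
  have e2: "norm x powr (- ((N + \<alpha>) / 2)) = (norm x powr (- ((N + \<alpha>) / 4)))\<^sup>2"
       "norm y powr (- ((N + \<alpha>) / 2)) = (norm y powr (- ((N + \<alpha>) / 4)))\<^sup>2"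
    by (simp_all only: power2_eq_square powr_add[symmetric]) simp_all
  have P: "P x y = I * X\<^sup>2" "P y x = I * Y\<^sup>2"
    unfolding P_def e1 e2 X_def Y_def I_def riesz_potential_minus[of \<alpha> y x] by (simp_all add: power_mult_distrib)
  have e3: "norm x powr (- ((\<alpha> + s) / 2)) = norm x powr ((N - \<alpha>) / 4 - s / 2) * norm x powr (- ((N + \<alpha>) / 4))"
    "norm y powr (- ((\<alpha> + s) / 2)) = norm y powr ((N - \<alpha>) / 4 - s / 2) * norm y powr (- ((N + \<alpha>) / 4))"
    unfolding powr_add[symmetric] by (rule powr_exponent_cong, simp add: field_simps)+
  have "\<bar>weighted_riesz_kernel \<alpha> s \<phi> x y\<bar> = \<bar>\<phi> x\<bar> * norm x powr (- ((\<alpha> + s) / 2)) * I * (\<bar>\<phi> y\<bar> * norm y powr (- ((\<alpha> + s) / 2)))"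
    unfolding weighted_riesz_kernel_def I_def[symmetric] using I by (simp only: powr_minus divide_inverse) (simp add: abs_mult)
  also have "\<dots> = I * (X * Y)"
    unfolding e3 X_def Y_def by (simp only: mult_ac)
  finally have "2 * \<bar>weighted_riesz_kernel \<alpha> s \<phi> x y\<bar> = I * (2 * X * Y)" by simp
  also have "\<dots> \<le> I * (X\<^sup>2 + Y\<^sup>2)"
    using I sum_squares_bound[of X Y] by (intro mult_left_mono) auto
  finally show ?thesis unfolding P by (simp add: distrib_left)
qed

text \<open>The two halves of the Schur bound have the same integral by symmetry. Integrating out
  \<open>y\<close> replaces the critical power by
  \<open>norm x powr (- ((N - \<alpha>) / 2))\<close>, which with the other factor of
  \<open>P\<close> leaves exactly \<open>norm x powr (- s)\<close>. No finiteness is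
  required.\<close>

lemma stein_weiss:
  fixes \<phi> :: "'a::euclidean_space \<Rightarrow> real"
  assumes \<alpha>: "0 < \<alpha>" "\<alpha> < real DIM('a)" and [measurable]: "\<phi> \<in> borel_measurable borel"
  shows "(NBINT y. NBINT x. ennreal \<bar>weighted_riesz_kernel \<alpha> s \<phi> x y\<bar>) \<le>
    ennreal (sharp_const DIM('a) \<alpha>) * (NBINT x. ennreal ((\<phi> x)\<^sup>2 * norm x powr (- s)))"
proof -
  define N where "N = real DIM('a)"
  define P where "P = (\<lambda>x y. (\<phi> x)\<^sup>2 * norm x powr ((N - \<alpha>) / 2 - s) * (riesz_potential \<alpha> (x - y) * norm y powr (- ((N + \<alpha>) / 2))))"
  have P0: "0 \<le> P x y" for x y
    unfolding P_def using riesz_potential_nonneg[OF \<alpha>] by (intro mult_nonneg_nonneg) auto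
  have [measurable]: "(\<lambda>(x, y). P x y) \<in> borel_measurable (borel \<Otimes>\<^sub>M borel)"
    unfolding P_def by measurable
  define H where "H = (NBINT x. ennreal ((\<phi> x)\<^sup>2 * norm x powr (- s)))"
  let ?h = "\<lambda>(x :: 'a). ennreal (sharp_const DIM('a) \<alpha> * ((\<phi> x)\<^sup>2 * norm x powr (- s)))"
  have PH: "(NBINT x. NBINT y. ennreal (P x y)) = ennreal (sharp_const DIM('a) \<alpha>) * H"
  proof -
    have "(NBINT x. NBINT y. ennreal (P x y)) = (NBINT x. ?h x)"
    proof (rule nn_lborel_cong)
      fix x :: 'a assume x: "x \<noteq> 0"
      have "(NBINT y. ennreal (P x y)) = ennreal ((\<phi> x)\<^sup>2 * norm x powr ((N - \<alpha>) / 2 - s)) * ennreal (sharp_const DIM('a) \<alpha> * norm x powr (- ((N - \<alpha>) / 2)))"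
        unfolding P_def N_def by (subst nn_cmult_real, simp, simp, subst nn_riesz_ground_state[OF \<alpha> x]) auto
      also have "\<dots> = ennreal (sharp_const DIM('a) \<alpha> * ((\<phi> x)\<^sup>2 * (norm x powr ((N - \<alpha>) / 2 - s) * norm x powr (- ((N - \<alpha>) / 2)))))"
        using sharp_const_pos[OF \<alpha>] by (subst ennreal_mult'[symmetric]) (auto simp: mult_ac)
      also have "norm x powr ((N - \<alpha>) / 2 - s) * norm x powr (- ((N - \<alpha>) / 2)) = norm x powr (- s)"
        by (simp only: powr_add[symmetric]) simp
      finally show "(NBINT y. ennreal (P x y)) = ?h x" .
    qed
    also have "\<dots> = ennreal (sharp_const DIM('a) \<alpha>) * H"
      unfolding H_def using sharp_const_pos[OF \<alpha>] by (intro nn_cmult_real) auto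
    finally show ?thesis .
  qed
  have "2 * (NBINT y. NBINT x. ennreal \<bar>weighted_riesz_kernel \<alpha> s \<phi> x y\<bar>) =
    (NBINT y. NBINT x. 2 * ennreal \<bar>weighted_riesz_kernel \<alpha> s \<phi> x y\<bar>)"
    by (simp add: nn_integral_cmult)
  also have "\<dots> \<le> (NBINT y. NBINT x. ennreal (P x y) + ennreal (P y x))"
  proof (intro nn_integral_mono)
    fix x y
    have "2 * ennreal \<bar>weighted_riesz_kernel \<alpha> s \<phi> x y\<bar> = ennreal (2 * \<bar>weighted_riesz_kernel \<alpha> s \<phi> x y\<bar>)"
      by (simp add: ennreal_mult')
    also have "\<dots> \<le> ennreal (P x y + P y x)"
      unfolding P_def N_def by (rule ennreal_leI, rule weighted_riesz_kernel_schur[OF \<alpha>])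
    finally show "2 * ennreal \<bar>weighted_riesz_kernel \<alpha> s \<phi> x y\<bar> \<le> ennreal (P x y) + ennreal (P y x)"
      using P0 by (simp add: ennreal_plus)
  qed
  also have "\<dots> = (NBINT y. NBINT x. ennreal (P x y)) + (NBINT y. NBINT x. ennreal (P y x))"
    by (simp add: nn_integral_add)
  also have "(NBINT y. NBINT x. ennreal (P x y)) = (NBINT x. NBINT y. ennreal (P x y))"
    by (rule lborel_pair.Fubini') measurable
  also have "(NBINT x. NBINT y. ennreal (P x y)) + (NBINT y. NBINT x. ennreal (P y x)) = 2 * (ennreal (sharp_const DIM('a) \<alpha>) * H)"
    unfolding PH by (simp add: mult_2)
  finally show ?thesis
    unfolding H_def[symmetric] by (subst (asm) ennreal_mult_le_mult_iff) auto
qed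

section \<open>Gaussian mixtures for the ground state\<close>

lemma nn_gamma_kernel:
  fixes x :: "'a::real_normed_vector"
  assumes "0 < b" "0 < t" "x \<noteq> 0"
  shows "(NPINT v. ennreal (t powr (b / 2) * v powr (b / 2 - 1) * exp (- (t * (norm x)\<^sup>2 * v)))) = ennreal (Gamma (b / 2) * norm x powr (- b))"
proof -
  let ?h = "Gamma (b / 2) * (t * (norm x)\<^sup>2) powr (- (b / 2))"
  have "(NPINT v. ennreal (t powr (b / 2) * v powr (b / 2 - 1) * exp (- (t * (norm x)\<^sup>2 * v)))) = ennreal (t powr (b / 2)) * ennreal ?h"
    unfolding mult.assoc[of "t powr (b / 2)"]
    using assms by (subst nn_cmult_real, simp, simp, subst nn_Gamma) auto
  also have "\<dots> = ennreal (Gamma (b / 2) * norm x powr (- b))"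
  proof -
    have 1: "((norm x)\<^sup>2) powr (- (b / 2)) = norm x powr (- b)" by (simp add: norm_square_powr)
    have 2: "t powr (b / 2) * t powr (- (b / 2)) = 1" using assms by (simp only: powr_add[symmetric]) simp
    have "(t * (norm x)\<^sup>2) powr (- (b / 2)) = t powr (- (b / 2)) * norm x powr (- b)"
      unfolding 1[symmetric] using assms by (intro powr_mult)
    then have "t powr (b / 2) * ?h = (t powr (b / 2) * t powr (- (b / 2))) * (Gamma (b / 2) * norm x powr (- b))"
      by (simp only: mult_ac)
    then have 3: "t powr (b / 2) * ?h = Gamma (b / 2) * norm x powr (- b)"
      unfolding 2 by (simp only: mult_1_left)
    show ?thesis by (subst ennreal_mult'[symmetric], simp) (simp only: 3)
  qed
  finally show ?thesis .
qed

text \<open>The mixing variable is rescaled to \<open>v = u / t\<close>, the same scaling as in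
  \<open>nn_gamma_kernel\<close>. The power and its Gaussian average then become integrals over the
  same \<open>v\<close>, differing only by the factor \<open>(1 + v) powr (- (N / 2))\<close> and by
  \<open>v / (1 + v)\<close> in the exponent, and can be compared under the integral sign.\<close>

lemma nn_gauss_conv_powr:
  fixes x :: "'a::euclidean_space"
  assumes b: "0 < b" and t: "0 < t" and x: "x \<noteq> 0"
  shows "ennreal (Gamma (b / 2)) * (NBINT y. ennreal (gauss t (x - y) * norm y powr (- b))) = ennreal ((pi / t) powr (real DIM('a) / 2)) *
    (NPINT v. ennreal (t powr (b / 2) * v powr (b / 2 - 1) * (1 + v) powr (- (real DIM('a) / 2)) * exp (- (t * (norm x)\<^sup>2 * v / (1 + v)))))"
proof -
  define N where "N = real DIM('a)"
  have G: "0 < Gamma (b / 2)" using b by simp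
  let ?h1 = "\<lambda>v. t powr (b / 2) * v powr (b / 2 - 1) * (1 + v) powr (- (N / 2)) * exp (- (t * (norm x)\<^sup>2 * v / (1 + v)))"
  let ?h2 = "\<lambda>v. (t * v) powr (b / 2 - 1) * ((pi / (t + t * v)) powr (N / 2) * gauss (t * (t * v) / (t + t * v)) x)"
  let ?h3 = "\<lambda>(y :: 'a) u. ennreal (gauss t (x - y) * (u powr (b / 2 - 1) * gauss u y))"
  let ?h4 = "\<lambda>u. ennreal (u powr (b / 2 - 1) * ((pi / (t + u)) powr (N / 2) * gauss (t * u / (t + u)) x))"
  have "ennreal (Gamma (b / 2)) * (NBINT y. ennreal (gauss t (x - y) * norm y powr (- b))) =
    (NBINT y. ennreal (gauss t (x - y) * (Gamma (b / 2) * norm y powr (- b))))"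
    using G by (subst nn_cmult_real[symmetric]) (auto simp: mult_ac)
  also have "\<dots> = (NBINT y. NPINT u. ?h3 y u)"
    by (rule nn_lborel_cong[where c = 0], rule norm_powr_subordination_mult) (use b in auto)
  also have "\<dots> = (NPINT u. NBINT y. ?h3 y u)"
    by (rule lpos_lborel.Fubini') measurable
  also have "\<dots> = (NPINT u. ?h4 u)"
  proof (rule nn_lpos_cong)
    fix u :: real assume u: "0 < u"
    have "(NBINT y. ?h3 y u) = (NBINT y. ennreal (u powr (b / 2 - 1) * (gauss t (x - y) * gauss u y)))"
      by (simp only: mult_ac)
    also have "\<dots> = ?h4 u"
      using t u by (subst nn_cmult_real, simp, simp, subst nn_gauss_conv) (auto simp: N_def ennreal_mult')
    finally show "(NBINT y. ?h3 y u) = \<dots>" .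
  qed
  also have "\<dots> = ennreal t * (NPINT v. ennreal (?h2 v))"
    using t by (subst nn_lpos_scale[of _ t]) auto
  also have "\<dots> = (NPINT v. ennreal (t * ?h2 v))"
    using t by (subst nn_cmult_real) auto
  also have "\<dots> = (NPINT v. ennreal ((pi / t) powr (N / 2) * ?h1 v))"
  proof (rule nn_lpos_cong)
    fix v :: real assume v: "0 < v"
    have tv: "t + t * v = t * (1 + v)" by (simp add: algebra_simps)
    have 1: "t * (t * v) / (t + t * v) * (norm x)\<^sup>2 = t * (norm x)\<^sup>2 * v / (1 + v)"
      unfolding tv using t v by simp
    have 2: "(pi / (t + t * v)) powr (N / 2) = (pi / t) powr (N / 2) * (1 + v) powr (- (N / 2))"
      unfolding tv using t v by (simp add: powr_divide_eq powr_mult)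
    have 3: "t powr (b / 2) = t * t powr (b / 2 - 1)"
      using t by (simp add: powr_diff)
    show "ennreal (t * ?h2 v) = ennreal ((pi / t) powr (N / 2) * ?h1 v)"
      unfolding 1 2 3 using t v by (simp add: powr_mult mult_ac)
  qed
  also have "\<dots> = ennreal ((pi / t) powr (N / 2)) * (NPINT v. ennreal (?h1 v))"
    by (rule nn_cmult_real) auto
  finally show ?thesis by (simp add: N_def)
qed

section \<open>The sharp fractional Hardy inequality\<close>

text \<open>Picone's inequality with a bounded, integrable kernel. The total mass of the kernel is
  finite here, so the square can be expanded and the diagonal terms integrated; with the singular
  kernel of the energy they would be infinite.\<close>

lemma picone_sliced:
  fixes \<phi> :: "'a::euclidean_space \<Rightarrow> real"
  assumes [measurable]: "\<phi> \<in> borel_measurable borel" and t: "0 < t"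
  shows "2 * (ennreal ((pi / t) powr (real DIM('a) / 2)) * (NBINT x. ennreal ((\<phi> x)\<^sup>2))) \<le>
    (NBINT y. NBINT x. ennreal ((\<phi> x - \<phi> y)\<^sup>2 * gauss t (x - y))) +
    2 * (NBINT x. ennreal ((\<phi> x)\<^sup>2 * norm x powr b) * (NBINT y. ennreal (gauss t (x - y) * norm y powr (- b))))"
    (is "_ \<le> ?E + 2 * ?Q")
proof -
  define G where "G = (\<lambda>x y :: 'a. gauss t (x - y))"
  have Gm [measurable]: "(\<lambda>(x, y). G x y) \<in> borel_measurable (borel \<Otimes>\<^sub>M borel)"
    unfolding G_def by measurable
  have Gsym: "G x y = G y x" for x y by (simp add: G_def norm_minus_commute)
  have G0: "0 \<le> G x y" for x y by (simp add: G_def)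
  define W where "W = (\<lambda>x y :: 'a. (\<phi> x)\<^sup>2 * norm x powr b * (G x y * norm y powr (- b)))"
  have [measurable]: "(\<lambda>(x, y). W x y) \<in> borel_measurable (borel \<Otimes>\<^sub>M borel)"
    unfolding W_def by measurable
  have W0: "0 \<le> W x y" for x y by (simp add: W_def G0)
  let ?h1 = "\<lambda>(x :: 'a). NBINT y. ennreal ((\<phi> x)\<^sup>2 * G x y)"
  let ?h2 = "ennreal ((pi / t) powr (real DIM('a) / 2))"
  have GI: "(NBINT x. ?h1 x) = ?h2 * (NBINT x. ennreal ((\<phi> x)\<^sup>2))"
  proof -
    have "(?h1 x) = ?h2 * ennreal ((\<phi> x)\<^sup>2)" for x
    proof -
      have "(?h1 x) = ennreal ((\<phi> x)\<^sup>2) * (NBINT y. ennreal (gauss t (x - y)))"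
        unfolding G_def by (rule nn_cmult_real) auto
      also have "(NBINT y. ennreal (gauss t (x - y))) = (NBINT y. ennreal (gauss t (y :: 'a)))"
        by (rule nn_lborel_reflect[of "\<lambda>y. ennreal (gauss t y)"]) simp
      finally show ?thesis using t by (simp add: nn_gauss mult.commute)
    qed
    then show ?thesis by (simp add: nn_integral_cmult)
  qed
  have WI: "(NBINT x. NBINT y. ennreal (W x y)) = ?Q"
    unfolding W_def G_def by (intro nn_integral_cong nn_cmult_real) auto
  have "2 * (?h2 * (NBINT x. ennreal ((\<phi> x)\<^sup>2))) =
    (NBINT y. NBINT x. ennreal ((\<phi> x)\<^sup>2 * G x y)) + (NBINT y. NBINT x. ennreal ((\<phi> y)\<^sup>2 * G y x))"
    using GI by (subst lborel_pair.Fubini') (auto simp: mult_2)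
  also have "\<dots> = (NBINT y. NBINT x. ennreal ((\<phi> x)\<^sup>2 * G x y) + ennreal ((\<phi> y)\<^sup>2 * G y x))"
    by (simp add: nn_integral_add)
  also have "\<dots> \<le> (NBINT y. NBINT x. ennreal ((\<phi> x - \<phi> y)\<^sup>2 * G x y) + (ennreal (W x y) + ennreal (W y x)))"
  proof (rule nn_integral_mono_AE, rule AE_mp[OF AE_lborel_singleton[of 0]], rule AE_I2, rule impI,
      rule nn_integral_mono_AE, rule AE_mp[OF AE_lborel_singleton[of 0]], rule AE_I2, rule impI)
    fix y x :: 'a assume "y \<noteq> 0" "x \<noteq> 0"
    then have p: "0 < norm x powr b" "0 < norm y powr b" by auto
    \<comment> \<open>The ratio \<open>w y / w x\<close> for the power \<open>w\<close> of exponent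
      \<open>- b\<close>. Expanding \<open>(c * \<phi> x - \<phi> y)^2 / c \<ge> 0\<close> is
      Picone's inequality.\<close>
    define c where "c = norm x powr b / norm y powr b"
    have c: "0 < c" using p by (simp add: c_def)
    have W: "W x y = (\<phi> x)\<^sup>2 * c * G x y" "W y x = (\<phi> y)\<^sup>2 / c * G x y"
      using p Gsym[of y x] by (simp_all add: W_def c_def powr_minus field_simps)
    have "(\<phi> x)\<^sup>2 + (\<phi> y)\<^sup>2 \<le> (\<phi> x - \<phi> y)\<^sup>2 + ((\<phi> x)\<^sup>2 * c + (\<phi> y)\<^sup>2 / c)"
    proof -
      have "0 \<le> (c * \<phi> x - \<phi> y)\<^sup>2 / c" using c by simp
      also have "(c * \<phi> x - \<phi> y)\<^sup>2 / c = (\<phi> x)\<^sup>2 * c + (\<phi> y)\<^sup>2 / c - 2 * \<phi> x * \<phi> y"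
        using c by (simp add: power2_eq_square field_simps)
      finally show ?thesis by (simp add: power2_eq_square algebra_simps)
    qed
    then have "((\<phi> x)\<^sup>2 + (\<phi> y)\<^sup>2) * G x y \<le> ((\<phi> x - \<phi> y)\<^sup>2 + ((\<phi> x)\<^sup>2 * c + (\<phi> y)\<^sup>2 / c)) * G x y"
      by (rule mult_right_mono[OF _ G0])
    then have "(\<phi> x)\<^sup>2 * G x y + (\<phi> y)\<^sup>2 * G y x \<le> (\<phi> x - \<phi> y)\<^sup>2 * G x y + (W x y + W y x)"
      unfolding W Gsym[of y x] by (simp only: distrib_right)
    then have "ennreal ((\<phi> x)\<^sup>2 * G x y + (\<phi> y)\<^sup>2 * G y x) \<le> ennreal ((\<phi> x - \<phi> y)\<^sup>2 * G x y + (W x y + W y x))"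
      by (rule ennreal_leI)
    then show "ennreal ((\<phi> x)\<^sup>2 * G x y) + ennreal ((\<phi> y)\<^sup>2 * G y x) \<le> ennreal ((\<phi> x - \<phi> y)\<^sup>2 * G x y) + (ennreal (W x y) + ennreal (W y x))"
      using G0 W0 by (simp add: ennreal_plus[symmetric] del: ennreal_plus)
  qed
  also have "\<dots> = ?E + ((NBINT y. NBINT x. ennreal (W x y)) + (NBINT y. NBINT x. ennreal (W y x)))"
    by (simp add: nn_integral_add G_def)
  also have "(NBINT y. NBINT x. ennreal (W x y)) = (NBINT x. NBINT y. ennreal (W x y))"
    by (rule lborel_pair.Fubini') measurable
  also have "?E + ((NBINT x. NBINT y. ennreal (W x y)) + (NBINT y. NBINT x. ennreal (W y x))) = ?E + 2 * ?Q"
    unfolding WI by (simp add: mult_2)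
  finally show ?thesis .
qed

lemma hs_energy_gauss_slices:
  fixes \<phi> :: "'a::euclidean_space \<Rightarrow> real"
  assumes [measurable]: "\<phi> \<in> borel_measurable borel" and s: "0 < s"
  shows "(NPINT t. ennreal (t powr ((real DIM('a) + s) / 2 - 1)) * (NBINT y. NBINT x. ennreal ((\<phi> x - \<phi> y)\<^sup>2 * gauss t (x - y)))) =
    ennreal (Gamma ((real DIM('a) + s) / 2)) *
      (NBINT y. NBINT x. ennreal (\<bar>\<phi> x - \<phi> y\<bar>\<^sup>2 / norm (x - y) powr (real DIM('a) + s)))"
proof -
  define a where "a = real DIM('a) + s"
  have a: "0 < a" using s by (simp add: a_def add_nonneg_pos)
  let ?F = "\<lambda>t x y. ennreal ((\<phi> x - \<phi> y)\<^sup>2 * (t powr (a / 2 - 1) * gauss t (x - y)))"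
  let ?h1 = "\<lambda>(x :: 'a) (y :: 'a). \<bar>\<phi> x - \<phi> y\<bar>\<^sup>2 / norm (x - y) powr a"
  let ?h2 = "\<lambda>(x :: 'a) (y :: 'a) t. ennreal ((\<phi> x - \<phi> y)\<^sup>2 * gauss t (x - y))"
  have "(NPINT t. ennreal (t powr (a / 2 - 1)) * (NBINT y. NBINT x. ?h2 x y t)) = (NPINT t. NBINT y. NBINT x. ?F t x y)"
  proof (rule nn_integral_cong)
    fix t :: real
    have "?F t x y = ennreal (t powr (a / 2 - 1)) * ?h2 x y t" for x y
      by (subst ennreal_mult'[symmetric]) (simp_all add: mult_ac)
    then show "ennreal (t powr (a / 2 - 1)) * (NBINT y. NBINT x. ?h2 x y t) = (NBINT y. NBINT x. ?F t x y)"
      by (simp add: nn_integral_cmult)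
  qed
  also have "\<dots> = (NBINT y. NPINT t. NBINT x. ?F t x y)"
    by (rule lpos_lborel.Fubini'[symmetric]) measurable
  also have "\<dots> = (NBINT y. NBINT x. NPINT t. ?F t x y)"
    by (intro nn_integral_cong lpos_lborel.Fubini'[symmetric]) measurable
  also have "\<dots> = (NBINT y. NBINT x. ennreal (Gamma (a / 2)) * ennreal (?h1 x y))"
  proof (rule nn_integral_cong)
    fix y :: 'a
    show "(NBINT x. NPINT t. ?F t x y) = (NBINT x. ennreal (Gamma (a / 2)) * ennreal (?h1 x y))"
    proof (rule nn_lborel_cong[where c = y])
      fix x assume "x \<noteq> y"
      have "(NPINT t. ?F t x y) = ennreal ((\<phi> x - \<phi> y)\<^sup>2 * (Gamma (a / 2) * norm (x - y) powr (- a)))"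
        by (rule norm_powr_subordination_mult[symmetric]) (use a \<open>x \<noteq> y\<close> in auto)
      also have "\<dots> = ennreal (Gamma (a / 2)) * ennreal (?h1 x y)"
      proof -
        have "(\<phi> x - \<phi> y)\<^sup>2 * (Gamma (a / 2) * norm (x - y) powr (- a)) = Gamma (a / 2) * ?h1 x y"
          by (simp only: powr_minus divide_inverse power2_abs mult_ac)
        moreover have "0 \<le> Gamma (a / 2)" using a by (simp add: less_imp_le)
        ultimately show ?thesis by (simp only: ennreal_mult')
      qed
      finally show "(NPINT t. ?F t x y) = \<dots>" .
    qed
  qed
  also have "\<dots> = ennreal (Gamma (a / 2)) * (NBINT y. NBINT x. ennreal (?h1 x y))"
    by (simp add: nn_integral_cmult)
  finally show ?thesis by (simp add: a_def)
qed

text \<open>The formal \<open>t\<close>-integral of a Gaussian mixture with mixing density \<open>g\<close>, evaluated by scaling.\<close>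

lemma nn_mixture_moment_gen:
  fixes x :: "'a::real_normed_vector" and b s :: real
  assumes [measurable]: "g \<in> borel_measurable borel" "q \<in> borel_measurable borel" "(\<lambda>(v, t). e v t) \<in> borel_measurable (borel \<Otimes>\<^sub>M borel)"
    and bs: "0 < b" "0 < s" and g: "\<And>v. 0 < v \<Longrightarrow> 0 \<le> g v"
    and e: "\<And>v. 0 < v \<Longrightarrow> (NPINT t. ennreal (t powr ((s + b) / 2 - 1) * e v t)) = ennreal (Gamma ((s + b) / 2) * norm x powr (- (s + b)) * q v)"
  shows "(NPINT t. ennreal (t powr (s / 2 - 1)) * (NPINT v. ennreal (t powr (b / 2) * v powr (b / 2 - 1) * g v * e v t))) =
    ennreal (Gamma ((s + b) / 2) * norm x powr (- (s + b))) * (NPINT v. ennreal (v powr (b / 2 - 1) * g v * q v))"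
proof -
  let ?c = "Gamma ((s + b) / 2) * norm x powr (- (s + b))"
  let ?w = "\<lambda>v. v powr (b / 2 - 1) * g v"
  have c: "0 \<le> ?c" using bs by (simp add: less_imp_le)
  let ?h = "\<lambda>v t. ennreal (?w v * (t powr ((s + b) / 2 - 1) * e v t))"
  have "(NPINT t. ennreal (t powr (s / 2 - 1)) * (NPINT v. ennreal (t powr (b / 2) * v powr (b / 2 - 1) * g v * e v t))) =
    (NPINT t. NPINT v. ?h v t)"
  proof (rule nn_lpos_cong)
    fix t :: real
    have t: "t powr ((s + b) / 2 - 1) = t powr (s / 2 - 1) * t powr (b / 2)"
      by (simp only: powr_add[symmetric]) (rule powr_exponent_cong, simp add: field_simps)
    show "ennreal (t powr (s / 2 - 1)) * (NPINT v. ennreal (t powr (b / 2) * v powr (b / 2 - 1) * g v * e v t)) = (NPINT v. ?h v t)"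
      unfolding t by (subst nn_cmult_real[symmetric]) (auto simp: mult_ac)
  qed
  also have "\<dots> = (NPINT v. NPINT t. ?h v t)"
    by (rule lpos_lpos.Fubini') measurable
  also have "\<dots> = (NPINT v. ennreal ?c * ennreal (?w v * q v))"
  proof (rule nn_lpos_cong)
    fix v :: real assume v: "0 < v"
    have w: "0 \<le> ?w v" using g[OF v] by simp
    have "(NPINT t. ?h v t) = ennreal (?w v) * ennreal (?c * q v)"
      unfolding e[OF v, symmetric] by (rule nn_cmult_real[OF w]) measurable
    also have "\<dots> = ennreal ?c * ennreal (?w v * q v)"
      unfolding ennreal_mult'[OF w] ennreal_mult'[OF c] by (simp only: mult_ac)
    finally show "(NPINT t. ?h v t) = \<dots>" .
  qed
  also have "\<dots> = ennreal ?c * (NPINT v. ennreal (?w v * q v))"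
    by (rule nn_integral_cmult) measurable
  finally show ?thesis .
qed

lemma nn_mixture_moment:
  fixes x :: "'a::real_normed_vector"
  assumes [measurable]: "g \<in> borel_measurable borel" "k \<in> borel_measurable borel"
    and bs: "0 < b" "0 < s" and x: "x \<noteq> 0" and g: "\<And>v. 0 < v \<Longrightarrow> 0 \<le> g v" and k: "\<And>v. 0 < v \<Longrightarrow> 0 < k v"
  shows "(NPINT t. ennreal (t powr (s / 2 - 1)) * (NPINT v. ennreal (t powr (b / 2) * v powr (b / 2 - 1) * g v * exp (- (t * (norm x)\<^sup>2 * k v))))) =
    ennreal (Gamma ((s + b) / 2) * norm x powr (- (s + b))) * (NPINT v. ennreal (v powr (b / 2 - 1) * g v * k v powr (- ((s + b) / 2))))"
proof (rule nn_mixture_moment_gen[OF assms(1) _ _ bs g])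
  fix v :: real assume v: "0 < v"
  have e: "2 * - ((s + b) / 2) = - (s + b)" by (simp add: field_simps)
  have "((norm x)\<^sup>2 * k v) powr (- ((s + b) / 2)) = norm x powr (- (s + b)) * k v powr (- ((s + b) / 2))"
    unfolding powr_mult norm_square_powr e ..
  then show "(NPINT t. ennreal (t powr ((s + b) / 2 - 1) * exp (- (t * (norm x)\<^sup>2 * k v)))) =
      ennreal (Gamma ((s + b) / 2) * norm x powr (- (s + b)) * k v powr (- ((s + b) / 2)))"
    using nn_Gamma[of "(s + b) / 2" "(norm x)\<^sup>2 * k v"] bs x k[OF v] by (simp only: mult_ac) (simp add: mult_ac)
qed measurable

lemma nn_mixture_moment_diff:
  fixes x :: "'a::real_normed_vector"
  assumes [measurable]: "g \<in> borel_measurable borel" "k \<in> borel_measurable borel" "l \<in> borel_measurable borel"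
    and bs: "0 < b" "0 < s" and x: "x \<noteq> 0" and g: "\<And>v. 0 < v \<Longrightarrow> 0 \<le> g v" and k: "\<And>v. 0 < v \<Longrightarrow> 0 < k v" and kl: "\<And>v. 0 < v \<Longrightarrow> k v \<le> l v"
  shows "(NPINT t. ennreal (t powr (s / 2 - 1)) * (NPINT v. ennreal (t powr (b / 2) * v powr (b / 2 - 1) * g v * (exp (- (t * (norm x)\<^sup>2 * k v)) - exp (- (t * (norm x)\<^sup>2 * l v)))))) =
    ennreal (Gamma ((s + b) / 2) * norm x powr (- (s + b))) * (NPINT v. ennreal (v powr (b / 2 - 1) * g v * (k v powr (- ((s + b) / 2)) - l v powr (- ((s + b) / 2)))))"
proof (rule nn_mixture_moment_gen[OF assms(1) _ _ bs g])
  fix v :: real assume v: "0 < v"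
  have e: "2 * - ((s + b) / 2) = - (s + b)" by (simp add: field_simps)
  have p: "((norm x)\<^sup>2 * r) powr (- ((s + b) / 2)) = norm x powr (- (s + b)) * r powr (- ((s + b) / 2))" for r
    unfolding powr_mult norm_square_powr e ..
  have "(NPINT t. ennreal (t powr ((s + b) / 2 - 1) * (exp (- ((norm x)\<^sup>2 * k v * t)) - exp (- ((norm x)\<^sup>2 * l v * t))))) =
      ennreal (Gamma ((s + b) / 2) * (((norm x)\<^sup>2 * k v) powr (- ((s + b) / 2)) - ((norm x)\<^sup>2 * l v) powr (- ((s + b) / 2))))"
    by (rule nn_Gamma_diff) (use bs x k[OF v] kl[OF v] in \<open>auto intro!: mult_left_mono\<close>)
  then show "(NPINT t. ennreal (t powr ((s + b) / 2 - 1) * (exp (- (t * (norm x)\<^sup>2 * k v)) - exp (- (t * (norm x)\<^sup>2 * l v))))) =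
      ennreal (Gamma ((s + b) / 2) * norm x powr (- (s + b)) * (k v powr (- ((s + b) / 2)) - l v powr (- ((s + b) / 2))))"
    unfolding p right_diff_distrib[symmetric] by (simp only: mult_ac)
qed measurable

text \<open>Subtraction in \<open>ennreal\<close> is truncated, so complementary pieces are kept as
  separate nonnegative integrals and recombined by addition.\<close>

lemma ennreal_split_complement:
  assumes "0 \<le> a" "0 \<le> p" "p \<le> 1" "0 \<le> e"
  shows "ennreal (a * p * e) + ennreal (a * (1 - p) * e) = ennreal (a * e)"
proof -
  have "ennreal (a * p * e) + ennreal (a * (1 - p) * e) = ennreal (a * p * e + a * (1 - p) * e)"
    by (rule ennreal_plus[symmetric]) (use assms in auto)
  also have "a * p * e + a * (1 - p) * e = a * e" by (simp add: algebra_simps)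
  finally show ?thesis .
qed

lemma ennreal_split_diff:
  assumes "0 \<le> a" "0 \<le> p" "p \<le> q"
  shows "ennreal (a * p) + ennreal (a * (q - p)) = ennreal (a * q)"
proof -
  have "ennreal (a * p) + ennreal (a * (q - p)) = ennreal (a * p + a * (q - p))"
    by (rule ennreal_plus[symmetric]) (use assms in auto)
  also have "a * p + a * (q - p) = a * q" by (simp add: algebra_simps)
  finally show ?thesis .
qed

text \<open>Both finiteness assumptions serve cancellation in \<open>ennreal\<close>: the first for
  the part common to the two sides of each Gaussian slice, the second for the term with
  \<open>KB\<close> after integrating the slices in \<open>t\<close>.\<close>

lemma hardy_L2:
  fixes \<phi> :: "'a::euclidean_space \<Rightarrow> real"
  assumes [measurable]: "\<phi> \<in> borel_measurable borel" and s: "0 < s" "s < 2" "s < real DIM('a)"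
    and L2: "(NBINT x. ennreal ((\<phi> x)\<^sup>2)) < \<infinity>"
    and fin: "(NBINT x. ennreal ((\<phi> x)\<^sup>2 * norm x powr (- s))) < \<infinity>"
  shows "(NBINT x. ennreal ((\<phi> x)\<^sup>2 * norm x powr (- s))) \<le> ennreal (sharp_const DIM('a) s) * hs_energy s \<phi>"
proof -
  let ?h1 = "\<lambda>(x :: 'a). (\<phi> x)\<^sup>2 * norm x powr (- s)"
  define N where "N = real DIM('a)"
  define b where "b = (N - s) / 2"
  define H where "H = (NBINT x. ennreal (?h1 x))"
  have sN: "s < N" using s by (simp add: N_def)
  have b: "0 < b" using sN by (simp add: b_def)
  have sb: "(s + b) / 2 = (N + s) / 4" by (simp add: b_def field_simps)
  let ?h2 = "\<lambda>t v (x :: 'a). ennreal (t powr (b / 2) * v powr (b / 2 - 1) * (1 + v) powr (- (N / 2)) * (exp (- (t * (norm x)\<^sup>2 * (v / (1 + v)))) - exp (- (t * (norm x)\<^sup>2 * v))))"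
  let ?h3 = "\<lambda>t v (x :: 'a). ennreal (t powr (b / 2) * v powr (b / 2 - 1) * (1 + v) powr (- (N / 2)) * exp (- (t * (norm x)\<^sup>2 * v)))"
  let ?h4 = "\<lambda>t v (x :: 'a). ennreal (t powr (b / 2) * v powr (b / 2 - 1) * (1 + v) powr (- (N / 2)) * exp (- (t * (norm x)\<^sup>2 * (v / (1 + v)))))"
  let ?h5 = "\<lambda>t v (x :: 'a). ennreal (t powr (b / 2) * v powr (b / 2 - 1) * (1 - (1 + v) powr (- (N / 2))) * exp (- (t * (norm x)\<^sup>2 * v)))"
  have G: "0 < Gamma (b / 2)" "0 < Gamma ((N + s) / 4)" "0 < Gamma ((N + s) / 2)" "0 < Gamma ((N - s) / 4)" "0 < Gamma (1 - s / 2)"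
    using s sN b by auto
  define E where "E = (\<lambda>t. (NBINT y. NBINT x. ennreal ((\<phi> x - \<phi> y)\<^sup>2 * gauss t (x - y))))"
  \<comment> \<open>Up to constants the ground state is \<open>P + A\<close> and its Gaussian
    average is \<open>P + B\<close>. The moment of \<open>P\<close> against
    \<open>t powr (s / 2 - 1)\<close> diverges at small \<open>v\<close>, while those of
    \<open>A\<close> and \<open>B\<close> converge; hence \<open>P\<close> must disappear before the
    \<open>t\<close>-integration.\<close>
  define P where "P = (\<lambda>t (x :: 'a). (NPINT v. ?h3 t v x))"
  define A where "A = (\<lambda>t (x :: 'a). (NPINT v. ?h5 t v x))"
  define B where "B = (\<lambda>t (x :: 'a). (NPINT v. ?h2 t v x))"
  define B1 where "B1 = (\<lambda>t (x :: 'a). (NPINT v. ?h4 t v x))"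
  have [measurable]: "(\<lambda>(t, x). P t x) \<in> borel_measurable (borel \<Otimes>\<^sub>M borel)" "(\<lambda>(t, x). A t x) \<in> borel_measurable (borel \<Otimes>\<^sub>M borel)"
     "(\<lambda>(t, x). B t x) \<in> borel_measurable (borel \<Otimes>\<^sub>M borel)" "(\<lambda>(t, x). B1 t x) \<in> borel_measurable (borel \<Otimes>\<^sub>M borel)"
    unfolding P_def A_def B_def B1_def by measurable
  have le1: "(1 + v) powr (- p) \<le> 1" if "0 < v" "0 < p" for v p :: real
    using that powr_mono[of "-p" 0 "1 + v"] by simp
  have N: "0 < N" by (simp add: N_def)
  let ?h6 = "\<lambda>(x :: 'a). ennreal (Gamma (b / 2) * norm x powr (- b))"
  have PA: "P t x + A t x = ?h6 x" if "0 < t" "x \<noteq> 0" for t x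
  proof -
    have "P t x + A t x = (NPINT v. ?h3 t v x + ?h5 t v x)"
      unfolding P_def A_def by (rule nn_integral_add[symmetric]) measurable
    also have "\<dots> = (NPINT v. ennreal (t powr (b / 2) * v powr (b / 2 - 1) * exp (- (t * (norm x)\<^sup>2 * v))))"
      using le1[of _ "N / 2"] N by (intro nn_lpos_cong ennreal_split_complement) auto
    also have "\<dots> = ?h6 x"
      by (rule nn_gamma_kernel) (use b that in auto)
    finally show ?thesis .
  qed
  have PB: "P t x + B t x = B1 t x" if "0 < t" for t x
  proof -
    have "P t x + B t x = (NPINT v. ?h3 t v x + ?h2 t v x)"
      unfolding P_def B_def by (rule nn_integral_add[symmetric]) measurable
    also have "\<dots> = B1 t x"
      unfolding B1_def
    proof (rule nn_lpos_cong)
      fix v :: real assume v: "0 < v"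
      have "v / (1 + v) \<le> v" using v by (simp add: field_simps)
      then have "t * (norm x)\<^sup>2 * (v / (1 + v)) \<le> t * (norm x)\<^sup>2 * v"
        using that by (intro mult_left_mono) auto
      then have "0 \<le> exp (- (t * (norm x)\<^sup>2 * (v / (1 + v)))) - exp (- (t * (norm x)\<^sup>2 * v))" by simp
      then show "?h3 t v x + ?h2 t v x = ?h4 t v x"
        by (intro ennreal_split_diff) auto
    qed
    finally show ?thesis .
  qed
  let ?h7 = "\<lambda>(x :: 'a). ennreal ((\<phi> x)\<^sup>2 * norm x powr b)"
  let ?h8 = "\<lambda>t (x :: 'a). NBINT y. ennreal (gauss t (x - y) * norm y powr (- b))"
  let ?h9 = "\<lambda>v. ennreal (v powr (- (s / 2) - 1) * ((1 + v) powr (- ((N - s) / 4)) - (1 + v) powr (- (N / 2))))"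
  let ?h10 = "\<lambda>v. ennreal (v powr (- (s / 2) - 1) * (1 - (1 + v) powr (- ((N - s) / 4))))"
  let ?h11 = "\<lambda>t. ennreal (t powr ((N + s) / 2 - 1)) * E t"
  let ?h12 = "\<lambda>(x :: 'a). ennreal (Gamma (b / 2) * (\<phi> x)\<^sup>2)"
  \<comment> \<open>The Picone slice after removing \<open>P\<close>, multiplied by the weight
    \<open>t powr ((N + s) / 2 - 1)\<close> that reassembles the energy. Against the Gaussian mass
    \<open>(pi / t) powr (N / 2)\<close> this weight leaves
    \<open>t powr (s / 2 - 1)\<close>.\<close>
  have key: "ennreal (2 * pi powr (N / 2)) * (NBINT x. ?h7 x * (ennreal (t powr (s / 2 - 1)) * A t x)) \<le> ennreal (Gamma (b / 2)) * ?h11 t +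
     ennreal (2 * pi powr (N / 2)) * (NBINT x. ?h7 x * (ennreal (t powr (s / 2 - 1)) * B t x))"
    if t: "0 < t" for t
  proof -
    define c where "c = ennreal ((pi / t) powr (N / 2))"
    have c_fin: "c < \<infinity>" by (simp add: c_def)
    define IP IA IB where "IP = (NBINT x. ?h7 x * P t x)"
      and "IA = (NBINT x. ?h7 x * A t x)"
      and "IB = (NBINT x. ?h7 x * B t x)"
    have 1: "IP + IA = ennreal (Gamma (b / 2)) * (NBINT x. ennreal ((\<phi> x)\<^sup>2))"
    proof -
      have "IP + IA = (NBINT x. ?h7 x * P t x + ?h7 x * A t x)"
        unfolding IP_def IA_def by (rule nn_integral_add[symmetric]) measurable
      also have "\<dots> = (NBINT x. ?h12 x)"
      proof (rule nn_lborel_cong)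
        fix x :: 'a assume x: "x \<noteq> 0"
        have "norm x powr b * norm x powr (- b) = 1" using x by (simp only: powr_add[symmetric]) simp
        then have e: "(\<phi> x)\<^sup>2 * norm x powr b * (Gamma (b / 2) * norm x powr (- b)) = Gamma (b / 2) * (\<phi> x)\<^sup>2"
          by (simp add: mult_ac)
        have "?h7 x * P t x + ?h7 x * A t x = ?h7 x * ?h6 x"
          using PA[OF t x] by (simp only: distrib_left[symmetric])
        also have "\<dots> = ?h12 x"
          by (subst ennreal_mult'[symmetric], simp) (simp only: e)
        finally show "?h7 x * P t x + ?h7 x * A t x = ?h12 x" .
      qed
      also have "\<dots> = ennreal (Gamma (b / 2)) * (NBINT x. ennreal ((\<phi> x)\<^sup>2))"
        using G by (intro nn_cmult_real) auto
      finally show ?thesis .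
    qed
    have 2: "ennreal (Gamma (b / 2)) * (NBINT x. ?h7 x * ?h8 t x) = c * (IP + IB)"
    proof -
      have "ennreal (Gamma (b / 2)) * (NBINT x. ?h7 x * ?h8 t x) = (NBINT x. ennreal (Gamma (b / 2)) * (?h7 x * ?h8 t x))"
        by (rule nn_integral_cmult[symmetric]) measurable
      also have "\<dots> = (NBINT x. c * (?h7 x * P t x + ?h7 x * B t x))"
      proof (rule nn_lborel_cong)
        fix x :: 'a assume x: "x \<noteq> 0"
        have "ennreal (Gamma (b / 2)) * ?h8 t x = c * B1 t x"
          using nn_gauss_conv_powr[OF b t x] by (simp add: c_def B1_def N_def)
        then have e: "f * (ennreal (Gamma (b / 2)) * ?h8 t x) = f * (c * B1 t x)" for f
          by (simp only:)
        show "ennreal (Gamma (b / 2)) * (?h7 x * ?h8 t x) = c * (?h7 x * P t x + ?h7 x * B t x)"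
          unfolding distrib_left[symmetric] PB[OF t] mult.left_commute[of "ennreal (Gamma (b / 2))"] e by (rule mult.left_commute)
      qed
      also have "\<dots> = c * (IP + IB)"
        unfolding IP_def IB_def by (subst nn_integral_add[symmetric]) (auto intro!: nn_integral_cmult)
      finally show ?thesis .
    qed
    have "c * 2 * IP + c * 2 * IA = ennreal (Gamma (b / 2)) * (2 * (ennreal ((pi / t) powr (real DIM('a) / 2)) * (NBINT x. ennreal ((\<phi> x)\<^sup>2))))"
      unfolding distrib_left[symmetric] 1 by (simp only: c_def N_def mult_ac)
    also have "\<dots> \<le> ennreal (Gamma (b / 2)) * (E t + 2 * (NBINT x. ?h7 x * ?h8 t x))"
      unfolding E_def by (intro mult_left_mono picone_sliced t) auto
    also have "\<dots> = ennreal (Gamma (b / 2)) * E t + 2 * (c * (IP + IB))"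
      unfolding 2[symmetric] by (simp only: distrib_left mult_ac)
    also have "\<dots> = c * 2 * IP + (ennreal (Gamma (b / 2)) * E t + c * 2 * IB)"
      by (simp only: distrib_left mult_ac add_ac)
    \<comment> \<open>The common term is finite because \<open>IP + IA\<close> is a multiple of the
      squared L2 norm.\<close>
    finally have "c * 2 * IA \<le> ennreal (Gamma (b / 2)) * E t + c * 2 * IB"
    proof (subst (asm) ennreal_add_left_cancel_le, elim disjE)
      have "IP \<le> IP + IA" by simp
      also have "\<dots> < \<infinity>" unfolding 1 using L2 by (simp add: ennreal_mult_less_top)
      finally have "c * 2 * IP < \<infinity>" using c_fin by (simp add: ennreal_mult_less_top)
      then show "c * 2 * IA \<le> ennreal (Gamma (b / 2)) * E t + c * 2 * IB" if "c * 2 * IP = \<infinity>"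
        using that by simp
    qed
    then have scaled: "ennreal (t powr ((N + s) / 2 - 1)) * (c * 2 * IA) \<le> ennreal (t powr ((N + s) / 2 - 1)) * (ennreal (Gamma (b / 2)) * E t + c * 2 * IB)"
      by (rule mult_left_mono) simp
    have cc: "ennreal (t powr ((N + s) / 2 - 1)) * c = ennreal (pi powr (N / 2)) * ennreal (t powr (s / 2 - 1))"
    proof -
      have "t powr (s / 2 - 1) = t powr ((N + s) / 2 - 1) * t powr (- (N / 2))"
        by (simp only: powr_add[symmetric]) (rule powr_exponent_cong, simp add: field_simps)
      then show ?thesis
        unfolding c_def using t by (simp add: powr_divide_eq ennreal_mult'[symmetric] mult_ac)
    qed
    have c2: "ennreal (2 * pi powr (N / 2)) = 2 * ennreal (pi powr (N / 2))" by (simp add: ennreal_mult')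
    have pull: "(NBINT x. ?h7 x * (ennreal (t powr (s / 2 - 1)) * F x)) = ennreal (t powr (s / 2 - 1)) * (NBINT x. ?h7 x * F x)"
       if [measurable]: "F \<in> borel_measurable borel" for F
      by (subst nn_integral_cmult[symmetric]) (auto simp: mult_ac)
    have eq: "ennreal (t powr ((N + s) / 2 - 1)) * (c * 2 * J) = ennreal (2 * pi powr (N / 2)) * (ennreal (t powr (s / 2 - 1)) * J)" for J
      unfolding c2 mult.assoc[symmetric] cc by (simp only: mult_ac)
    have [measurable]: "A t \<in> borel_measurable borel" "B t \<in> borel_measurable borel"
      unfolding A_def B_def by measurable
    have pA: "(NBINT x. ?h7 x * (ennreal (t powr (s / 2 - 1)) * A t x)) = ennreal (t powr (s / 2 - 1)) * IA"
      unfolding IA_def by (rule pull) measurable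
    have pB: "(NBINT x. ?h7 x * (ennreal (t powr (s / 2 - 1)) * B t x)) = ennreal (t powr (s / 2 - 1)) * IB"
      unfolding IB_def by (rule pull) measurable
    from scaled show ?thesis
      unfolding pA pB by (simp only: distrib_left[of "ennreal (t powr ((N + s) / 2 - 1))"] eq mult.left_commute[of "ennreal (t powr ((N + s) / 2 - 1))" "ennreal (Gamma (b / 2))"])
  qed
  \<comment> \<open>\<open>KA\<close> and \<open>KB\<close> are the \<open>t\<close>-moments of
    \<open>A\<close> and \<open>B\<close> stripped of their power of \<open>norm x\<close>. Their
    difference \<open>KI\<close> is the formal eigenvalue of the ground state, up to explicit
    factors.\<close>
  define KA where "KA = (NPINT v. ennreal (v powr (- (s / 2) - 1) * (1 - (1 + v) powr (- (N / 2)))))"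
  define KI where "KI = (NPINT v. ?h10 v)"
  define KB where "KB = (NPINT v. ?h9 v)"
  have K: "KB + KI = KA"
  proof -
    have "KB + KI = (NPINT v. ?h9 v + ?h10 v)"
      unfolding KB_def KI_def by (rule nn_integral_add[symmetric]) measurable
    also have "\<dots> = KA"
      unfolding KA_def
    proof (rule nn_lpos_cong)
      fix v :: real assume v: "0 < v"
      have 1: "(1 + v) powr (- (N / 2)) \<le> (1 + v) powr (- ((N - s) / 4))"
        using v s N by (intro powr_mono) auto
      have 2: "(1 + v) powr (- ((N - s) / 4)) \<le> 1" using le1[OF v] sN by simp
      show "?h9 v + ?h10 v = ennreal (v powr (- (s / 2) - 1) * (1 - (1 + v) powr (- (N / 2))))"
        using ennreal_split_diff[of "v powr (- (s / 2) - 1)" "(1 + v) powr (- ((N - s) / 4)) - (1 + v) powr (- (N / 2))" "1 - (1 + v) powr (- (N / 2))"] 1 2 by simp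
    qed
    finally show ?thesis .
  qed
  have KA_fin: "KA < \<infinity>"
    unfolding KA_def using nn_one_minus_powr[of "s / 2" "N / 2"] s N by simp
  have vp: "v powr (- (s / 2) - 1) = v powr (b / 2 - 1) * v powr (- ((s + b) / 2))" for v :: real
    by (simp only: powr_add[symmetric]) (rule powr_exponent_cong, simp add: field_simps)
  let ?h13 = "\<lambda>(x :: 'a). Gamma ((N + s) / 4) * norm x powr (- (s + b))"
  let ?h14 = "NPINT v. ennreal (v powr (b / 2 - 1) * (1 - (1 + v) powr (- (N / 2))) * v powr (- ((s + b) / 2)))"
  have IA: "(NPINT t. ennreal (t powr (s / 2 - 1)) * A t x) = ennreal (?h13 x) * KA" if "x \<noteq> 0" for x
  proof -
    have "(NPINT t. ennreal (t powr (s / 2 - 1)) * A t x) = ennreal (Gamma ((s + b) / 2) * norm x powr (- (s + b))) * ?h14"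
      unfolding A_def by (rule nn_mixture_moment) (use that b s le1 N in auto)
    also have "?h14 = KA"
      unfolding KA_def vp by (simp only: mult_ac)
    finally show ?thesis unfolding sb .
  qed
  let ?h15 = "\<lambda>v. ennreal (v powr (b / 2 - 1) * (1 + v) powr (- (N / 2)) * ((v / (1 + v)) powr (- ((s + b) / 2)) - v powr (- ((s + b) / 2))))"
  have IB: "(NPINT t. ennreal (t powr (s / 2 - 1)) * B t x) = ennreal (?h13 x) * KB" if "x \<noteq> 0" for x
  proof -
    have "(NPINT t. ennreal (t powr (s / 2 - 1)) * B t x) = ennreal (Gamma ((s + b) / 2) * norm x powr (- (s + b))) * (NPINT v. ?h15 v)"
      unfolding B_def by (rule nn_mixture_moment_diff) (use that b s in \<open>auto simp: field_simps\<close>)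
    also have "(NPINT v. ?h15 v) = KB"
      unfolding KB_def
    proof (rule nn_lpos_cong)
      fix v :: real assume v: "0 < v"
      have 1: "(v / (1 + v)) powr (- ((s + b) / 2)) = v powr (- ((s + b) / 2)) * (1 + v) powr ((s + b) / 2)"
        using v by (subst powr_divide_eq) auto
      have 2: "(1 + v) powr (- ((N - s) / 4)) = (1 + v) powr (- (N / 2)) * (1 + v) powr ((s + b) / 2)"
        by (simp only: powr_add[symmetric]) (rule powr_exponent_cong, simp add: b_def field_simps)
      show "?h15 v = ?h9 v"
        unfolding 1 2 vp by (simp only: right_diff_distrib left_diff_distrib mult_ac)
    qed
    finally show ?thesis unfolding sb .
  qed
  define C where "C = ennreal (2 * pi powr (N / 2)) * ennreal (Gamma ((N + s) / 4))"
  \<comment> \<open>Both moments are proportional to \<open>norm x powr (- (s + b))\<close>; the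
    factor \<open>norm x powr b\<close> turns this into the Hardy weight, so each side becomes a
    multiple of \<open>H\<close>.\<close>
  have swap: "(NPINT t. ennreal (2 * pi powr (N / 2)) * (NBINT x. ?h7 x * (ennreal (t powr (s / 2 - 1)) * F t x))) = C * K * H"
    if [measurable]: "(\<lambda>(t, x). F t x) \<in> borel_measurable (borel \<Otimes>\<^sub>M borel)"
      and F: "\<And>x. x \<noteq> 0 \<Longrightarrow> (NPINT t. ennreal (t powr (s / 2 - 1)) * F t x) = ennreal (?h13 x) * K" for F K
  proof -
    have "(NPINT t. ennreal (2 * pi powr (N / 2)) * (NBINT x. ?h7 x * (ennreal (t powr (s / 2 - 1)) * F t x))) =
      ennreal (2 * pi powr (N / 2)) * (NPINT t. NBINT x. ?h7 x * (ennreal (t powr (s / 2 - 1)) * F t x))"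
      by (rule nn_integral_cmult) measurable
    also have "(NPINT t. NBINT x. ?h7 x * (ennreal (t powr (s / 2 - 1)) * F t x)) =
      (NBINT x. NPINT t. ?h7 x * (ennreal (t powr (s / 2 - 1)) * F t x))"
      by (rule lpos_lborel.Fubini'[symmetric]) measurable
    also have "\<dots> = (NBINT x. ennreal (Gamma ((N + s) / 4)) * K * ennreal (?h1 x))"
    proof (rule nn_lborel_cong)
      fix x :: 'a assume x: "x \<noteq> 0"
      have "norm x powr (- s) = norm x powr b * norm x powr (- (s + b))"
        by (simp only: powr_add[symmetric]) simp
      then have e: "(\<phi> x)\<^sup>2 * norm x powr b * ?h13 x = Gamma ((N + s) / 4) * ?h1 x"
        by (simp only: mult_ac)
      have "(NPINT t. ?h7 x * (ennreal (t powr (s / 2 - 1)) * F t x)) = ?h7 x * (NPINT t. ennreal (t powr (s / 2 - 1)) * F t x)"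
        by (rule nn_integral_cmult) measurable
      also have "\<dots> = ?h7 x * ennreal (?h13 x) * K"
        unfolding F[OF x] by (simp only: mult_ac)
      also have "?h7 x * ennreal (?h13 x) = ennreal (Gamma ((N + s) / 4)) * ennreal (?h1 x)"
        using G by (subst (1 2) ennreal_mult'[symmetric]) (simp_all only: e, auto)
      finally show "(NPINT t. ?h7 x * (ennreal (t powr (s / 2 - 1)) * F t x)) = ennreal (Gamma ((N + s) / 4)) * K * ennreal (?h1 x)"
        by (simp only: mult_ac)
    qed
    also have "\<dots> = ennreal (Gamma ((N + s) / 4)) * K * H"
      unfolding H_def by (rule nn_integral_cmult) measurable
    finally show ?thesis
      unfolding C_def by (simp only: mult.assoc)
  qed
  define EE where "EE = (NBINT y. NBINT x. ennreal (\<bar>\<phi> x - \<phi> y\<bar>\<^sup>2 / norm (x - y) powr (N + s)))"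
  have [measurable]: "E \<in> borel_measurable borel" unfolding E_def by measurable
  have "C * KA * H \<le> (NPINT t. ennreal (Gamma (b / 2)) * ?h11 t +
     ennreal (2 * pi powr (N / 2)) * (NBINT x. ?h7 x * (ennreal (t powr (s / 2 - 1)) * B t x)))"
    by (subst swap[of A KA, symmetric]) (auto simp: IA intro!: nn_lpos_mono key)
  also have "\<dots> = (NPINT t. ennreal (Gamma (b / 2)) * ?h11 t) + C * KB * H"
    by (subst swap[of B KB, symmetric]) (auto simp: IB intro!: nn_integral_add)
  also have "(NPINT t. ennreal (Gamma (b / 2)) * ?h11 t) = ennreal (Gamma (b / 2)) * (ennreal (Gamma ((N + s) / 2)) * EE)"
    unfolding EE_def hs_energy_gauss_slices[OF assms(1) s(1), folded N_def, symmetric] E_def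
    by (rule nn_integral_cmult) measurable
  finally have "C * KB * H + C * KI * H \<le> C * KB * H + ennreal (Gamma (b / 2)) * (ennreal (Gamma ((N + s) / 2)) * EE)"
    unfolding K[symmetric] by (simp only: distrib_left distrib_right add_ac)
  \<comment> \<open>\<open>KB\<close> is bounded by the finite \<open>KA\<close>, and
    \<open>H\<close> is finite by assumption.\<close>
  moreover have "C * KB * H \<noteq> \<infinity>"
  proof -
    have "KB \<le> KA" unfolding K[symmetric] by simp
    then have "KB < \<infinity>" using KA_fin by (rule le_less_trans)
    then show ?thesis using fin unfolding H_def[symmetric] C_def by (auto simp: ennreal_mult_eq_top_iff)
  qed
  ultimately have main: "C * KI * H \<le> ennreal (Gamma (b / 2)) * (ennreal (Gamma ((N + s) / 2)) * EE)"
    by (simp add: ennreal_add_left_cancel_le)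
  define i where "i = Gamma (1 - s / 2) / (s / 2) * (Gamma ((N + s) / 4) / Gamma ((N - s) / 4))"
  have i: "0 < i" unfolding i_def using G s by auto
  have "KI = ennreal i"
  proof -
    have e: "(N - s) / 4 + s / 2 = (N + s) / 4" by (simp add: field_simps)
    show ?thesis
      unfolding KI_def i_def using nn_one_minus_powr[of "s / 2" "(N - s) / 4", unfolded e] s sN by simp
  qed
  define c where "c = 2 * pi powr (N / 2) * Gamma ((N + s) / 4) * i"
  have c: "0 < c" unfolding c_def using i G by simp
  let ?h16 = "ennreal (Gamma (b / 2) * Gamma ((N + s) / 2))"
  have "ennreal c = C * KI"
    using G i unfolding c_def C_def \<open>KI = ennreal i\<close> by (simp add: ennreal_mult' mult.assoc)
  moreover have "?h16 = ennreal (Gamma (b / 2)) * ennreal (Gamma ((N + s) / 2))"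
    using G by (intro ennreal_mult') simp
  ultimately have "ennreal c * H \<le> ?h16 * EE"
    using main by (simp only: mult.assoc)
  then have "ennreal (1 / c) * (ennreal c * H) \<le> ennreal (1 / c) * (?h16 * EE)"
    by (rule mult_left_mono) simp
  then have "H \<le> ennreal (Gamma (b / 2) * Gamma ((N + s) / 2) / c) * EE"
    using c G by (simp add: mult.assoc[symmetric] ennreal_mult'[symmetric])
  also have "Gamma (b / 2) * Gamma ((N + s) / 2) / c = sharp_const DIM('a) s * sobolev_const DIM('a) s"
  proof -
    \<comment> \<open>With the Gamma values and powers replaced by positive reals the comparison of
      constants is plain algebra: \<open>g1\<close>, \<open>g2\<close> stand for the values at
      \<open>(N + s) / 4\<close> and \<open>(N - s) / 4\<close>, \<open>g3\<close>,
      \<open>g4\<close> for those at \<open>(N + s) / 2\<close> and \<open>1 - s / 2\<close>, and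
      \<open>q\<close> for \<open>2 powr s\<close>.\<close>
    have alg: "g2 * g3 / (2 * p * g1 * (g4 / (s / 2) * (g1 / g2))) = 1 / q * (g2 / g1)\<^sup>2 * (g3 * s / (4 / q * p * g4))"
      if "0 < g1" "0 < g2" "0 < g4" "0 < p" "0 < q" for g1 g2 g3 g4 p q :: real
      using that s(1) by (simp add: power2_eq_square field_simps)
    have e: "b / 2 = (N - s) / 4" "2 powr (2 - s) = 4 / 2 powr s" by (simp_all add: b_def powr_diff)
    show ?thesis
      unfolding c_def i_def sharp_const_def sobolev_const_def N_def[symmetric] e
      by (rule alg) (use G in simp_all)
  qed
  finally show ?thesis
    unfolding hs_energy_def H_def EE_def N_def using sharp_const_pos[OF s(1) s(3)]
    by (simp add: ennreal_mult' mult.assoc)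
qed

section \<open>Test functions and the completion\<close>

text \<open>With \<open>r = |z|^2\<close> one has \<open>min 1 r \<le> 2 * (1 - 1 / (1 + r)) \<le> 2
  * (1 - exp (- r))\<close>, so the exact integral for \<open>1 - gauss 1\<close> serves as majorant
  both near 0 and at infinity.\<close>

lemma nn_kernel_min_finite:
  assumes s: "0 < s" "s < 2"
  shows "(NBINT z. ennreal (min 1 ((norm (z :: 'a::euclidean_space))\<^sup>2) / norm z powr (real DIM('a) + s))) < \<infinity>"
proof -
  let ?h = "\<lambda>(z :: 'a). norm z powr (- (real DIM('a) + s)) * (1 - gauss 1 z)"
  have "(NBINT z. ennreal (min 1 ((norm (z :: 'a))\<^sup>2) / norm z powr (real DIM('a) + s))) \<le> (NBINT z. ennreal (2 * ?h z))"
  proof (intro nn_integral_mono ennreal_leI)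
    fix z :: 'a
    define r where "r = (norm z)\<^sup>2"
    have r: "0 \<le> r" by (simp add: r_def)
    have "1 + r \<le> exp r" by (rule exp_ge_add_one_self)
    then have "exp (- r) \<le> 1 / (1 + r)" using r by (simp add: exp_minus field_simps)
    moreover have "min 1 r \<le> 2 * (1 - 1 / (1 + r))"
    proof (cases "r \<le> 1")
      case True
      then have "r * r \<le> r" using mult_left_le[of r r] r by simp
      then show ?thesis using r True by (simp add: min_def field_simps)
    next
      case False
      then show ?thesis by (simp add: min_def field_simps)
    qed
    moreover have "2 * (1 - 1 / (1 + r)) \<le> 2 * (1 - exp (- r))" if "exp (- r) \<le> 1 / (1 + r)"
      using that by (intro mult_left_mono diff_left_mono) auto
    ultimately have "min 1 r \<le> 2 * (1 - exp (- r))" by (blast intro: order_trans)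
    then have "min 1 r * norm z powr (- (real DIM('a) + s)) \<le> 2 * (1 - exp (- r)) * norm z powr (- (real DIM('a) + s))"
      by (rule mult_right_mono) simp
    then show "min 1 ((norm z)\<^sup>2) / norm z powr (real DIM('a) + s) \<le> 2 * ?h z"
      unfolding r_def by (simp only: powr_minus divide_inverse mult_1_left mult_ac)
  qed
  also have "\<dots> = 2 * (NBINT z. ennreal (?h z))"
    by (subst nn_cmult_real) auto
  also have "\<dots> < \<infinity>"
    unfolding nn_norm_powr_one_minus_gauss[OF s zero_less_one] by (simp add: ennreal_mult_less_top)
  finally show ?thesis .
qed

text \<open>Serves twice: with \<open>g\<close> the indicator of a ball it bounds the energy of a
  test function, and with \<open>g\<close> the square of a function it dominates the error made by a
  cutoff.\<close>

lemma nn_kernel_min_weighted_finite: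
  fixes g :: "'a::euclidean_space \<Rightarrow> real"
  assumes s: "0 < s" "s < 2"
    and K: "0 \<le> K" and g0: "\<And>x. 0 \<le> g x" and [measurable]: "g \<in> borel_measurable borel"
    and g: "(NBINT x. ennreal (g x)) < \<infinity>"
  shows "(NBINT y. NBINT x. ennreal (K * min 1 ((norm (x - y))\<^sup>2) * (g x + g y) / norm (x - y) powr (real DIM('a) + s))) < \<infinity>"
proof -
  define k where "k = (\<lambda>z :: 'a. min 1 ((norm z)\<^sup>2) / norm z powr (real DIM('a) + s))"
  have [measurable]: "k \<in> borel_measurable borel" unfolding k_def by measurable
  have k0: "0 \<le> k z" for z unfolding k_def by simp
  have ksym: "k (x - y) = k (y - x)" for x y unfolding k_def by (simp add: norm_minus_commute)
  define Ik where "Ik = (NBINT z. ennreal (k z))"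
  have Ik: "Ik < \<infinity>" unfolding Ik_def k_def by (rule nn_kernel_min_finite[OF s])
  let ?h1 = "\<lambda>y k. NBINT x. ennreal (g y) * ennreal (k (y - x))"
  have 1: "(?h1 y k) = ennreal (g y) * Ik" for y
    unfolding Ik_def by (subst nn_integral_cmult) (auto simp: nn_lborel_reflect[of "\<lambda>z. ennreal (k z)"])
  let ?h2 = "\<lambda>(x :: 'a) (y :: 'a). ennreal (K * min 1 ((norm (x - y))\<^sup>2) * (g x + g y) / norm (x - y) powr (real DIM('a) + s))"
  have "(NBINT y. NBINT x. ?h2 x y) = (NBINT y. NBINT x. ennreal K * (ennreal (g x) * ennreal (k (x - y)) + ennreal (g y) * ennreal (k (y - x))))"
  proof (intro nn_integral_cong)
    fix x y
    have "K * min 1 ((norm (x - y))\<^sup>2) * (g x + g y) / norm (x - y) powr (real DIM('a) + s) = K * (g x * k (x - y) + g y * k (y - x))"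
      unfolding ksym[of y x] unfolding k_def by (simp add: algebra_simps add_divide_distrib)
    then show "?h2 x y = ennreal K * (ennreal (g x) * ennreal (k (x - y)) + ennreal (g y) * ennreal (k (y - x)))"
      using g0 k0 K by (simp add: ennreal_mult' ennreal_plus)
  qed
  also have "\<dots> = ennreal K * ((NBINT y. NBINT x. ennreal (g x) * ennreal (k (x - y))) + (NBINT y. ?h1 y k))"
    by (simp add: nn_integral_cmult nn_integral_add)
  also have "(NBINT y. NBINT x. ennreal (g x) * ennreal (k (x - y))) = (NBINT x. NBINT y. ennreal (g x) * ennreal (k (x - y)))"
    by (rule lborel_pair.Fubini') measurable
  also have "ennreal K * ((NBINT x. NBINT y. ennreal (g x) * ennreal (k (x - y))) + (NBINT y. ?h1 y k)) < \<infinity>"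
    unfolding 1 using g Ik by (simp add: nn_integral_multc ennreal_mult_less_top)
  finally show ?thesis .
qed

lemma differentiable_continuous_UNIV:
  assumes "\<forall>x. f differentiable (at x)"
  shows "continuous_on UNIV f"
  by (intro continuous_at_imp_continuous_on ballI differentiable_imp_continuous_within) (rule assms[rule_format])

lemma lipschitz_on_ball:
  fixes f :: "'a::euclidean_space \<Rightarrow> real"
  assumes "C_k 1 f"
  shows "\<exists>L. \<forall>x\<in>cball 0 R. \<forall>y\<in>cball 0 R. \<bar>f x - f y\<bar> \<le> L * norm (x - y)"
proof -
  have d: "f differentiable (at x)" and c: "continuous_on UNIV (\<lambda>x. frechet_derivative f (at x) v)" for x v
    using assms by (auto simp: numeral_eq_Suc)
  have "\<exists>B. \<forall>x\<in>cball 0 R. \<bar>frechet_derivative f (at x) b\<bar> \<le> B" for b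
  proof -
    have "compact ((\<lambda>x. frechet_derivative f (at x) b) ` cball 0 R)"
      by (rule compact_continuous_image[OF continuous_on_subset[OF c]]) auto
    then have "bounded ((\<lambda>x. frechet_derivative f (at x) b) ` cball 0 R)" by (rule compact_imp_bounded)
    then show ?thesis by (auto simp: bounded_iff)
  qed
  then obtain B where B: "\<And>b x. x \<in> cball 0 R \<Longrightarrow> \<bar>frechet_derivative f (at x) b\<bar> \<le> B b" by metis
  \<comment> \<open>\<open>C_k\<close> speaks only of derivatives in a fixed direction; bounds along
    the finitely many basis vectors control the operator norm.\<close>
  have on: "onorm (frechet_derivative f (at x)) \<le> (\<Sum>b\<in>Basis. B b)" if x: "x \<in> cball 0 R" for x
  proof (rule onorm_le)
    fix h :: 'a
    have lin: "linear (frechet_derivative f (at x))" by (rule linear_frechet_derivative[OF d])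
    have "frechet_derivative f (at x) h = (\<Sum>b\<in>Basis. (h \<bullet> b) * frechet_derivative f (at x) b)"
      by (subst (1) euclidean_representation[of h, symmetric]) (simp add: linear_sum[OF lin] linear_scale[OF lin])
    also have "norm \<dots> \<le> (\<Sum>b\<in>Basis. norm h * B b)"
      by (rule order_trans[OF norm_sum])
        (auto simp: abs_mult intro!: sum_mono mult_mono B[OF x] Basis_le_norm)
    finally show "norm (frechet_derivative f (at x) h) \<le> (\<Sum>b\<in>Basis. B b) * norm h"
      by (subst mult.commute) (simp only: sum_distrib_left)
  qed
  have "norm (f x - f y) \<le> (\<Sum>b\<in>Basis. B b) * norm (x - y)" if "x \<in> cball 0 R" "y \<in> cball 0 R" for x y
    by (rule differentiable_bound[of "cball 0 R" f "\<lambda>x. frechet_derivative f (at x)"])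
      (use that on d in \<open>auto intro: has_derivative_at_withinI simp: frechet_derivative_works[symmetric]\<close>)
  then have "\<forall>x\<in>cball 0 R. \<forall>y\<in>cball 0 R. \<bar>f x - f y\<bar> \<le> (\<Sum>b\<in>Basis. B b) * norm (x - y)"
    by (simp only: real_norm_def) blast
  then show ?thesis by (rule exI)
qed

text \<open>Boundedness handles distant points and the Lipschitz bound close ones. The combined form
  is what cancels the singularity of the energy kernel on the diagonal while keeping its
  decay.\<close>

lemma test_function_bounds:
  fixes f :: "'a::euclidean_space \<Rightarrow> real"
  assumes "f \<in> test_functions"
  obtains K R where "0 \<le> K" "0 < R" "\<And>x. R < norm x \<Longrightarrow> f x = 0" "\<And>x y. (f x - f y)\<^sup>2 \<le> K * min 1 ((norm (x - y))\<^sup>2)"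
proof -
  have C: "C_k k f" for k using assms by (simp add: test_functions_def)
  have "bounded (closure (support_on UNIV f))" using assms by (simp add: test_functions_def compact_imp_bounded)
  then obtain R0 where R0: "\<And>x. x \<in> closure (support_on UNIV f) \<Longrightarrow> norm x \<le> R0" by (auto simp: bounded_iff)
  define R where "R = max R0 1"
  have R: "0 < R" by (simp add: R_def)
  have z: "f x = 0" if "R < norm x" for x
  proof (rule ccontr)
    assume "f x \<noteq> 0"
    then have "x \<in> closure (support_on UNIV f)" by (intro subsetD[OF closure_subset]) (simp add: support_on_def)
    from R0[OF this] show False using that by (simp add: R_def)
  qed
  obtain L where L: "\<And>x y. x \<in> cball 0 (R + 1) \<Longrightarrow> y \<in> cball 0 (R + 1) \<Longrightarrow> \<bar>f x - f y\<bar> \<le> L * norm (x - y)"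
    using lipschitz_on_ball[OF C] by blast
  define L' where "L' = max L 0"
  have L': "\<bar>f x - f y\<bar> \<le> L' * norm (x - y)" if "x \<in> cball 0 (R + 1)" "y \<in> cball 0 (R + 1)" for x y
    using L[OF that] mult_right_mono[of L L' "norm (x - y)"] by (auto simp: L'_def)
  have "continuous_on UNIV f" using C[of 0] by simp
  then have "bounded (f ` cball 0 (R + 1))"
    by (rule compact_imp_bounded[OF compact_continuous_image[OF continuous_on_subset[of UNIV f]]]) auto
  then obtain M where "\<forall>x\<in>cball 0 (R + 1). \<bar>f x\<bar> \<le> M" by (auto simp: bounded_iff)
  then have M: "\<bar>f x\<bar> \<le> M" if "norm x \<le> R + 1" for x
    using that by simp
  have "\<bar>f 0\<bar> \<le> M" by (rule M) (use R in simp)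
  then have M0: "0 \<le> M" by linarith
  have fM: "\<bar>f x\<bar> \<le> M" for x
    using M[of x] z[of x] M0 by (cases "norm x \<le> R + 1") auto
  define K where "K = max (L'\<^sup>2) (4 * M\<^sup>2)"
  have K0: "0 \<le> K" by (simp add: K_def le_max_iff_disj)
  have big: "(f x - f y)\<^sup>2 \<le> K" for x y
  proof -
    have "\<bar>f x - f y\<bar> \<le> 2 * M" using fM[of x] fM[of y] by linarith
    then have "\<bar>f x - f y\<bar>\<^sup>2 \<le> (2 * M)\<^sup>2" by (rule power_mono) simp
    then show ?thesis by (simp add: K_def power_mult_distrib)
  qed
  have "(f x - f y)\<^sup>2 \<le> K * min 1 ((norm (x - y))\<^sup>2)" for x y
  proof (cases "norm (x - y) < 1")
    case False
    then have "1 \<le> (norm (x - y))\<^sup>2" by (simp add: one_le_power)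
    then show ?thesis using big by (simp add: min_def)
  next
    case True
    then have "(norm (x - y))\<^sup>2 \<le> 1" by (simp add: power_le_one)
    then have m: "min 1 ((norm (x - y))\<^sup>2) = (norm (x - y))\<^sup>2" by simp
    \<comment> \<open>Two points at distance below 1 lie either both in the ball of radius
      \<open>R + 1\<close> or both outside the ball of radius \<open>R\<close>, where
      \<open>f\<close> vanishes.\<close>
    consider "x \<in> cball 0 (R + 1)" "y \<in> cball 0 (R + 1)" | "R < norm x" "R < norm y"
      using True norm_triangle_ineq2[of x y] norm_triangle_ineq2[of y x] norm_minus_commute[of x y]
      by (cases "norm x \<le> R + 1 \<and> norm y \<le> R + 1") (auto simp: dist_norm)
    then show ?thesis
    proof cases
      case 1
      have "(f x - f y)\<^sup>2 \<le> (L' * norm (x - y))\<^sup>2"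
        using L'[OF 1] by (metis abs_ge_zero power2_abs power_mono)
      also have "\<dots> \<le> K * (norm (x - y))\<^sup>2"
        unfolding power_mult_distrib by (intro mult_right_mono) (auto simp: K_def)
      finally show ?thesis unfolding m .
    next
      case 2
      then show ?thesis using z K0 unfolding m by simp
    qed
  qed
  then show thesis using that[of K R] K0 R z by blast
qed

lemma test_function_measurable:
  "f \<in> test_functions \<Longrightarrow> f \<in> borel_measurable borel"
proof -
  assume "f \<in> test_functions"
  then have "C_k 0 f" unfolding test_functions_def by blast
  then show ?thesis by (simp add: borel_measurable_continuous_onI)
qed

lemma test_function_energy_finite:
  fixes f :: "'a::euclidean_space \<Rightarrow> real"
  assumes "f \<in> test_functions" and s: "0 < s" "s < 2"
  shows "hs_energy s f < \<infinity>"
proof -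
  obtain K R where K: "0 \<le> K" and R: "0 < R" and z: "\<And>x. R < norm x \<Longrightarrow> f x = 0" and L: "\<And>x y. (f x - f y)\<^sup>2 \<le> K * min 1 ((norm (x - y))\<^sup>2)"
    using test_function_bounds[OF assms(1)] by blast
  define g where "g = (\<lambda>x. indicator (cball (0::'a) R) x :: real)"
  have [measurable]: "cball (0::'a) R \<in> sets borel" by (simp add: borel_closed)
  have fg: "(f x - f y)\<^sup>2 \<le> K * min 1 ((norm (x - y))\<^sup>2) * (g x + g y)" for x y
  proof (cases "norm x \<le> R \<or> norm y \<le> R")
    case True
    then have "1 \<le> g x + g y" by (auto simp: g_def)
    then have "K * min 1 ((norm (x - y))\<^sup>2) * 1 \<le> K * min 1 ((norm (x - y))\<^sup>2) * (g x + g y)"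
      using K by (intro mult_left_mono) auto
    then show ?thesis using L[of x y] by linarith
  next
    case False
    then show ?thesis using z by (simp add: g_def not_le)
  qed
  have "(NBINT x. ennreal (g x)) = emeasure lborel (cball (0::'a) R)"
    unfolding g_def by (simp add: ennreal_indicator)
  also have "\<dots> < \<infinity>" using emeasure_compact_finite[of "cball (0::'a) R"] by simp
  finally have "(NBINT y. NBINT x. ennreal (K * min 1 ((norm (x - y))\<^sup>2) * (g x + g y) / norm (x - y) powr (real DIM('a) + s))) < \<infinity>"
    by (intro nn_kernel_min_weighted_finite[OF s K]) (auto simp: g_def)
  then have "(NBINT y. NBINT x. ennreal (\<bar>f x - f y\<bar>\<^sup>2 / norm (x - y) powr (real DIM('a) + s))) < \<infinity>"
    by (rule le_less_trans[rotated]) (intro nn_integral_mono ennreal_leI divide_right_mono, auto simp: fg)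
  then show ?thesis unfolding hs_energy_def by (simp add: ennreal_mult_less_top)
qed

lemma nn_norm_powr_ball_finite:
  assumes s: "0 < s" "s < real DIM('a::euclidean_space)"
  shows "(NBINT x. ennreal (indicator (cball (0::'a) R) x * norm x powr (- s))) < \<infinity>"
proof -
  let ?h = "\<lambda>(x :: 'a). norm x powr (- s) * exp (- (norm x)\<^sup>2)"
  have "(NBINT x. ennreal (indicator (cball (0::'a) R) x * norm x powr (- s))) \<le> (NBINT x. ennreal (exp (R\<^sup>2) * ?h x))"
  proof (intro nn_integral_mono ennreal_leI)
    fix x :: 'a
    show "indicator (cball (0::'a) R) x * norm x powr (- s) \<le> exp (R\<^sup>2) * ?h x"
    proof (cases "norm x \<le> R")
      case True
      then have "(norm x)\<^sup>2 \<le> R\<^sup>2" by (simp add: power_mono)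
      then have "1 \<le> exp (R\<^sup>2) * exp (- (norm x)\<^sup>2)" by (simp add: exp_add[symmetric])
      then have "norm x powr (- s) * 1 \<le> norm x powr (- s) * (exp (R\<^sup>2) * exp (- (norm x)\<^sup>2))" by (rule mult_left_mono) simp
      then show ?thesis using True by (simp add: mult_ac)
    qed simp
  qed
  also have "\<dots> = ennreal (exp (R\<^sup>2)) * (NBINT x. ennreal (?h x))"
    by (rule nn_cmult_real) auto
  also have "\<dots> < \<infinity>"
    unfolding nn_norm_powr_gauss[OF s] by (simp add: ennreal_mult_less_top)
  finally show ?thesis .
qed

lemma hardy_test_function:
  fixes f :: "'a::euclidean_space \<Rightarrow> real"
  assumes f: "f \<in> test_functions" and s: "0 < s" "s < 2" "s < real DIM('a)"
  shows "(NBINT x. ennreal ((f x)\<^sup>2 * norm x powr (- s))) \<le> ennreal (sharp_const DIM('a) s) * hs_energy s f"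
proof -
  obtain K R where K: "0 \<le> K" and R: "0 < R" and z: "\<And>x. R < norm x \<Longrightarrow> f x = 0" and L: "\<And>x y. (f x - f y)\<^sup>2 \<le> K * min 1 ((norm (x - y))\<^sup>2)"
    using test_function_bounds[OF f] by blast
  have [measurable]: "cball (0::'a) R \<in> sets borel" by (simp add: borel_closed)
  \<comment> \<open>A point where \<open>f\<close> vanishes turns the increment bound into a bound
    for \<open>f\<close> itself.\<close>
  obtain p :: 'a where p: "R < norm p" by (metis vector_choose_size less_add_one R add_pos_pos less_imp_le zero_less_one)
  have bd: "(f x)\<^sup>2 \<le> K * indicator (cball 0 R) x" for x
  proof (cases "norm x \<le> R")
    case True
    have "(f x)\<^sup>2 = (f x - f p)\<^sup>2" using z[OF p] by simp
    also have "\<dots> \<le> K * min 1 ((norm (x - p))\<^sup>2)" by (rule L)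
    also have "\<dots> \<le> K * 1" using K by (intro mult_left_mono) auto
    finally show ?thesis using True by simp
  next
    case False
    then show ?thesis using z by (simp add: not_le)
  qed
  have fin: "(NBINT x. ennreal ((f x)\<^sup>2 * h x)) < \<infinity>"
    if [measurable]: "h \<in> borel_measurable borel" and h: "\<And>x. 0 \<le> h x" "(NBINT x. ennreal (indicator (cball (0::'a) R) x * h x)) < \<infinity>" for h
  proof -
    have "(NBINT x. ennreal ((f x)\<^sup>2 * h x)) \<le> (NBINT x. ennreal (K * (indicator (cball (0::'a) R) x * h x)))"
      using mult_right_mono[OF bd h(1)] by (intro nn_integral_mono ennreal_leI) (simp add: mult.assoc)
    also have "\<dots> = ennreal K * (NBINT x. ennreal (indicator (cball (0::'a) R) x * h x))"
      using K by (intro nn_cmult_real) auto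
    also have "\<dots> < \<infinity>" using h by (simp add: ennreal_mult_less_top)
    finally show ?thesis .
  qed
  show ?thesis
  proof (rule hardy_L2[OF test_function_measurable[OF f] s])
    show "(NBINT x. ennreal ((f x)\<^sup>2)) < \<infinity>"
      using fin[of "\<lambda>_. 1"] emeasure_compact_finite[of "cball (0::'a) R"] by (simp add: ennreal_indicator)
    show "(NBINT x. ennreal ((f x)\<^sup>2 * norm x powr (- s))) < \<infinity>"
      using nn_norm_powr_ball_finite[OF s(1,3)] by (intro fin) auto
  qed
qed

section \<open>From test functions to the completion\<close>

lemma hs_energy_minus: "hs_energy s (\<lambda>x. f x - g x) = hs_energy s (\<lambda>x. g x - f x)"
proof -
  have "\<bar>f x - g x - (f y - g y)\<bar> = \<bar>g x - f x - (g y - f y)\<bar>" for x y by linarith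
  then show ?thesis unfolding hs_energy_def by simp
qed

text \<open>A quadratic substitute for the triangle inequality that needs no square roots in
  \<open>ennreal\<close>: \<open>2 * a * b \<le> \<eta> * a^2 + b^2 / \<eta>\<close>. As
  \<open>\<eta>\<close> may tend to 0, sharp constants survive the comparison.\<close>

lemma hs_energy_le_add:
  fixes f g :: "'a::euclidean_space \<Rightarrow> real"
  assumes [measurable]: "f \<in> borel_measurable borel" "g \<in> borel_measurable borel" and \<eta>: "0 < \<eta>"
  shows "hs_energy s f \<le> ennreal (1 + \<eta>) * hs_energy s g + ennreal (1 + 1 / \<eta>) * hs_energy s (\<lambda>x. f x - g x)"
proof -
  define k where "k = (\<lambda>x y :: 'a. norm (x - y) powr (real DIM('a) + s))"
  have [measurable]: "(\<lambda>(x, y). k x y) \<in> borel_measurable (borel \<Otimes>\<^sub>M borel)" unfolding k_def by measurable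
  have k0: "0 \<le> k x y" for x y by (simp add: k_def)
  define I where "I = (\<lambda>h :: 'a \<Rightarrow> real. (NBINT y. NBINT x. ennreal (\<bar>h x - h y\<bar>\<^sup>2 / k x y)))"
  let ?h = "\<lambda>x. f x - g x"
  have "I f \<le> (NBINT y. NBINT x. ennreal (1 + \<eta>) * ennreal (\<bar>g x - g y\<bar>\<^sup>2 / k x y) + ennreal (1 + 1 / \<eta>) * ennreal (\<bar>?h x - ?h y\<bar>\<^sup>2 / k x y))"
    unfolding I_def
  proof (intro nn_integral_mono)
    fix x y
    define a b where "a = g x - g y" and "b = ?h x - ?h y"
    have "0 \<le> (\<eta> * a - b)\<^sup>2 / \<eta>" using \<eta> by simp
    also have "\<dots> = \<eta> * a\<^sup>2 + b\<^sup>2 / \<eta> - 2 * a * b"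
      using \<eta> by (simp add: power2_eq_square field_simps)
    finally have "(a + b)\<^sup>2 \<le> (1 + \<eta>) * a\<^sup>2 + (1 + 1 / \<eta>) * b\<^sup>2"
      by (simp add: power2_eq_square algebra_simps)
    moreover have "f x - f y = a + b" by (simp add: a_def b_def)
    ultimately have "\<bar>f x - f y\<bar>\<^sup>2 / k x y \<le> ((1 + \<eta>) * \<bar>a\<bar>\<^sup>2 + (1 + 1 / \<eta>) * \<bar>b\<bar>\<^sup>2) / k x y"
      using k0 by (intro divide_right_mono) auto
    then have "ennreal (\<bar>f x - f y\<bar>\<^sup>2 / k x y) \<le> ennreal ((1 + \<eta>) * (\<bar>a\<bar>\<^sup>2 / k x y) + (1 + 1 / \<eta>) * (\<bar>b\<bar>\<^sup>2 / k x y))"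
      by (intro ennreal_leI) (simp only: add_divide_distrib times_divide_eq_right)
    also have "\<dots> = ennreal (1 + \<eta>) * ennreal (\<bar>a\<bar>\<^sup>2 / k x y) + ennreal (1 + 1 / \<eta>) * ennreal (\<bar>b\<bar>\<^sup>2 / k x y)"
    proof -
      have "ennreal ((1 + \<eta>) * (\<bar>a\<bar>\<^sup>2 / k x y)) = ennreal (1 + \<eta>) * ennreal (\<bar>a\<bar>\<^sup>2 / k x y)"
        "ennreal ((1 + 1 / \<eta>) * (\<bar>b\<bar>\<^sup>2 / k x y)) = ennreal (1 + 1 / \<eta>) * ennreal (\<bar>b\<bar>\<^sup>2 / k x y)"
        using \<eta> by (intro ennreal_mult'; simp)+
      moreover have "ennreal ((1 + \<eta>) * (\<bar>a\<bar>\<^sup>2 / k x y) + (1 + 1 / \<eta>) * (\<bar>b\<bar>\<^sup>2 / k x y)) =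
          ennreal ((1 + \<eta>) * (\<bar>a\<bar>\<^sup>2 / k x y)) + ennreal ((1 + 1 / \<eta>) * (\<bar>b\<bar>\<^sup>2 / k x y))"
        using \<eta> k0[of x y] by (intro ennreal_plus mult_nonneg_nonneg divide_nonneg_nonneg) auto
      ultimately show ?thesis by (simp only:)
    qed
    finally show "ennreal (\<bar>f x - f y\<bar>\<^sup>2 / k x y) \<le> ennreal (1 + \<eta>) * ennreal (\<bar>g x - g y\<bar>\<^sup>2 / k x y) + ennreal (1 + 1 / \<eta>) * ennreal (\<bar>?h x - ?h y\<bar>\<^sup>2 / k x y)"
      unfolding a_def b_def .
  qed
  also have "\<dots> = ennreal (1 + \<eta>) * I g + ennreal (1 + 1 / \<eta>) * I ?h"
    unfolding I_def by (simp add: nn_integral_add nn_integral_cmult)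
  finally have "ennreal (sobolev_const DIM('a) s) * I f \<le> ennreal (sobolev_const DIM('a) s) * (ennreal (1 + \<eta>) * I g + ennreal (1 + 1 / \<eta>) * I ?h)"
    by (rule mult_left_mono) simp
  then show ?thesis
    unfolding hs_energy_def I_def k_def by (simp only: distrib_left mult_ac)
qed

text \<open>The energy is finite by comparison with a single approximant. For Hardy's inequality the
  weighted integral passes to the limit by Fatou's lemma along the almost everywhere convergence,
  and the energies of the approximants are controlled up to the factor \<open>1 + \<eta>\<close>,
  which is removed at the end.\<close>

lemma
  fixes \<phi> :: "'a::euclidean_space \<Rightarrow> real"
  assumes \<phi>: "\<phi> \<in> hom_sobolev s" and s: "0 < s" "s < 2" "s < real DIM('a)"
  shows hom_sobolev_energy_finite: "hs_energy s \<phi> < \<infinity>"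
    and hom_sobolev_hardy: "(NBINT x. ennreal ((\<phi> x)\<^sup>2 * norm x powr (- s))) \<le> ennreal (sharp_const DIM('a) s) * hs_energy s \<phi>"
proof -
  define S where "S = sharp_const DIM('a) s"
  have S: "0 < S" unfolding S_def by (rule sharp_const_pos) (use s in auto)
  from \<phi> obtain u where [measurable]: "\<phi> \<in> borel_measurable borel" and u: "\<And>n. u n \<in> test_functions"
    and lim: "(\<lambda>n. hs_energy s (\<lambda>x. u n x - \<phi> x)) \<longlonglongrightarrow> 0" and ae: "AE x in lborel. (\<lambda>n. u n x) \<longlonglongrightarrow> \<phi> x"
    by (auto simp: hom_sobolev_def)
  have [measurable]: "u n \<in> borel_measurable borel" for n by (rule test_function_measurable[OF u])
  have ev: "\<forall>\<^sub>F n in sequentially. hs_energy s (\<lambda>x. u n x - \<phi> x) < ennreal d" if "0 < d" for d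
    by (rule order_tendstoD(2)[OF lim]) (use that in simp)
  obtain n0 where n0: "hs_energy s (\<lambda>x. u n0 x - \<phi> x) < ennreal 1"
    using eventually_happens'[OF _ ev[of 1]] by auto
  let ?h1 = "\<lambda>(x :: 'a). ennreal ((\<phi> x)\<^sup>2 * norm x powr (- s))"
  have "hs_energy s \<phi> \<le> ennreal (1 + 1) * hs_energy s (u n0) + ennreal (1 + 1 / 1) * hs_energy s (\<lambda>x. \<phi> x - u n0 x)"
    by (rule hs_energy_le_add) auto
  also have "\<dots> < \<infinity>"
    using test_function_energy_finite[OF u s(1,2), of n0] n0 less_trans[OF n0 ennreal_less_top]
    by (simp add: hs_energy_minus[of s \<phi>] ennreal_mult_less_top)
  finally show fin: "hs_energy s \<phi> < \<infinity>" .
  then obtain e where e: "hs_energy s \<phi> = ennreal e" "0 \<le> e" by (cases "hs_energy s \<phi>") auto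
  define H where "H = (NBINT x. ?h1 x)"
  let ?h2 = "\<lambda>n (x :: 'a). ennreal ((u n x)\<^sup>2 * norm x powr (- s))"
  have bound: "H \<le> ennreal (S * ((1 + \<eta>) * e + (\<eta>\<^sup>2 + \<eta>)))" if \<eta>: "0 < \<eta>" for \<eta>
  proof -
    have "H = (NBINT x. liminf (\<lambda>n. ?h2 n x))"
      unfolding H_def
    proof (rule nn_integral_cong_AE, rule AE_mp[OF ae], rule AE_I2, rule impI)
      fix x assume "(\<lambda>n. u n x) \<longlonglongrightarrow> \<phi> x"
      then have "(\<lambda>n. ?h2 n x) \<longlonglongrightarrow> (?h1 x)"
        by (intro tendsto_ennrealI tendsto_mult tendsto_power tendsto_const)
      then show "?h1 x = liminf (\<lambda>n. ?h2 n x)"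
        by (intro lim_imp_Liminf[symmetric]) auto
    qed
    also have "\<dots> \<le> liminf (\<lambda>n. (NBINT x. ?h2 n x))"
      by (rule nn_integral_liminf) measurable
    also have "\<dots> \<le> ennreal (S * ((1 + \<eta>) * e + (\<eta>\<^sup>2 + \<eta>)))"
    proof (rule Liminf_le)
      \<comment> \<open>The tolerance is \<open>\<eta>^2\<close> so that, multiplied by the large
        factor \<open>1 + 1 / \<eta>\<close>, it still vanishes with \<open>\<eta>\<close>.\<close>
      have "0 < \<eta>\<^sup>2" using \<eta> by simp
      from ev[OF this] show "\<forall>\<^sub>F n in sequentially. (NBINT x. ?h2 n x) \<le> ennreal (S * ((1 + \<eta>) * e + (\<eta>\<^sup>2 + \<eta>)))"
      proof (rule eventually_mono)
        fix n assume n: "hs_energy s (\<lambda>x. u n x - \<phi> x) < ennreal (\<eta>\<^sup>2)"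
        have "(NBINT x. ?h2 n x) \<le> ennreal S * hs_energy s (u n)"
          unfolding S_def by (rule hardy_test_function[OF u s])
        also have "\<dots> \<le> ennreal S * (ennreal (1 + \<eta>) * hs_energy s \<phi> + ennreal (1 + 1 / \<eta>) * hs_energy s (\<lambda>x. u n x - \<phi> x))"
          by (intro mult_left_mono hs_energy_le_add) (use \<eta> in auto)
        also have "\<dots> \<le> ennreal S * (ennreal (1 + \<eta>) * ennreal e + ennreal (1 + 1 / \<eta>) * ennreal (\<eta>\<^sup>2))"
          unfolding e(1) by (intro mult_left_mono add_left_mono less_imp_le[OF n]) auto
        also have "\<dots> = ennreal (S * ((1 + \<eta>) * e + (1 + 1 / \<eta>) * \<eta>\<^sup>2))"
          using S \<eta> e(2) by (simp add: ennreal_mult'[symmetric] ennreal_plus[symmetric] del: ennreal_plus)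
        also have "(1 + 1 / \<eta>) * \<eta>\<^sup>2 = \<eta>\<^sup>2 + \<eta>"
          using \<eta> by (simp add: power2_eq_square field_simps)
        finally show "(NBINT x. ?h2 n x) \<le> ennreal (S * ((1 + \<eta>) * e + (\<eta>\<^sup>2 + \<eta>)))" .
      qed
    qed simp
    finally show ?thesis .
  qed
  have "H \<le> ennreal (S * e)"
  proof (rule tendsto_lowerbound)
    have "((\<lambda>\<eta>. S * ((1 + \<eta>) * e + (\<eta>\<^sup>2 + \<eta>))) \<longlongrightarrow> S * ((1 + 0) * e + (0\<^sup>2 + 0))) (at_right 0)"
      by (intro tendsto_intros)
    then have "((\<lambda>\<eta>. S * ((1 + \<eta>) * e + (\<eta>\<^sup>2 + \<eta>))) \<longlongrightarrow> S * e) (at_right 0)" by simp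
    then show "((\<lambda>\<eta>. ennreal (S * ((1 + \<eta>) * e + (\<eta>\<^sup>2 + \<eta>)))) \<longlongrightarrow> ennreal (S * e)) (at_right 0)"
      by (rule tendsto_ennrealI)
    show "\<forall>\<^sub>F \<eta> in at_right 0. H \<le> ennreal (S * ((1 + \<eta>) * e + (\<eta>\<^sup>2 + \<eta>)))"
      using bound by (auto simp: eventually_at_right_field intro: exI[of _ 1])
  qed simp
  also have "ennreal (S * e) = ennreal S * hs_energy s \<phi>"
    unfolding e(1) using S by (simp add: ennreal_mult')
  finally show "(NBINT x. ?h1 x) \<le> ennreal (sharp_const DIM('a) s) * hs_energy s \<phi>"
    unfolding H_def S_def .
qed

text \<open>With the absolute value inside, the form is defined for every function; its finiteness
  is absolute integrability on the product space, and for a nonnegative kernel it is the quadratic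
  form itself.\<close>

definition riesz_form :: "real \<Rightarrow> real \<Rightarrow> ('a::euclidean_space \<Rightarrow> real) \<Rightarrow> ennreal" where
  "riesz_form \<alpha> s \<phi> = (NBINT y. NBINT x. ennreal \<bar>weighted_riesz_kernel \<alpha> s \<phi> x y\<bar>)"

lemma riesz_form_le:
  fixes \<phi> :: "'a::euclidean_space \<Rightarrow> real"
  assumes \<phi>: "\<phi> \<in> hom_sobolev s" and s: "0 < s" "s < 2" "s < real DIM('a)" and \<alpha>: "0 < \<alpha>" "\<alpha> < real DIM('a)"
  shows "riesz_form \<alpha> s \<phi> \<le> ennreal (sharp_const DIM('a) \<alpha> * sharp_const DIM('a) s) * hs_energy s \<phi>"
proof -
  have m: "\<phi> \<in> borel_measurable borel" using \<phi> by (simp add: hom_sobolev_def)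
  have "riesz_form \<alpha> s \<phi> \<le> ennreal (sharp_const DIM('a) \<alpha>) * (NBINT x. ennreal ((\<phi> x)\<^sup>2 * norm x powr (- s)))"
    unfolding riesz_form_def by (rule stein_weiss[OF \<alpha> m])
  also have "\<dots> \<le> ennreal (sharp_const DIM('a) \<alpha>) * (ennreal (sharp_const DIM('a) s) * hs_energy s \<phi>)"
    by (intro mult_left_mono hom_sobolev_hardy[OF \<phi> s]) simp
  finally show ?thesis
    using sharp_const_pos[OF \<alpha>] by (simp add: ennreal_mult' mult.assoc)
qed

text \<open>Absolute integrability lets Fubini replace the iterated Bochner integral by the integral
  over the product, which is then compared with the integral of the absolute value.\<close>

lemma
  fixes \<phi> :: "'a::euclidean_space \<Rightarrow> real"
  assumes [measurable]: "\<phi> \<in> borel_measurable borel" and fin: "riesz_form \<alpha> s \<phi> < \<infinity>"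
  shows weighted_riesz_kernel_integrable: "integrable (lborel \<Otimes>\<^sub>M lborel) (\<lambda>(x, y). weighted_riesz_kernel \<alpha> s \<phi> x y)"
    and weighted_riesz_kernel_LINT_le: "(LINT y|lborel. LINT x|lborel. weighted_riesz_kernel \<alpha> s \<phi> x y) \<le> enn2real (riesz_form \<alpha> s \<phi>)"
    and weighted_riesz_kernel_LINT_eq: "(\<And>x y. 0 \<le> weighted_riesz_kernel \<alpha> s \<phi> x y) \<Longrightarrow>
      (LINT y|lborel. LINT x|lborel. weighted_riesz_kernel \<alpha> s \<phi> x y) = enn2real (riesz_form \<alpha> s \<phi>)"
proof -
  let ?W = "\<lambda>(x, y). weighted_riesz_kernel \<alpha> s \<phi> x y"
  have [measurable]: "?W \<in> borel_measurable (lborel \<Otimes>\<^sub>M lborel)" by measurable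
  have form: "(\<integral>\<^sup>+ p. ennreal (norm (?W p)) \<partial>(lborel \<Otimes>\<^sub>M lborel)) = riesz_form \<alpha> s \<phi>"
    unfolding riesz_form_def by (subst lborel_pair.nn_integral_snd[symmetric]) auto
  show int: "integrable (lborel \<Otimes>\<^sub>M lborel) ?W"
    using fin form by (intro integrableI_bounded) auto
  let ?h = "\<lambda>(x :: 'a). LINT y|lborel. LINT x|lborel. weighted_riesz_kernel \<alpha> s \<phi> x y"
  have eq: "(?h x) = (LINT p|(lborel \<Otimes>\<^sub>M lborel). ?W p)"
    by (rule lborel_pair.integral_snd[OF int])
  have abs: "(LINT p|(lborel \<Otimes>\<^sub>M lborel). norm (?W p)) = enn2real (riesz_form \<alpha> s \<phi>)"
    unfolding form[symmetric] by (rule integral_eq_nn_integral) auto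
  show "(?h x) \<le> enn2real (riesz_form \<alpha> s \<phi>)"
    unfolding eq abs[symmetric] using int by (intro integral_mono) (auto simp: abs_ge_self)
  assume "\<And>x y. 0 \<le> weighted_riesz_kernel \<alpha> s \<phi> x y"
  then show "(?h x) = enn2real (riesz_form \<alpha> s \<phi>)"
    unfolding eq abs[symmetric] by (intro Bochner_Integration.integral_cong) auto
qed

lemma hs_energy_scale:
  fixes \<phi> :: "'a::euclidean_space \<Rightarrow> real"
  assumes [measurable]: "\<phi> \<in> borel_measurable borel"
  shows "hs_energy s (\<lambda>x. c * \<phi> x) = ennreal (c\<^sup>2) * hs_energy s \<phi>"
proof -
  have "ennreal (\<bar>c * \<phi> x - c * \<phi> y\<bar>\<^sup>2 / norm (x - y) powr (real DIM('a) + s)) = ennreal (c\<^sup>2) * ennreal (\<bar>\<phi> x - \<phi> y\<bar>\<^sup>2 / norm (x - y) powr (real DIM('a) + s))" for x y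
    by (subst ennreal_mult'[symmetric]) (simp_all add: right_diff_distrib[symmetric] power_mult_distrib abs_mult)
  then show ?thesis
    unfolding hs_energy_def by (simp add: nn_integral_cmult mult.left_commute)
qed

lemma riesz_form_scale:
  fixes \<phi> :: "'a::euclidean_space \<Rightarrow> real"
  assumes [measurable]: "\<phi> \<in> borel_measurable borel"
  shows "riesz_form \<alpha> s (\<lambda>x. c * \<phi> x) = ennreal (c\<^sup>2) * riesz_form \<alpha> s \<phi>"
proof -
  have "\<bar>weighted_riesz_kernel \<alpha> s (\<lambda>x. c * \<phi> x) x y\<bar> = c\<^sup>2 * \<bar>weighted_riesz_kernel \<alpha> s \<phi> x y\<bar>" for x y
    unfolding weighted_riesz_kernel_def by (simp add: abs_mult power2_eq_square)
  then have "ennreal \<bar>weighted_riesz_kernel \<alpha> s (\<lambda>x. c * \<phi> x) x y\<bar> = ennreal (c\<^sup>2) * ennreal \<bar>weighted_riesz_kernel \<alpha> s \<phi> x y\<bar>" for x y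
    by (simp add: ennreal_mult')
  then show ?thesis
    unfolding riesz_form_def by (simp add: nn_integral_cmult)
qed

section \<open>Smooth radial functions\<close>

text \<open>Smoothness is witnessed by the whole sequence of derivatives at once, so that explicit
  sequences for bumps, affine substitutions and Laplace integrals can be supplied without induction
  on the order.\<close>

definition smooth_real :: "(real \<Rightarrow> real) \<Rightarrow> bool" where
  "smooth_real f \<longleftrightarrow> (\<exists>d. d 0 = f \<and> (\<forall>n x. (d n has_real_derivative d (Suc n) x) (at x)))"

lemma smooth_realI:
  assumes "d 0 = f" "\<And>n x. (d n has_real_derivative d (Suc n) x) (at x)"
  shows "smooth_real f"
  using assms unfolding smooth_real_def by blast

lemma smooth_real_derivE:
  assumes "smooth_real f"
  obtains f' where "smooth_real f'" "\<And>x. (f has_real_derivative f' x) (at x)"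
proof -
  obtain d where d: "d 0 = f" "\<And>n x. (d n has_real_derivative d (Suc n) x) (at x)"
    using assms unfolding smooth_real_def by blast
  have "smooth_real (d 1)"
    by (rule smooth_realI[of "\<lambda>n. d (Suc n)"]) (auto intro: d)
  moreover have "\<And>x. (f has_real_derivative d 1 x) (at x)" using d(2)[of 0] d(1) by simp
  ultimately show thesis by (rule that)
qed

lemma smooth_real_affine:
  assumes "smooth_real f"
  shows "smooth_real (\<lambda>x. c * f (p + q * x))"
proof -
  obtain d where d: "d 0 = f" "\<And>n x. (d n has_real_derivative d (Suc n) x) (at x)"
    using assms unfolding smooth_real_def by blast
  show ?thesis
  proof (rule smooth_realI[of "\<lambda>n x. c * q ^ n * d n (p + q * x)"])
    show "((\<lambda>x. c * q ^ n * d n (p + q * x)) has_real_derivative c * q ^ Suc n * d (Suc n) (p + q * x)) (at x)" for n x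
      by (rule derivative_eq_intros DERIV_chain'[OF _ d(2)] refl)+ (simp add: mult_ac)
  qed (simp add: d)
qed

text \<open>The polynomial \<open>p\<close> for which the derivative of order \<open>n\<close> of
  \<open>exp (- (1 / t))\<close> equals \<open>p (1 / t) * exp (- (1 / t))\<close>. Differentiating
  \<open>1 / t\<close> gives \<open>- (1 / t)^2\<close>, whence the factor
  \<open>[:0, 0, 1:]\<close> and the minus sign before \<open>pderiv\<close>.\<close>

primrec bump_poly :: "nat \<Rightarrow> real poly" where
  "bump_poly 0 = 1"
| "bump_poly (Suc n) = [:0, 0, 1:] * (bump_poly n - pderiv (bump_poly n))"

definition bump :: "nat \<Rightarrow> real \<Rightarrow> real" where
  "bump n t = (if 0 < t then poly (bump_poly n) (1 / t) * exp (- (1 / t)) else 0)"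

lemma poly_times_exp_tendsto_0:
  fixes p :: "real poly"
  shows "((\<lambda>y. poly p y * exp (- y)) \<longlongrightarrow> 0) at_top"
proof -
  have "((\<lambda>y. \<Sum>i\<le>degree p. coeff p i * (y ^ i / exp y)) \<longlongrightarrow> 0) at_top"
    by (intro tendsto_null_sum tendsto_mult_right_zero tendsto_power_div_exp_0)
  then show ?thesis
    by (simp add: poly_altdef sum_distrib_right exp_minus divide_inverse mult.assoc)
qed

lemma bump_deriv: "(bump n has_real_derivative bump (Suc n) t) (at t)"
proof -
  consider "t < 0" | "0 < t" | "t = 0" by linarith
  then show ?thesis
  proof cases
    case 1
    have "((\<lambda>_. 0) has_real_derivative bump (Suc n) t) (at t)"
      using 1 by (simp add: bump_def)
    then show ?thesis
      by (rule has_field_derivative_transform_within_open[of _ _ _ "{..<0}"]) (use 1 in \<open>auto simp: bump_def\<close>)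
  next
    case 2
    have "((\<lambda>t. poly (bump_poly n) (1 / t) * exp (- (1 / t))) has_real_derivative
      poly (pderiv (bump_poly n)) (1 / t) * (- (1 / t\<^sup>2)) * exp (- (1 / t)) + poly (bump_poly n) (1 / t) * (exp (- (1 / t)) * (1 / t\<^sup>2))) (at t)"
      using 2 by (auto intro!: derivative_eq_intros DERIV_chain'[OF _ poly_DERIV] simp: power2_eq_square divide_inverse)
    moreover have "poly (pderiv (bump_poly n)) (1 / t) * (- (1 / t\<^sup>2)) * exp (- (1 / t)) + poly (bump_poly n) (1 / t) * (exp (- (1 / t)) * (1 / t\<^sup>2)) = bump (Suc n) t"
      using 2 by (simp add: bump_def power2_eq_square algebra_simps)
    ultimately have "((\<lambda>t. poly (bump_poly n) (1 / t) * exp (- (1 / t))) has_real_derivative bump (Suc n) t) (at t)" by simp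
    then show ?thesis
      by (rule has_field_derivative_transform_within_open[of _ _ _ "{0<..}"]) (use 2 in \<open>auto simp: bump_def\<close>)
  next
    case 3
    have "((\<lambda>y. (bump n y - bump n 0) / (y - 0)) \<longlongrightarrow> 0) (at 0)"
    proof (rule filterlim_split_at)
      show "((\<lambda>y. (bump n y - bump n 0) / (y - 0)) \<longlongrightarrow> 0) (at_left 0)"
        by (rule tendsto_eventually) (auto simp: eventually_at_left_field bump_def intro: exI[of _ "-1"])
      \<comment> \<open>With \<open>y = 1 / t\<close> the difference quotient at 0 from the right is
        a polynomial times \<open>exp (- y)\<close> for \<open>y\<close> tending to infinity;
        dividing by \<open>t\<close> contributes the factor \<open>[:0, 1:]\<close>.\<close>
      have "((\<lambda>y. poly ([:0, 1:] * bump_poly n) y * exp (- y)) \<longlongrightarrow> 0) at_top"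
        by (rule poly_times_exp_tendsto_0)
      then show "((\<lambda>y. (bump n y - bump n 0) / (y - 0)) \<longlongrightarrow> 0) (at_right 0)"
        unfolding filterlim_at_right_to_top
      proof (rule filterlim_cong[THEN iffD1, OF refl refl, rotated])
        show "\<forall>\<^sub>F y in at_top. poly ([:0, 1:] * bump_poly n) y * exp (- y) = (bump n (inverse y) - bump n 0) / (inverse y - 0)"
          using eventually_gt_at_top[of 0] by eventually_elim (simp add: bump_def divide_inverse mult_ac)
      qed
    qed
    then show ?thesis unfolding 3 has_field_derivative_iff by (simp add: bump_def)
  qed
qed

lemma smooth_real_bump: "smooth_real (bump 0)"
  by (rule smooth_realI[of bump]) (auto intro: bump_deriv)

lemma bump_0_eq: "bump 0 t = (if 0 < t then exp (- (1 / t)) else 0)"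
  by (simp add: bump_def)

text \<open>
  Finite sums of products of coordinates and smooth functions of \<open>x \<bullet> x\<close> are closed under directional derivatives,
  which gives smoothness of all orders at once.
\<close>

inductive radial_alg :: "('a::euclidean_space \<Rightarrow> real) \<Rightarrow> bool" where
  const: "radial_alg (\<lambda>x. c)"
| inner: "radial_alg (\<lambda>x. x \<bullet> v)"
| add: "radial_alg f \<Longrightarrow> radial_alg g \<Longrightarrow> radial_alg (\<lambda>x. f x + g x)"
| mult: "radial_alg f \<Longrightarrow> radial_alg g \<Longrightarrow> radial_alg (\<lambda>x. f x * g x)"
| radial: "smooth_real h \<Longrightarrow> radial_alg (\<lambda>x. h (x \<bullet> x))"

lemma radial_alg_derivative:
  assumes "radial_alg (f :: 'a::euclidean_space \<Rightarrow> real)"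
  shows "\<exists>f'. (\<forall>x. (f has_derivative f' x) (at x)) \<and> (\<forall>v. radial_alg (\<lambda>x. f' x v))"
  using assms
proof induction
  case (const c)
  then show ?case
    by (intro exI[of _ "\<lambda>x v. 0"]) (auto intro: radial_alg.const)
next
  case (inner w)
  then show ?case
    by (intro exI[of _ "\<lambda>x v. v \<bullet> w"]) (auto intro!: radial_alg.const derivative_eq_intros)
next
  case (add f g)
  then obtain f' g' where "\<forall>x. (f has_derivative f' x) (at x)" "\<forall>v. radial_alg (\<lambda>x. f' x v)" "\<forall>x. (g has_derivative g' x) (at x)" "\<forall>v. radial_alg (\<lambda>x. g' x v)"
    by blast
  then show ?case
    by (intro exI[of _ "\<lambda>x v. f' x v + g' x v"]) (auto intro: radial_alg.add has_derivative_add)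
next
  case (mult f g)
  then obtain f' g' where "\<forall>x. (f has_derivative f' x) (at x)" "\<forall>v. radial_alg (\<lambda>x. f' x v)" "\<forall>x. (g has_derivative g' x) (at x)" "\<forall>v. radial_alg (\<lambda>x. g' x v)"
    by blast
  moreover from this have "radial_alg (\<lambda>x. f x * g' x v + f' x v * g x)" for v
    using mult.hyps by (intro radial_alg.add radial_alg.mult[of f "\<lambda>x. g' x v"] radial_alg.mult[of "\<lambda>x. f' x v" g]) simp_all
  ultimately show ?case
    by (intro exI[of _ "\<lambda>x v. f x * g' x v + f' x v * g x"]) (auto intro: has_derivative_mult)
next
  case (radial h)
  then obtain h' where h': "smooth_real h'" "\<And>x. (h has_real_derivative h' x) (at x)"
    by (rule smooth_real_derivE) blast
  have "((\<lambda>x. h (x \<bullet> x)) has_derivative (\<lambda>v. h' (x \<bullet> x) * (2 * (v \<bullet> x)))) (at x)" for x :: 'a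
  proof -
    have "((\<lambda>x. x \<bullet> x) has_derivative (\<lambda>v. 2 * (v \<bullet> x))) (at x)"
      by (auto intro!: derivative_eq_intros simp: inner_commute)
    from has_derivative_compose[OF this has_field_derivative_imp_has_derivative[OF h'(2)]]
    show ?thesis by simp
  qed
  moreover have "radial_alg (\<lambda>x. h' (x \<bullet> x) * (2 * (v \<bullet> x)))" for v :: 'a
    using radial_alg.inner[of v] by (intro radial_alg.mult radial_alg.radial h' radial_alg.const) (simp add: inner_commute)
  ultimately show ?case
    by (intro exI[of _ "\<lambda>x v. h' (x \<bullet> x) * (2 * (v \<bullet> x))"]) auto
qed

lemma radial_alg_C_k: "radial_alg f \<Longrightarrow> C_k k f"
proof (induction k arbitrary: f)
  case 0
  then obtain f' where "\<And>x. (f has_derivative f' x) (at x)" using radial_alg_derivative by blast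
  then have "\<forall>x. f differentiable (at x)" by (auto simp: differentiable_def)
  then show ?case by (simp add: differentiable_continuous_UNIV)
next
  case (Suc k)
  then obtain f' where f': "\<And>x. (f has_derivative f' x) (at x)" "\<And>v. radial_alg (\<lambda>x. f' x v)" using radial_alg_derivative by blast
  have "frechet_derivative f (at x) = f' x" for x
    using frechet_derivative_at[OF f'(1)] by simp
  moreover have "f differentiable (at x)" for x using f'(1) by (auto simp: differentiable_def)
  ultimately show ?case using Suc.IH[OF f'(2)] by simp
qed

text \<open>The factor \<open>exp 1\<close> normalises the value at 0 to 1. The cutoff is not
  constant on any ball, but tends to 1 pointwise, which is all that the limits below use;
  \<open>x \<bullet> x\<close> in place of the norm keeps it smooth at the origin.\<close>

definition cutoff :: "nat \<Rightarrow> 'a::euclidean_space \<Rightarrow> real" where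
  "cutoff n x = exp 1 * bump 0 (1 - (x \<bullet> x) / (real (Suc n))\<^sup>2)"

lemma radial_alg_cutoff: "radial_alg (cutoff n)"
proof -
  have "smooth_real (\<lambda>r. exp 1 * bump 0 (1 + (- (1 / (real (Suc n))\<^sup>2)) * r))"
    by (rule smooth_real_affine[OF smooth_real_bump])
  then have "radial_alg (\<lambda>x :: 'a. exp 1 * bump 0 (1 + (- (1 / (real (Suc n))\<^sup>2)) * (x \<bullet> x)))"
    by (rule radial_alg.radial)
  then show ?thesis unfolding cutoff_def[abs_def] by simp
qed

lemma cutoff_nonneg: "0 \<le> cutoff n x"
  by (simp add: cutoff_def bump_0_eq)

lemma cutoff_le_1: "cutoff n x \<le> 1"
proof (cases "0 < 1 - (x \<bullet> x) / (real (Suc n))\<^sup>2")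
  case True
  define t where "t = 1 - (x \<bullet> x) / (real (Suc n))\<^sup>2"
  have t: "0 < t" "t \<le> 1" using True by (auto simp: t_def)
  then have "1 - 1 / t \<le> 0" by simp
  have "cutoff n x = exp (1 - 1 / t)"
    unfolding cutoff_def t_def[symmetric] bump_0_eq using t by (simp add: exp_diff exp_minus divide_inverse)
  also have "\<dots> \<le> 1" using \<open>1 - 1 / t \<le> 0\<close> by simp
  finally show ?thesis .
qed (simp add: cutoff_def bump_0_eq)

lemma cutoff_eq_0:
  assumes "real (Suc n) \<le> norm x"
  shows "cutoff n x = 0"
proof -
  have "(real (Suc n))\<^sup>2 \<le> x \<bullet> x" using assms by (simp add: power2_norm_eq_inner[symmetric] power_mono)
  then have "1 \<le> (x \<bullet> x) / (real (Suc n))\<^sup>2" by (simp add: field_simps)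
  then show ?thesis by (simp add: cutoff_def bump_0_eq)
qed

lemma cutoff_tendsto: "(\<lambda>n. cutoff n x) \<longlonglongrightarrow> 1"
proof -
  have "(\<lambda>n. (x \<bullet> x) / (real (Suc n))\<^sup>2) \<longlonglongrightarrow> 0"
    by real_asymp
  from tendsto_diff[OF tendsto_const[of 1] this]
  have t: "(\<lambda>n. 1 - (x \<bullet> x) / (real (Suc n))\<^sup>2) \<longlonglongrightarrow> 1" by simp
  have "isCont (bump 0) 1" using bump_deriv[of 0 1] by (rule DERIV_isCont)
  then have "(\<lambda>n. bump 0 (1 - (x \<bullet> x) / (real (Suc n))\<^sup>2)) \<longlonglongrightarrow> bump 0 1"
    by (rule isCont_tendsto_compose[OF _ t])
  then have "(\<lambda>n. cutoff n x) \<longlonglongrightarrow> exp 1 * bump 0 1"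
    unfolding cutoff_def by (intro tendsto_mult tendsto_const)
  then show ?thesis by (simp add: bump_0_eq exp_minus)
qed

lemma test_functionI:
  assumes "radial_alg f" and z: "\<And>x. R < norm x \<Longrightarrow> f x = 0"
  shows "f \<in> test_functions"
proof -
  have "support_on UNIV f \<subseteq> cball 0 R" using z by (auto simp: support_on_def not_less[symmetric])
  then have "closure (support_on UNIV f) \<subseteq> cball 0 R" by (rule closure_minimal) simp
  then have "compact (closure (support_on UNIV f))"
    using bounded_subset[OF bounded_cball] by (auto simp: compact_eq_bounded_closed)
  then show ?thesis using radial_alg_C_k[OF assms(1)] by (simp add: test_functions_def)
qed

lemma cutoff_mult_test_function:
  assumes "radial_alg f"
  shows "(\<lambda>x. f x * cutoff n x) \<in> test_functions"
  by (rule test_functionI[of _ "real (Suc n)"]) (auto intro: radial_alg.mult assms radial_alg_cutoff cutoff_eq_0)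

text \<open>Each cutoff is \<open>cutoff 0\<close> composed with a contraction, so the bound for
  this single test function holds with the same \<open>K\<close> for all \<open>n\<close>.\<close>

lemma cutoff_lipschitz:
  "\<exists>K. 0 \<le> K \<and> (\<forall>n x y. (cutoff n x - cutoff n (y :: 'a::euclidean_space))\<^sup>2 \<le> K * min 1 ((norm (x - y))\<^sup>2))"
proof -
  have tf: "cutoff 0 \<in> (test_functions :: ('a \<Rightarrow> real) set)"
  proof (rule test_functionI[OF radial_alg_cutoff])
    fix x :: 'a assume "1 < norm x"
    then show "cutoff 0 x = 0" by (intro cutoff_eq_0) simp
  qed
  obtain K R where K: "0 \<le> K" and "0 < R" and "\<And>x :: 'a. R < norm x \<Longrightarrow> cutoff 0 x = 0"
      and K2: "\<And>x y. (cutoff 0 x - cutoff 0 (y :: 'a))\<^sup>2 \<le> K * min 1 ((norm (x - y))\<^sup>2)"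
    using test_function_bounds[OF tf] by blast
  have "(cutoff n x - cutoff n (y :: 'a))\<^sup>2 \<le> K * min 1 ((norm (x - y))\<^sup>2)" for n x y
  proof -
    define c where "c = 1 / real (Suc n)"
    have c: "0 \<le> c" "c \<le> 1" by (auto simp: c_def)
    have sc: "cutoff n z = cutoff 0 (c *\<^sub>R z)" for z :: 'a
      by (simp add: cutoff_def c_def power2_eq_square divide_inverse mult_ac)
    have "(norm (c *\<^sub>R x - c *\<^sub>R y))\<^sup>2 \<le> (norm (x - y))\<^sup>2"
    proof (rule power_mono)
      have "norm (c *\<^sub>R x - c *\<^sub>R y) = c * norm (x - y)"
        using c by (simp add: scaleR_diff_right[symmetric])
      also have "\<dots> \<le> norm (x - y)" using c by (simp add: mult_left_le_one_le)
      finally show "norm (c *\<^sub>R x - c *\<^sub>R y) \<le> norm (x - y)" .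
    qed simp
    then have "K * min 1 ((norm (c *\<^sub>R x - c *\<^sub>R y))\<^sup>2) \<le> K * min 1 ((norm (x - y))\<^sup>2)"
      using K by (intro mult_left_mono min.mono) auto
    then show ?thesis unfolding sc using K2[of "c *\<^sub>R x" "c *\<^sub>R y"] by linarith
  qed
  then show ?thesis using K by blast
qed

text \<open>Differentiation under the integral over a compact interval; each derivative in
  \<open>r\<close> brings down a factor \<open>- u\<close>, which yields the sequence of derivatives
  explicitly.\<close>

lemma smooth_real_laplace:
  fixes m :: "real \<Rightarrow> real"
  assumes m: "continuous_on {a..b} m"
  shows "smooth_real (\<lambda>r. integral {a..b} (\<lambda>u. m u * exp (- (u * r))))"
proof (rule smooth_realI[of "\<lambda>n r. integral {a..b} (\<lambda>u. (- u) ^ n * m u * exp (- (u * r)))"])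
  fix n r
  have c: "continuous_on (UNIV \<times> {a..b}) (\<lambda>(r, u). (- u) ^ Suc n * m u * exp (- (u * r)))"
    unfolding case_prod_beta
    by (intro continuous_intros continuous_on_compose2[OF m]) auto
  have "((\<lambda>r. integral (cbox a b) (\<lambda>u. (- u) ^ n * m u * exp (- (u * r)))) has_real_derivative
    integral (cbox a b) (\<lambda>u. (- u) ^ Suc n * m u * exp (- (u * r)))) (at r within UNIV)"
  proof (rule leibniz_rule_field_derivative)
    show "((\<lambda>r. (- u) ^ n * m u * exp (- (u * r))) has_real_derivative (- u) ^ Suc n * m u * exp (- (u * r))) (at r within UNIV)" for r u
      by (auto intro!: derivative_eq_intros simp: mult_ac)
    show "(\<lambda>u. (- u) ^ n * m u * exp (- (u * r))) integrable_on cbox a b" for r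
      by (intro integrable_continuous continuous_intros) (use m in auto)
  qed (use c in auto)
  then show "((\<lambda>r. integral {a..b} (\<lambda>u. (- u) ^ n * m u * exp (- (u * r)))) has_real_derivative
    integral {a..b} (\<lambda>u. (- u) ^ Suc n * m u * exp (- (u * r)))) (at r)"
    by simp
qed simp

section \<open>Trial functions\<close>

lemma radial_alg_measurable: "radial_alg f \<Longrightarrow> f \<in> borel_measurable borel"
  using radial_alg_C_k[of f 0] by (simp add: borel_measurable_continuous_onI)

lemma borel_measurable_cutoff [measurable]: "cutoff n \<in> borel_measurable borel"
  by (rule radial_alg_measurable[OF radial_alg_cutoff])

text \<open>Dominated convergence. The increment of the product splits into an increment of
  \<open>\<phi>\<close>, dominated by the finite energy, and \<open>\<phi> y\<close> times an
  increment of the cutoff, dominated uniformly in \<open>n\<close> through the L2 norm and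
  \<open>cutoff_lipschitz\<close>.\<close>

lemma hs_energy_cutoff_tendsto:
  fixes \<phi> :: "'a::euclidean_space \<Rightarrow> real"
  assumes [measurable]: "\<phi> \<in> borel_measurable borel" and s: "0 < s" "s < 2"
    and L2: "(NBINT x. ennreal ((\<phi> x)\<^sup>2)) < \<infinity>" and fin: "hs_energy s \<phi> < \<infinity>"
  shows "(\<lambda>n. hs_energy s (\<lambda>x. \<phi> x * cutoff n x)) \<longlonglongrightarrow> hs_energy s \<phi>"
proof -
  obtain K where K: "0 \<le> K" and lip: "\<And>n x y. (cutoff n x - cutoff n (y :: 'a))\<^sup>2 \<le> K * min 1 ((norm (x - y))\<^sup>2)"
    using cutoff_lipschitz[where 'a = 'a] by blast
  define k where "k = (\<lambda>x y :: 'a. norm (x - y) powr (real DIM('a) + s))"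
  have [measurable]: "(\<lambda>(x, y). k x y) \<in> borel_measurable (borel \<Otimes>\<^sub>M borel)" unfolding k_def by measurable
  let ?h1 = "\<lambda>(x :: 'a) (y :: 'a). (\<phi> x)\<^sup>2 + (\<phi> y)\<^sup>2"
  let ?h2 = "\<lambda>(x :: 'a) (y :: 'a). \<bar>\<phi> x - \<phi> y\<bar>\<^sup>2 / k x y"
  let ?h3 = "\<lambda>(x :: 'a) n (y :: 'a). ennreal (\<bar>\<phi> x * cutoff n x - \<phi> y * cutoff n y\<bar>\<^sup>2 / k x y)"
  have k0: "0 \<le> k x y" for x y by (simp add: k_def)
  define U where "U = (\<lambda>n (x, y :: 'a). ?h3 x n y)"
  define V where "V = (\<lambda>(x, y :: 'a). ennreal (?h2 x y))"
  define Z where "Z = (\<lambda>(x, y :: 'a). ennreal (K * min 1 ((norm (x - y))\<^sup>2) * (?h1 x y) / k x y))"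
  have [measurable]: "U n \<in> borel_measurable (lborel \<Otimes>\<^sub>M lborel)" "V \<in> borel_measurable (lborel \<Otimes>\<^sub>M lborel)" "Z \<in> borel_measurable (lborel \<Otimes>\<^sub>M lborel)" for n
    unfolding U_def V_def Z_def by measurable
  have EU: "hs_energy s (\<lambda>x. \<phi> x * cutoff n x) = ennreal (sobolev_const DIM('a) s) * (\<integral>\<^sup>+ p. U n p \<partial>(lborel \<Otimes>\<^sub>M lborel))" for n
    unfolding hs_energy_def by (subst lborel_pair.nn_integral_snd[symmetric]) (auto simp: U_def k_def)
  have EV: "hs_energy s \<phi> = ennreal (sobolev_const DIM('a) s) * (\<integral>\<^sup>+ p. V p \<partial>(lborel \<Otimes>\<^sub>M lborel))"
    unfolding hs_energy_def by (subst lborel_pair.nn_integral_snd[symmetric]) (auto simp: V_def k_def)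
  have Vfin: "(\<integral>\<^sup>+ p. V p \<partial>(lborel \<Otimes>\<^sub>M lborel)) < \<infinity>"
    using fin sobolev_const_pos[OF s, of "DIM('a)"] unfolding EV by (auto simp: ennreal_mult_less_top ennreal_eq_0_iff)
  have Zfin: "(\<integral>\<^sup>+ p. Z p \<partial>(lborel \<Otimes>\<^sub>M lborel)) < \<infinity>"
    using nn_kernel_min_weighted_finite[OF s K, of "\<lambda>x :: 'a. (\<phi> x)\<^sup>2"] L2
    by (subst lborel_pair.nn_integral_snd[symmetric]) (auto simp: Z_def k_def)
  have "(\<lambda>n. \<integral>\<^sup>+ p. U n p \<partial>(lborel \<Otimes>\<^sub>M lborel)) \<longlonglongrightarrow> (\<integral>\<^sup>+ p. V p \<partial>(lborel \<Otimes>\<^sub>M lborel))"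
  proof (rule nn_integral_dominated_convergence[where w = "\<lambda>p. 2 * V p + 2 * Z p"])
    show "(\<integral>\<^sup>+ p. 2 * V p + 2 * Z p \<partial>(lborel \<Otimes>\<^sub>M lborel)) < \<infinity>"
      using Vfin Zfin by (simp add: nn_integral_add nn_integral_cmult ennreal_mult_less_top)
    show "AE p in lborel \<Otimes>\<^sub>M lborel. U n p \<le> 2 * V p + 2 * Z p" for n
    proof (rule AE_I2)
      fix p :: "'a \<times> 'a"
      obtain x y where p: "p = (x, y)" by (cases p)
      define a b where "a = (\<phi> x - \<phi> y) * cutoff n x" and "b = \<phi> y * (cutoff n x - cutoff n y)"
      have "\<bar>\<phi> x * cutoff n x - \<phi> y * cutoff n y\<bar>\<^sup>2 = (a + b)\<^sup>2"
        by (simp add: a_def b_def algebra_simps)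
      also have "\<dots> \<le> 2 * a\<^sup>2 + 2 * b\<^sup>2"
        using zero_le_power2[of "a - b"] by (simp add: power2_eq_square algebra_simps)
      also have "a\<^sup>2 \<le> \<bar>\<phi> x - \<phi> y\<bar>\<^sup>2"
        unfolding a_def power_mult_distrib using cutoff_nonneg[of n x] cutoff_le_1[of n x]
        by (simp add: mult_left_le power_le_one)
      also have "b\<^sup>2 \<le> K * min 1 ((norm (x - y))\<^sup>2) * ?h1 x y"
      proof -
        have "b\<^sup>2 \<le> (\<phi> y)\<^sup>2 * (K * min 1 ((norm (x - y))\<^sup>2))"
          unfolding b_def power_mult_distrib by (intro mult_left_mono lip) simp
        also have "\<dots> \<le> ?h1 x y * (K * min 1 ((norm (x - y))\<^sup>2))"
          using K by (intro mult_right_mono) auto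
        finally show ?thesis by (simp add: mult_ac)
      qed
      finally have "\<bar>\<phi> x * cutoff n x - \<phi> y * cutoff n y\<bar>\<^sup>2 / k x y \<le>
        (2 * \<bar>\<phi> x - \<phi> y\<bar>\<^sup>2 + 2 * (K * min 1 ((norm (x - y))\<^sup>2) * ?h1 x y)) / k x y"
        using k0 by (intro divide_right_mono) auto
      also have "\<dots> = 2 * ?h2 x y + 2 * (K * min 1 ((norm (x - y))\<^sup>2) * (?h1 x y) / k x y)"
        by (simp only: add_divide_distrib times_divide_eq_right)
      finally have "?h3 x n y \<le> ennreal \<dots>"
        by (rule ennreal_leI)
      also have "\<dots> = ennreal (2 * ?h2 x y) + ennreal (2 * (K * min 1 ((norm (x - y))\<^sup>2) * (?h1 x y) / k x y))"
        by (rule ennreal_plus) (use k0 K in \<open>auto intro!: mult_nonneg_nonneg divide_nonneg_nonneg\<close>)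
      also have "\<dots> = 2 * V p + 2 * Z p"
      proof -
        have two: "ennreal (2 * r) = 2 * ennreal r" for r :: real by (subst ennreal_mult') auto
        show ?thesis unfolding p V_def Z_def by (simp only: two prod.case)
      qed
      finally show "U n p \<le> 2 * V p + 2 * Z p" unfolding p U_def by simp
    qed
    show "AE p in lborel \<Otimes>\<^sub>M lborel. (\<lambda>n. U n p) \<longlonglongrightarrow> V p"
    proof (rule AE_I2)
      fix p :: "'a \<times> 'a"
      obtain x y where p: "p = (x, y)" by (cases p)
      have "(\<lambda>n. \<phi> x * cutoff n x - \<phi> y * cutoff n y) \<longlonglongrightarrow> \<phi> x * 1 - \<phi> y * 1"
        by (rule tendsto_diff[OF tendsto_mult[OF tendsto_const cutoff_tendsto] tendsto_mult[OF tendsto_const cutoff_tendsto]])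
      then have "(\<lambda>n. \<bar>\<phi> x * cutoff n x - \<phi> y * cutoff n y\<bar>\<^sup>2 * inverse (k x y)) \<longlonglongrightarrow> \<bar>\<phi> x * 1 - \<phi> y * 1\<bar>\<^sup>2 * inverse (k x y)"
        by (rule tendsto_mult[OF tendsto_power[OF tendsto_rabs] tendsto_const])
      then show "(\<lambda>n. U n p) \<longlonglongrightarrow> V p"
        unfolding p U_def V_def prod.case by (intro tendsto_ennrealI) (simp only: divide_inverse mult_1_right)
    qed
  qed measurable
  then show ?thesis unfolding EU EV by (intro ennreal_tendsto_cmult) auto
qed

lemma riesz_form_cutoff_liminf:
  fixes \<phi> :: "'a::euclidean_space \<Rightarrow> real"
  assumes [measurable]: "\<phi> \<in> borel_measurable borel"
  shows "riesz_form \<alpha> s \<phi> \<le> liminf (\<lambda>n. riesz_form \<alpha> s (\<lambda>x. \<phi> x * cutoff n x))"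
proof -
  define k where "k = (\<lambda>x y :: 'a. 1 / norm x powr ((\<alpha> + s) / 2) * riesz_potential \<alpha> (x - y) * (1 / norm y powr ((\<alpha> + s) / 2)))"
  have W: "weighted_riesz_kernel \<alpha> s f x y = k x y * (f x * f y)" for f :: "'a \<Rightarrow> real" and x y
    unfolding weighted_riesz_kernel_def k_def by simp
  have [measurable]: "(\<lambda>(x, y). k x y) \<in> borel_measurable (borel \<Otimes>\<^sub>M borel)" unfolding k_def by measurable
  have J: "riesz_form \<alpha> s f = (\<integral>\<^sup>+ p. (case p of (x, y) \<Rightarrow> ennreal \<bar>k x y * (f x * f y)\<bar>) \<partial>(lborel \<Otimes>\<^sub>M lborel))"
    if [measurable]: "f \<in> borel_measurable borel" for f :: "'a \<Rightarrow> real"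
    unfolding riesz_form_def W by (subst lborel_pair.nn_integral_snd[symmetric]) auto
  let ?h = "\<lambda>(x :: 'a) n (y :: 'a). \<phi> x * cutoff n x * (\<phi> y * cutoff n y)"
  have "riesz_form \<alpha> s \<phi> = (\<integral>\<^sup>+ p. liminf (\<lambda>n. case p of (x, y) \<Rightarrow> ennreal \<bar>k x y * (?h x n y)\<bar>) \<partial>(lborel \<Otimes>\<^sub>M lborel))"
    unfolding J[OF assms]
  proof (rule nn_integral_cong)
    fix p :: "'a \<times> 'a"
    obtain x y where p: "p = (x, y)" by (cases p)
    have "(\<lambda>n. k x y * ?h x n y) \<longlonglongrightarrow> k x y * (\<phi> x * 1 * (\<phi> y * 1))"
      by (rule tendsto_mult[OF tendsto_const tendsto_mult[OF tendsto_mult[OF tendsto_const cutoff_tendsto] tendsto_mult[OF tendsto_const cutoff_tendsto]]])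
    then have "(\<lambda>n. ennreal \<bar>k x y * (?h x n y)\<bar>) \<longlonglongrightarrow> ennreal \<bar>k x y * (\<phi> x * 1 * (\<phi> y * 1))\<bar>"
      by (rule tendsto_ennrealI[OF tendsto_rabs])
    then show "(case p of (x, y) \<Rightarrow> ennreal \<bar>k x y * (\<phi> x * \<phi> y)\<bar>) = liminf (\<lambda>n. case p of (x, y) \<Rightarrow> ennreal \<bar>k x y * (?h x n y)\<bar>)"
      unfolding p prod.case by (subst lim_imp_Liminf) auto
  qed
  also have "\<dots> \<le> liminf (\<lambda>n. \<integral>\<^sup>+ p. (case p of (x, y) \<Rightarrow> ennreal \<bar>k x y * (?h x n y)\<bar>) \<partial>(lborel \<Otimes>\<^sub>M lborel))"
    by (rule nn_integral_liminf) measurable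
  also have "\<dots> = liminf (\<lambda>n. riesz_form \<alpha> s (\<lambda>x. \<phi> x * cutoff n x))"
    by (subst J) auto
  finally show ?thesis .
qed

text \<open>Lets the Gaussian mixtures below, which lack compact support, be used as trial functions
  without placing them in \<open>hom_sobolev\<close>. The smaller side needs only Fatou's lemma, the
  larger one true convergence of the energies.\<close>

lemma riesz_form_le_of_test_functions:
  fixes \<phi> :: "'a::euclidean_space \<Rightarrow> real"
  assumes \<phi>: "radial_alg \<phi>" "\<And>x. 0 \<le> \<phi> x" and s: "0 < s" "s < 2"
    and L2: "(NBINT x. ennreal ((\<phi> x)\<^sup>2)) < \<infinity>" and fin: "hs_energy s \<phi> < \<infinity>"
    and S: "\<And>f :: 'a \<Rightarrow> real. f \<in> test_functions \<Longrightarrow> (\<And>x. 0 \<le> f x) \<Longrightarrow> riesz_form \<alpha> s f \<le> ennreal S * hs_energy s f"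
  shows "riesz_form \<alpha> s \<phi> \<le> ennreal S * hs_energy s \<phi>"
proof -
  have m: "\<phi> \<in> borel_measurable borel"
    by (rule radial_alg_measurable[OF \<phi>(1)])
  have "riesz_form \<alpha> s \<phi> \<le> liminf (\<lambda>n. riesz_form \<alpha> s (\<lambda>x. \<phi> x * cutoff n x))"
    by (rule riesz_form_cutoff_liminf[OF m])
  also have "\<dots> \<le> liminf (\<lambda>n. ennreal S * hs_energy s (\<lambda>x. \<phi> x * cutoff n x))"
    by (intro Liminf_mono always_eventually allI S cutoff_mult_test_function \<phi> mult_nonneg_nonneg cutoff_nonneg)
  also have "\<dots> = ennreal S * hs_energy s \<phi>"
    by (intro lim_imp_Liminf ennreal_tendsto_cmult hs_energy_cutoff_tendsto m s L2 fin) auto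
  finally show ?thesis .
qed

section \<open>Autocorrelation and energy of Gaussian mixtures\<close>

definition gauss_overlap :: "(real \<Rightarrow> real) \<Rightarrow> 'a::euclidean_space \<Rightarrow> ennreal" where
  "gauss_overlap m z = (NPINT u. NPINT v. ennreal (m u * m v * ((pi / (u + v)) powr (real DIM('a) / 2) * gauss (u * v / (u + v)) z)))"

lemma mixture_autocorrelation:
  fixes \<phi> :: "'a::euclidean_space \<Rightarrow> real"
  assumes [measurable]: "m \<in> borel_measurable borel" and m0: "\<And>u. 0 \<le> m u"
    and \<phi>0: "\<And>x. 0 \<le> \<phi> x" and rep: "\<And>x. ennreal (\<phi> x) = (NPINT u. ennreal (m u * gauss u x))"
  shows "(NBINT y. ennreal (\<phi> (z + y) * \<phi> y)) = gauss_overlap m z"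
proof -
  let ?F = "\<lambda>u v y. ennreal (m u * m v * (gauss u (- z - y) * gauss v y))"
  have "(NBINT y. ennreal (\<phi> (z + y) * \<phi> y)) = (NBINT y. NPINT u. NPINT v. ?F u v y)"
  proof (rule nn_integral_cong)
    fix y
    \<comment> \<open>Gaussians are even; the sign change brings the product to the form of a
      convolution.\<close>
    have n: "norm (z + y) = norm (- z - y)" by (metis minus_add_distrib norm_minus_cancel uminus_add_conv_diff diff_conv_add_uminus)
    have "ennreal (\<phi> (z + y) * \<phi> y) = (NPINT u. ennreal (m u * gauss u (- z - y))) * (NPINT v. ennreal (m v * gauss v y))"
      using rep[of "z + y"] rep[of y] \<phi>0 by (simp add: ennreal_mult n)
    also have "\<dots> = (NPINT u. ennreal (m u * gauss u (- z - y)) * (NPINT v. ennreal (m v * gauss v y)))"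
      by (rule nn_integral_multc[symmetric]) measurable
    also have "\<dots> = (NPINT u. NPINT v. ennreal (m u * gauss u (- z - y) * (m v * gauss v y)))"
      by (intro nn_integral_cong nn_cmult_real[symmetric]) (auto simp: m0)
    finally show "ennreal (\<phi> (z + y) * \<phi> y) = (NPINT u. NPINT v. ?F u v y)"
      by (simp only: mult_ac)
  qed
  also have "\<dots> = (NPINT u. NBINT y. NPINT v. ?F u v y)"
    by (rule lpos_lborel.Fubini') measurable
  also have "\<dots> = (NPINT u. NPINT v. NBINT y. ?F u v y)"
    by (intro nn_integral_cong lpos_lborel.Fubini') measurable
  also have "\<dots> = gauss_overlap m z"
    unfolding gauss_overlap_def
  proof (intro nn_lpos_cong)
    fix u v :: real assume "0 < u" "0 < v"
    then show "(NBINT y. ?F u v y) = ennreal (m u * m v * ((pi / (u + v)) powr (real DIM('a) / 2) * gauss (u * v / (u + v)) z))"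
      using m0 by (subst nn_cmult_real, simp, simp, subst nn_gauss_conv) (auto simp: ennreal_mult')
  qed
  finally show ?thesis .
qed

text \<open>The drop of the autocorrelation from shift 0 to shift \<open>z\<close>, kept as an
  integral of nonnegative terms instead of a truncated difference.\<close>

definition gauss_defect :: "(real \<Rightarrow> real) \<Rightarrow> 'a::euclidean_space \<Rightarrow> ennreal" where
  "gauss_defect m z = (NPINT u. NPINT v. ennreal (m u * m v * (pi / (u + v)) powr (real DIM('a) / 2) * (1 - gauss (u * v / (u + v)) z)))"

lemma gauss_overlap_defect:
  fixes z :: "'a::euclidean_space"
  assumes [measurable]: "m \<in> borel_measurable borel" and m0: "\<And>u. 0 \<le> m u"
  shows "gauss_overlap m z + gauss_defect m z = gauss_overlap m (0 :: 'a)"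
proof -
  let ?f = "\<lambda>u v. m u * m v * (pi / (u + v)) powr (real DIM('a) / 2)"
  let ?e = "\<lambda>u v. gauss (u * v / (u + v)) z"
  have ov: "gauss_overlap m z = (NPINT u. NPINT v. ennreal (?f u v * ?e u v))"
    unfolding gauss_overlap_def by (simp only: mult.assoc)
  have "gauss_overlap m z + gauss_defect m z = (NPINT u. NPINT v. ennreal (?f u v * ?e u v) + ennreal (?f u v * (1 - ?e u v)))"
    unfolding ov gauss_defect_def by (simp add: nn_integral_add)
  also have "\<dots> = (NPINT u. NPINT v. ennreal (?f u v * 1))"
    by (intro nn_lpos_cong ennreal_split_diff) (auto simp: m0)
  also have "\<dots> = gauss_overlap m (0 :: 'a)"
    unfolding gauss_overlap_def by (simp add: mult.assoc)
  finally show ?thesis .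
qed

text \<open>The squared increment is the sum of two squares minus twice the autocorrelation. The
  finite L2 norm bounds the overlap at 0, hence at every shift, which justifies the
  cancellation.\<close>

lemma mixture_increment:
  fixes \<phi> :: "'a::euclidean_space \<Rightarrow> real"
  assumes m [measurable]: "m \<in> borel_measurable borel" "\<phi> \<in> borel_measurable borel" and m0: "\<And>u. 0 \<le> m u"
    and \<phi>0: "\<And>x. 0 \<le> \<phi> x" and rep: "\<And>x. ennreal (\<phi> x) = (NPINT u. ennreal (m u * gauss u x))"
    and L2: "(NBINT x. ennreal ((\<phi> x)\<^sup>2)) < \<infinity>"
  shows "(NBINT y. ennreal ((\<phi> (z + y) - \<phi> y)\<^sup>2)) = 2 * gauss_defect m z"
proof -
  note ac = mixture_autocorrelation[OF m(1) m0 \<phi>0 rep]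
  have o0: "(NBINT y. ennreal ((\<phi> y)\<^sup>2)) = gauss_overlap m (0 :: 'a)"
    using ac[of 0] by (simp add: power2_eq_square)
  let ?h = "\<lambda>(y :: 'a). ennreal ((\<phi> (z + y) - \<phi> y)\<^sup>2)"
  have "(NBINT y. ?h y) + 2 * gauss_overlap m z = (NBINT y. ?h y + 2 * ennreal (\<phi> (z + y) * \<phi> y))"
    unfolding ac[symmetric] by (simp add: nn_integral_add nn_integral_cmult)
  also have "\<dots> = (NBINT y. ennreal ((\<phi> (z + y))\<^sup>2) + ennreal ((\<phi> y)\<^sup>2))"
  proof (rule nn_integral_cong)
    fix y
    have "2 * ennreal (\<phi> (z + y) * \<phi> y) = ennreal (2 * (\<phi> (z + y) * \<phi> y))" by (subst ennreal_mult') auto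
    then have "?h y + 2 * ennreal (\<phi> (z + y) * \<phi> y) = ennreal ((\<phi> (z + y) - \<phi> y)\<^sup>2 + 2 * (\<phi> (z + y) * \<phi> y))"
      using \<phi>0 by (simp add: ennreal_plus)
    also have "(\<phi> (z + y) - \<phi> y)\<^sup>2 + 2 * (\<phi> (z + y) * \<phi> y) = (\<phi> (z + y))\<^sup>2 + (\<phi> y)\<^sup>2"
      by (simp add: power2_eq_square algebra_simps)
    finally show "?h y + 2 * ennreal (\<phi> (z + y) * \<phi> y) = ennreal ((\<phi> (z + y))\<^sup>2) + ennreal ((\<phi> y)\<^sup>2)"
      by (simp add: ennreal_plus)
  qed
  also have "\<dots> = (NBINT y. ennreal ((\<phi> (z + y))\<^sup>2)) + (NBINT y. ennreal ((\<phi> y)\<^sup>2))"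
    by (simp add: nn_integral_add)
  also have "(NBINT y. ennreal ((\<phi> (z + y))\<^sup>2)) = (NBINT y. ennreal ((\<phi> y)\<^sup>2))"
    by (rule nn_lborel_translate[of "\<lambda>y. ennreal ((\<phi> y)\<^sup>2)"]) measurable
  also have "(NBINT y. ennreal ((\<phi> y)\<^sup>2)) + (NBINT y. ennreal ((\<phi> y)\<^sup>2)) = 2 * gauss_overlap m z + 2 * gauss_defect m z"
    unfolding o0 gauss_overlap_defect[OF m(1) m0, of z, symmetric] by (simp only: mult_2 add_ac)
  finally have "2 * gauss_overlap m z + (NBINT y. ?h y) = 2 * gauss_overlap m z + 2 * gauss_defect m z"
    by (simp only: add.commute)
  moreover have "2 * gauss_overlap m z \<noteq> \<infinity>"
  proof -
    have "gauss_overlap m z \<le> gauss_overlap m (0 :: 'a)"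
      unfolding gauss_overlap_defect[OF m(1) m0, of z, symmetric] by simp
    also have "\<dots> < \<infinity>" using L2 unfolding o0 .
    finally show ?thesis by (simp add: ennreal_mult_eq_top_iff)
  qed
  ultimately show ?thesis by (simp add: ennreal_add_left_cancel)
qed

text \<open>After substituting \<open>x = y + z\<close> the singular kernel meets only
  \<open>1 - gauss\<close>, whose integral is known exactly. What remains is a kernel in
  \<open>u\<close> and \<open>v\<close> of homogeneity degree \<open>-(N - s) / 2\<close>, the
  source of the logarithmic growth.\<close>

lemma mixture_energy:
  fixes \<phi> :: "'a::euclidean_space \<Rightarrow> real"
  assumes m [measurable]: "m \<in> borel_measurable borel" "\<phi> \<in> borel_measurable borel" and m0: "\<And>u. 0 \<le> m u"
    and \<phi>0: "\<And>x. 0 \<le> \<phi> x" and rep: "\<And>x. ennreal (\<phi> x) = (NPINT u. ennreal (m u * gauss u x))"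
    and L2: "(NBINT x. ennreal ((\<phi> x)\<^sup>2)) < \<infinity>" and s: "0 < s" "s < 2"
  shows "hs_energy s \<phi> = ennreal (2 powr s * pi powr (real DIM('a) / 2) * Gamma ((real DIM('a) + s) / 2) / Gamma (real DIM('a) / 2)) *
    (NPINT u. NPINT v. ennreal (m u * m v * ((u * v) powr (s / 2) * (u + v) powr (- ((real DIM('a) + s) / 2)))))"
proof -
  define N where "N = real DIM('a)"
  have N: "0 < N" by (simp add: N_def)
  have G: "0 < Gamma (1 - s / 2)" "0 < Gamma (N / 2)" "0 < Gamma ((N + s) / 2)" using s N by auto
  define q where "q = 2 / s * pi powr (N / 2) * Gamma (1 - s / 2) / Gamma (N / 2)"
  let ?h1 = "\<lambda>u v. m u * m v * ((u * v) powr (s / 2) * (u + v) powr (- ((N + s) / 2)))"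
  have q: "0 < q" unfolding q_def using s G by simp
  define M where "M = (NPINT u. NPINT v. ennreal (?h1 u v))"
  let ?k = "\<lambda>z :: 'a. norm z powr (- (N + s))"
  let ?f = "\<lambda>u v. m u * m v * (pi / (u + v)) powr (N / 2)"
  let ?e = "\<lambda>u v z. 1 - gauss (u * v / (u + v)) (z :: 'a)"
  have [measurable]: "gauss_defect m \<in> borel_measurable (borel :: 'a measure)" unfolding gauss_defect_def by measurable
  let ?h2 = "\<lambda>(y :: 'a). NBINT x. ennreal (\<bar>\<phi> x - \<phi> y\<bar>\<^sup>2 / norm (x - y) powr (N + s))"
  let ?h3 = "\<lambda>(z :: 'a) (y :: 'a). ennreal ((\<phi> (z + y) - \<phi> y)\<^sup>2)"
  let ?h4 = "\<lambda>(y :: 'a) (z :: 'a). ennreal (\<bar>\<phi> (y + z) - \<phi> y\<bar>\<^sup>2 / norm (y + z - y) powr (N + s))"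
  let ?h5 = "\<lambda>u v. NBINT z. ennreal (?k z * (?f u v * ?e u v z))"
  have "(NBINT y. ?h2 y) = (NBINT y. NBINT z. ennreal (?k z) * ?h3 z y)"
  proof (rule nn_integral_cong)
    fix y :: 'a
    have "(?h2 y) = (NBINT z. ?h4 y z)"
      by (rule nn_lborel_translate[symmetric]) measurable
    also have "\<dots> = (NBINT z. ennreal (?k z) * ?h3 z y)"
    proof (rule nn_integral_cong)
      fix z
      have d: "y + z - y = z" by simp
      have "\<bar>\<phi> (y + z) - \<phi> y\<bar>\<^sup>2 / norm (y + z - y) powr (N + s) = ?k z * (\<phi> (z + y) - \<phi> y)\<^sup>2"
        unfolding d unfolding add.commute[of y z] by (simp only: powr_minus divide_inverse power2_abs mult.commute)
      then show "?h4 y z = ennreal (?k z) * ?h3 z y"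
        by (simp only: ennreal_mult'[OF powr_ge_zero])
    qed
    finally show "(?h2 y) = \<dots>" .
  qed
  also have "\<dots> = (NBINT z. NBINT y. ennreal (?k z) * ?h3 z y)"
    by (rule lborel_pair.Fubini') measurable
  also have "\<dots> = (NBINT z. ennreal (?k z) * (2 * gauss_defect m z))"
    by (simp add: nn_integral_cmult mixture_increment[OF m m0 \<phi>0 rep L2])
  also have "\<dots> = 2 * (NBINT z. ennreal (?k z) * gauss_defect m z)"
    by (simp add: mult.left_commute nn_integral_cmult)
  also have "(NBINT z. ennreal (?k z) * gauss_defect m z) = (NBINT z. NPINT u. NPINT v. ennreal (?k z * (?f u v * ?e u v z)))"
    unfolding gauss_defect_def N_def by (simp add: nn_integral_cmult[symmetric] ennreal_mult')
  also have "\<dots> = (NPINT u. NBINT z. NPINT v. ennreal (?k z * (?f u v * ?e u v z)))"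
    by (rule lpos_lborel.Fubini') measurable
  also have "\<dots> = (NPINT u. NPINT v. ?h5 u v)"
    by (intro nn_integral_cong lpos_lborel.Fubini') measurable
  also have "\<dots> = (NPINT u. NPINT v. ennreal (q * pi powr (N / 2)) * ennreal (?h1 u v))"
  proof (intro nn_lpos_cong)
    fix u v :: real assume uv: "0 < u" "0 < v"
    define c where "c = u * v / (u + v)"
    have c: "0 < c" using uv by (simp add: c_def)
    have "(?h5 u v) = (NBINT z. ennreal (?f u v * (?k z * (1 - gauss c (z :: 'a)))))"
      unfolding c_def by (simp only: mult_ac)
    also have "\<dots> = ennreal (?f u v) * ennreal (q * c powr (s / 2))"
      unfolding q_def N_def using m0 uv by (subst nn_cmult_real, simp, simp, subst nn_norm_powr_one_minus_gauss[OF s c]) auto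
    also have "\<dots> = ennreal (?f u v * (q * c powr (s / 2)))"
      by (rule ennreal_mult'[symmetric]) (use m0 in simp)
    also have "?f u v * (q * c powr (s / 2)) = q * pi powr (N / 2) * ?h1 u v"
    proof -
      have 1: "(pi / (u + v)) powr (N / 2) = pi powr (N / 2) * (u + v) powr (- (N / 2))" using uv by (intro powr_divide_eq) auto
      have 2: "c powr (s / 2) = (u * v) powr (s / 2) * (u + v) powr (- (s / 2))" unfolding c_def using uv by (intro powr_divide_eq) auto
      have 3: "(u + v) powr (- ((N + s) / 2)) = (u + v) powr (- (N / 2)) * (u + v) powr (- (s / 2))"
        by (simp only: powr_add[symmetric]) (rule powr_exponent_cong, simp add: field_simps)
      show ?thesis unfolding 1 2 3 by (simp only: mult_ac)
    qed
    also have "ennreal (q * pi powr (N / 2) * ?h1 u v) = ennreal (q * pi powr (N / 2)) * ennreal (?h1 u v)"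
      by (rule ennreal_mult') (use q in simp)
    finally show "(?h5 u v) = \<dots>" .
  qed
  also have "\<dots> = ennreal (q * pi powr (N / 2)) * M"
    unfolding M_def by (simp add: nn_integral_cmult)
  finally have "hs_energy s \<phi> = ennreal (sobolev_const DIM('a) s) * (2 * (ennreal (q * pi powr (N / 2)) * M))"
    unfolding hs_energy_def N_def by simp
  also have "\<dots> = ennreal (sobolev_const DIM('a) s * (2 * (q * pi powr (N / 2)))) * M"
    using sobolev_const_pos[OF s, of "DIM('a)"] q by (simp add: ennreal_mult' mult.assoc)
  also have "sobolev_const DIM('a) s * (2 * (q * pi powr (N / 2))) = 2 powr s * pi powr (N / 2) * Gamma ((N + s) / 2) / Gamma (N / 2)"
  proof -
    have alg: "g3 * s / (4 / t * p * g4) * (2 * (2 / s * p * g4 / g2 * p)) = t * p * g3 / g2"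
      if "0 < g2" "0 < g4" "0 < p" "0 < t" for g2 g3 g4 p t :: real
      using that s(1) by (simp add: field_simps)
    have e: "2 powr (2 - s) = 4 / 2 powr s" by (simp add: powr_diff)
    show ?thesis
      unfolding q_def sobolev_const_def N_def[symmetric] e by (rule alg) (use G in simp_all)
  qed
  finally show ?thesis unfolding M_def N_def .
qed

section \<open>Truncated ground states as trial functions\<close>

lemma log_uniform_mass:
  assumes "0 < a" "0 < b"
  shows "(NPINT u. ennreal (indicator {a..b} u / u)) = ennreal (ln b - ln a)"
proof (cases "a \<le> b")
  case True
  have "(NPINT u. ennreal (indicator {a..b} u / u)) = (NBINT u. ennreal (1 / u) * indicator {a..b} u)"
    using assms by (subst nn_lpos_eq) (auto intro!: nn_integral_cong simp: indicator_def)
  also have "\<dots> = ennreal (ln b - ln a)"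
    by (rule nn_integral_FTC_Icc) (use assms True in \<open>auto intro!: derivative_eq_intros\<close>)
  finally show ?thesis .
next
  case False
  \<comment> \<open>For an empty interval the logarithmic length is not positive, and
    \<open>ennreal\<close> sends it to the correct value 0.\<close>
  then have "ln b - ln a \<le> 0" using assms by simp
  moreover have "(NPINT u. ennreal (indicator {a..b} u / u)) = 0" using False by simp
  ultimately show ?thesis by (simp add: ennreal_neg)
qed

text \<open>Without the indicator this is the mixing density of \<open>norm x powr (- b)\<close>, up
  to \<open>Gamma (b / 2)\<close>. The bound \<open>1 \<le> u\<close> enforces decay at infinity,
  and \<open>u \<le> M\<close> removes the singularity at the origin.\<close>

definition log_density :: "real \<Rightarrow> real \<Rightarrow> real \<Rightarrow> real" where
  "log_density b M u = indicator {1..M} u * u powr (b / 2 - 1)"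

definition log_profile :: "real \<Rightarrow> real \<Rightarrow> 'a::euclidean_space \<Rightarrow> real" where
  "log_profile b M x = integral {1..M} (\<lambda>u. u powr (b / 2 - 1) * exp (- (u * (x \<bullet> x))))"

lemma borel_measurable_log_density [measurable]: "log_density b M \<in> borel_measurable borel"
  unfolding log_density_def[abs_def] by measurable

lemma log_density_nonneg: "0 \<le> log_density b M u"
  by (simp add: log_density_def)

lemma radial_alg_log_profile: "radial_alg (log_profile b M)"
proof -
  have "smooth_real (\<lambda>r. integral {1..M} (\<lambda>u. u powr (b / 2 - 1) * exp (- (u * r))))"
    by (intro smooth_real_laplace continuous_intros) auto
  from radial_alg.radial[OF this] show ?thesis unfolding log_profile_def[abs_def] .
qed

lemma log_profile_nn:
  "ennreal (log_profile b M x) = (NPINT u. ennreal (log_density b M u * gauss u x))"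
  and log_profile_nonneg: "0 \<le> log_profile b M x"
proof -
  let ?f = "\<lambda>u. u powr (b / 2 - 1) * exp (- (u * (x \<bullet> x)))"
  have "continuous_on {1..M} ?f" by (intro continuous_intros) auto
  then have "?f integrable_on {1..M}" by (rule integrable_continuous_real)
  then have I: "(?f has_integral log_profile b M x) {1..M}"
    unfolding log_profile_def by (rule integrable_integral)
  show "0 \<le> log_profile b M x" by (rule has_integral_nonneg[OF I]) simp
  have "ennreal (log_profile b M x) = (NBINT u. ennreal (?f u) * indicator {1..M} u)"
    by (rule nn_integral_has_integral_lebesgue'[symmetric, OF _ I]) simp
  also have "\<dots> = (NPINT u. ennreal (log_density b M u * gauss u x))"
    by (subst nn_lpos_eq) (auto intro!: nn_integral_cong simp: log_density_def power2_norm_eq_inner indicator_def)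
  finally show "ennreal (log_profile b M x) = (NPINT u. ennreal (log_density b M u * gauss u x))" .
qed

text \<open>All mixing parameters are at least 1, so the profile is dominated by its value at 0
  times \<open>gauss 1\<close>.\<close>

lemma log_profile_L2: "(NBINT x. ennreal ((log_profile b M (x :: 'a::euclidean_space))\<^sup>2)) < \<infinity>"
proof -
  define c where "c = log_profile b M (0 :: 'a)"
  have c0: "0 \<le> c" unfolding c_def by (rule log_profile_nonneg)
  have bd: "log_profile b M x \<le> c * gauss 1 x" for x :: 'a
  proof -
    have "ennreal (log_profile b M x) \<le> (NPINT u. ennreal (gauss 1 x * (log_density b M u * gauss u (0::'a))))"
      unfolding log_profile_nn
    proof (intro nn_integral_mono ennreal_leI)
      fix u
      show "log_density b M u * gauss u x \<le> gauss 1 x * (log_density b M u * gauss u (0::'a))"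
      proof (cases "u \<in> {1..M}")
        case True
        then have "1 * (norm x)\<^sup>2 \<le> u * (norm x)\<^sup>2" by (intro mult_right_mono) auto
        then have "gauss u x \<le> gauss 1 x" by simp
        then have "log_density b M u * gauss u x \<le> log_density b M u * gauss 1 x"
          by (rule mult_left_mono) (rule log_density_nonneg)
        then show ?thesis by (simp add: mult.commute)
      qed (simp add: log_density_def)
    qed
    also have "\<dots> = ennreal (gauss 1 x) * ennreal c"
      unfolding c_def log_profile_nn by (rule nn_cmult_real) auto
    also have "\<dots> = ennreal (c * gauss 1 x)"
      using ennreal_mult'[OF c0, of "gauss 1 x"] by (simp only: mult.commute)
    finally show ?thesis using c0 by (subst (asm) ennreal_le_iff) auto
  qed
  have "(NBINT x. ennreal ((log_profile b M (x :: 'a))\<^sup>2)) \<le> (NBINT x. ennreal (c\<^sup>2 * gauss 2 (x :: 'a)))"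
  proof (intro nn_integral_mono ennreal_leI)
    fix x :: 'a
    have "(log_profile b M x)\<^sup>2 \<le> (c * gauss 1 x)\<^sup>2"
      by (rule power_mono[OF bd log_profile_nonneg])
    also have "\<dots> = c\<^sup>2 * gauss 2 x"
      by (simp add: power_mult_distrib exp_double[symmetric])
    finally show "(log_profile b M x)\<^sup>2 \<le> c\<^sup>2 * gauss 2 x" .
  qed
  also have "\<dots> = ennreal (c\<^sup>2) * ennreal ((pi / 2) powr (real DIM('a) / 2))"
    by (subst nn_cmult_real, simp, simp, subst nn_gauss) auto
  also have "\<dots> < \<infinity>" by (simp add: ennreal_mult_less_top)
  finally show ?thesis .
qed

text \<open>With \<open>v = u * r\<close> the homogeneity leaves \<open>1 / u\<close> times a
  function of \<open>r\<close>. An upper bound suffices because the energy bounds the form from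
  above, so the constraint on \<open>u * r\<close> may be dropped: the \<open>r\<close>-integral is
  then a Beta value and the \<open>u\<close>-integral is \<open>ln M\<close>.\<close>

lemma log_profile_energy:
  fixes s M :: real
  defines "N \<equiv> real DIM('a::euclidean_space)"
  assumes s: "0 < s" "s < 2" "s < N" and M: "1 \<le> M"
  shows "hs_energy s (log_profile ((N - s) / 2) M :: 'a \<Rightarrow> real) \<le>
    ennreal (2 powr s * pi powr (N / 2) * (Gamma ((N + s) / 4))\<^sup>2 / Gamma (N / 2) * ln M)"
proof -
  define b where "b = (N - s) / 2"
  define p where "p = (N + s) / 4"
  have p: "0 < p" using s by (simp add: p_def)
  have G: "0 < Gamma (N / 2)" "0 < Gamma ((N + s) / 2)" "0 < Gamma p" using s p by auto
  define C where "C = 2 powr s * pi powr (N / 2) * Gamma ((N + s) / 2) / Gamma (N / 2)"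
  have C: "0 < C" unfolding C_def using G by simp
  let ?m = "log_density b M"
  have pp: "p + p = (N + s) / 2" by (simp add: p_def)
  let ?h1 = "\<lambda>u. NPINT v. ennreal (?m u * ?m v * ((u * v) powr (s / 2) * (u + v) powr (- ((N + s) / 2))))"
  let ?h2 = "\<lambda>u r. ?m u * ?m (u * r) * ((u * (u * r)) powr (s / 2) * (u + u * r) powr (- ((N + s) / 2)))"
  let ?h3 = "ennreal (Gamma p * Gamma p / Gamma (p + p))"
  let ?h4 = "\<lambda>r. r powr (p - 1) * (1 + r) powr (- (p + p))"
  have "(NPINT u. ?h1 u) \<le> (NPINT u. ?h3 * ennreal (indicator {1..M} u / u))"
  proof (rule nn_lpos_mono)
    fix u :: real assume u: "0 < u"
    have "(?h1 u) = ennreal u * (NPINT r. ennreal (?h2 u r))"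
      using u by (subst nn_lpos_scale[of _ u]) auto
    also have "\<dots> = (NPINT r. ennreal (u * ?h2 u r))"
      using u by (subst nn_cmult_real) auto
    also have "\<dots> \<le> (NPINT r. ennreal (indicator {1..M} u / u * ?h4 r))"
    proof (intro nn_lpos_mono ennreal_leI)
      fix r :: real assume r: "0 < r"
      have ur: "u + u * r = u * (1 + r)" by (simp add: algebra_simps)
      \<comment> \<open>Here the constraint on the second mixing variable is given up.\<close>
      have "?m (u * r) \<le> (u * r) powr (b / 2 - 1)" by (auto simp: log_density_def indicator_def)
      then have "u * ?h2 u r \<le> u * (?m u * (u * r) powr (b / 2 - 1) * ((u * (u * r)) powr (s / 2) * (u + u * r) powr (- ((N + s) / 2))))"
        using u by (intro mult_left_mono mult_right_mono) (auto simp: log_density_nonneg)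
      also have "\<dots> = indicator {1..M} u / u * ?h4 r"
      proof -
        have 1: "(u * r) powr (b / 2 - 1) = u powr (b / 2 - 1) * r powr (b / 2 - 1)" by (rule powr_mult)
        have 2: "(u * (u * r)) powr (s / 2) = u powr (s / 2) * (u powr (s / 2) * r powr (s / 2))" using u r by (simp add: powr_mult)
        have 3: "(u + u * r) powr (- ((N + s) / 2)) = u powr (- ((N + s) / 2)) * (1 + r) powr (- (p + p))" unfolding ur pp by (rule powr_mult)
        have 4: "r powr (p - 1) = r powr (b / 2 - 1) * r powr (s / 2)"
          by (simp only: powr_add[symmetric]) (rule powr_exponent_cong, simp add: b_def p_def field_simps)
        \<comment> \<open>The powers of \<open>u\<close> from the substitution, the two densities
          and the kernel add up to exactly \<open>- 1\<close>; this is the criticality of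
          \<open>b = (N - s) / 2\<close>.\<close>
        have "1 / u = u powr (- 1)" using u by (simp add: powr_minus_divide)
        also have "\<dots> = u powr 1 * u powr (b / 2 - 1) * u powr (b / 2 - 1) * u powr (s / 2) * u powr (s / 2) * u powr (- ((N + s) / 2))"
          by (simp only: powr_add[symmetric]) (rule powr_exponent_cong, simp add: b_def field_simps)
        finally have 5: "1 / u = u * u powr (b / 2 - 1) * u powr (b / 2 - 1) * u powr (s / 2) * u powr (s / 2) * u powr (- ((N + s) / 2))"
          using u by simp
        have 6: "indicator {1..M} u / u = indicator {1..M} u * (1 / u)" by simp
        show ?thesis unfolding log_density_def 1 2 3 4 6 5 by (simp only: mult_ac)
      qed
      finally show "u * ?h2 u r \<le> indicator {1..M} u / u * ?h4 r" .
    qed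
    also have "\<dots> = ennreal (indicator {1..M} u / u) * ?h3"
      using u p by (subst nn_cmult_real, simp, simp, subst nn_Beta) auto
    finally show "(?h1 u) \<le> ?h3 * ennreal (indicator {1..M} u / u)"
      by (simp only: mult.commute)
  qed
  also have "\<dots> = ?h3 * ennreal (ln M - ln 1)"
    using M log_uniform_mass[of 1 M] by (simp add: nn_integral_cmult)
  finally have "ennreal C * (NPINT u. ?h1 u) \<le> ennreal C * (?h3 * ennreal (ln M - ln 1))"
    by (rule mult_left_mono) simp
  also have "\<dots> = ennreal (C * (Gamma p * Gamma p / Gamma (p + p) * ln M))"
  proof -
    have X: "0 \<le> Gamma p * Gamma p / Gamma (p + p)" unfolding pp using G by simp
    show ?thesis
      by (simp only: ennreal_mult'[OF X] ennreal_mult'[OF less_imp_le[OF C]] ln_one diff_zero)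
  qed
  also have "C * (Gamma p * Gamma p / Gamma (p + p) * ln M) = 2 powr s * pi powr (N / 2) * (Gamma p)\<^sup>2 / Gamma (N / 2) * ln M"
    unfolding C_def pp using G by (simp add: power2_eq_square)
  finally have "ennreal C * (NPINT u. ?h1 u) \<le> ennreal (2 powr s * pi powr (N / 2) * (Gamma p)\<^sup>2 / Gamma (N / 2) * ln M)" .
  moreover have "hs_energy s (log_profile b M :: 'a \<Rightarrow> real) = ennreal C * (NPINT u. ?h1 u)"
    unfolding C_def N_def
    by (rule mixture_energy[OF _ radial_alg_measurable[OF radial_alg_log_profile] log_density_nonneg log_profile_nonneg log_profile_nn log_profile_L2 s(1,2)]) simp
  ultimately show ?thesis by (simp only: b_def p_def)
qed

section \<open>Optimality\<close>

definition weighted_kernel :: "real \<Rightarrow> real \<Rightarrow> 'a::euclidean_space \<Rightarrow> 'a \<Rightarrow> real" where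
  "weighted_kernel \<alpha> s x y = norm x powr (- ((\<alpha> + s) / 2)) * riesz_potential \<alpha> (x - y) * norm y powr (- ((\<alpha> + s) / 2))"

lemma weighted_riesz_kernel_eq: "weighted_riesz_kernel \<alpha> s f x y = weighted_kernel \<alpha> s x y * (f x * f y)"
  unfolding weighted_riesz_kernel_def weighted_kernel_def by (simp only: powr_minus divide_inverse mult_ac)

lemma weighted_kernel_measurable [measurable]:
  "(\<lambda>(x, y). weighted_kernel \<alpha> s x y) \<in> borel_measurable (borel \<Otimes>\<^sub>M borel)"
  unfolding weighted_kernel_def by measurable

lemma weighted_kernel_nonneg:
  assumes "0 < \<alpha>" "\<alpha> < real DIM('a)"
  shows "0 \<le> weighted_kernel \<alpha> s (x :: 'a::euclidean_space) y"
  unfolding weighted_kernel_def using riesz_potential_nonneg[OF assms] by simp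

lemma weighted_kernel_scale:
  assumes c: "0 < c"
  shows "weighted_kernel \<alpha> s (c *\<^sub>R x) (c *\<^sub>R (y :: 'a::euclidean_space)) = c powr (- (real DIM('a) + s)) * weighted_kernel \<alpha> s x y"
proof -
  have "norm (c *\<^sub>R x - c *\<^sub>R y) = c * norm (x - y)" using c by (simp add: scaleR_diff_right[symmetric])
  moreover have "c powr (- (real DIM('a) + s)) = c powr (- ((\<alpha> + s) / 2)) * c powr (- (real DIM('a) - \<alpha>)) * c powr (- ((\<alpha> + s) / 2))"
    by (simp only: powr_add[symmetric]) (rule powr_exponent_cong, simp add: field_simps)
  ultimately show ?thesis
    using c unfolding weighted_kernel_def riesz_potential_eq by (simp add: powr_mult mult_ac)
qed

text \<open>The bilinear form between two Gaussians. The \<open>itself\<close> argument fixes the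
  underlying space, which the real parameters cannot determine.\<close>

definition gauss_form :: "'a::euclidean_space itself \<Rightarrow> real \<Rightarrow> real \<Rightarrow> real \<Rightarrow> real \<Rightarrow> ennreal" where
  "gauss_form _ \<alpha> s u v = (NBINT y. NBINT x. ennreal (gauss u (x :: 'a) * (weighted_kernel \<alpha> s x y * gauss v y)))"

lemma gauss_form_measurable [measurable]:
  "(\<lambda>(u, v). gauss_form TYPE('a::euclidean_space) \<alpha> s u v) \<in> borel_measurable (borel \<Otimes>\<^sub>M borel)"
  unfolding gauss_form_def by measurable

text \<open>Rescaling both space variables by \<open>1 / sqrt u\<close> gives degree
  \<open>2 * N\<close> from the two measures and \<open>-(N + s)\<close> from the kernel, hence
  \<open>-(N - s) / 2\<close> in \<open>u\<close>, as for the energy.\<close>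

lemma gauss_form_scale:
  assumes u: "0 < u"
  shows "gauss_form TYPE('a::euclidean_space) \<alpha> s u (u * r) = ennreal (u powr (- ((real DIM('a) - s) / 2))) * gauss_form TYPE('a) \<alpha> s 1 r"
proof -
  define N where "N = real DIM('a)"
  define c where "c = 1 / sqrt u"
  have c: "0 < c" using u by (simp add: c_def)
  have uc: "u * c\<^sup>2 = 1" using u by (simp add: c_def power_divide)
  let ?F = "\<lambda>u v x y :: 'a. gauss u x * (weighted_kernel \<alpha> s x y * gauss v y)"
  have sc: "?F u (u * r) (c *\<^sub>R x) (c *\<^sub>R y) = c powr (- (N + s)) * ?F 1 r x y" for x y
  proof -
    have "u * (norm (c *\<^sub>R x))\<^sup>2 = u * c\<^sup>2 * (norm x)\<^sup>2" "u * r * (norm (c *\<^sub>R y))\<^sup>2 = u * c\<^sup>2 * (r * (norm y)\<^sup>2)"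
      by (simp_all add: power_mult_distrib)
    then show ?thesis unfolding weighted_kernel_scale[OF c] uc N_def by (simp add: mult_ac)
  qed
  have "gauss_form TYPE('a) \<alpha> s u (u * r) = ennreal (c ^ DIM('a)) * (NBINT y. NBINT x. ennreal (?F u (u * r) x (c *\<^sub>R y)))"
    unfolding gauss_form_def by (subst nn_lborel_scale[OF _ c]) auto
  also have "\<dots> = ennreal (c ^ DIM('a)) * (NBINT y. ennreal (c ^ DIM('a)) * (NBINT x. ennreal (?F u (u * r) (c *\<^sub>R x) (c *\<^sub>R y))))"
    by (intro arg_cong2[where f = "(*)"] refl nn_integral_cong, rule nn_lborel_scale[OF _ c]) measurable
  also have "\<dots> = ennreal (c ^ DIM('a)) * (ennreal (c ^ DIM('a)) * (ennreal (c powr (- (N + s))) * gauss_form TYPE('a) \<alpha> s 1 r))"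
    unfolding sc gauss_form_def by (simp add: ennreal_mult' nn_integral_cmult)
  also have "\<dots> = ennreal (c ^ DIM('a) * c ^ DIM('a) * c powr (- (N + s))) * gauss_form TYPE('a) \<alpha> s 1 r"
    using c by (simp add: ennreal_mult' mult.assoc)
  also have "c ^ DIM('a) * c ^ DIM('a) * c powr (- (N + s)) = u powr (- ((N - s) / 2))"
  proof -
    have "c ^ DIM('a) = c powr N" using c by (simp add: powr_realpow N_def)
    then have "c ^ DIM('a) * c ^ DIM('a) * c powr (- (N + s)) = c powr (N - s)"
      by (simp only: powr_add[symmetric]) (rule powr_exponent_cong, simp)
    also have "c powr (N - s) = (u powr (- (1 / 2))) powr (N - s)" using u by (simp add: c_def powr_minus_divide powr_half_sqrt)
    also have "(u powr (- (1 / 2))) powr (N - s) = u powr (- ((N - s) / 2))" by (simp add: powr_powr)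
    finally show ?thesis .
  qed
  finally show ?thesis by (simp add: N_def)
qed

text \<open>No formula for \<open>gauss_form\<close> itself is needed: integrating in
  \<open>r\<close> first turns \<open>gauss r y\<close> back into the ground state, on which the
  Riesz potential acts by \<open>sharp_const\<close>. A Gaussian moment in \<open>x\<close> is
  left.\<close>

lemma gauss_form_mellin:
  fixes \<alpha> s :: real
  defines "N \<equiv> real DIM('a::euclidean_space)"
  assumes \<alpha>: "0 < \<alpha>" "\<alpha> < N" and s: "0 < s" "s < N"
  shows "(NPINT r. ennreal (r powr ((N - s) / 4 - 1)) * gauss_form TYPE('a) \<alpha> s 1 r) =
    ennreal (sharp_const DIM('a) \<alpha> * pi powr (N / 2) * (Gamma ((N - s) / 4))\<^sup>2 / Gamma (N / 2))"
proof -
  define b where "b = (N - s) / 2"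
  have b: "0 < b" "b / 2 = (N - s) / 4" using s by (auto simp: b_def)
  have G: "0 < Gamma ((N - s) / 4)" using s by simp
  note \<alpha>' = \<alpha>[unfolded N_def]
  let ?k = "weighted_kernel \<alpha> s :: 'a \<Rightarrow> 'a \<Rightarrow> real"
  let ?F = "\<lambda>r x y :: 'a. ennreal (r powr (b / 2 - 1) * (gauss 1 x * (?k x y * gauss r y)))"
  let ?h1 = "\<lambda>(x :: 'a) (y :: 'a). ennreal (exp (- (norm x)\<^sup>2) * ?k x y * (Gamma (b / 2) * norm y powr (- b)))"
  let ?h2 = "\<lambda>(x :: 'a). norm x powr (- ((N + s) / 2)) * exp (- (norm x)\<^sup>2)"
  let ?h3 = "pi powr (N / 2) * Gamma ((N - s) / 4) / Gamma (N / 2)"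
  let ?h4 = "\<lambda>(x :: 'a). sharp_const DIM('a) \<alpha> * norm x powr (- ((real DIM('a) - \<alpha>) / 2))"
  let ?h5 = "\<lambda>x (y :: 'a). riesz_potential \<alpha> (x - y) * norm y powr (- ((real DIM('a) + \<alpha>) / 2))"
  have "(NPINT r. ennreal (r powr (b / 2 - 1)) * gauss_form TYPE('a) \<alpha> s 1 r) = (NPINT r. NBINT y. NBINT x. ?F r x y)"
    unfolding gauss_form_def by (simp add: nn_integral_cmult[symmetric] ennreal_mult')
  also have "\<dots> = (NBINT y. NPINT r. NBINT x. ?F r x y)"
    by (rule lpos_lborel.Fubini'[symmetric]) measurable
  also have "\<dots> = (NBINT y. NBINT x. NPINT r. ?F r x y)"
    by (intro nn_integral_cong lpos_lborel.Fubini'[symmetric]) measurable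
  also have "\<dots> = (NBINT y. NBINT x. ?h1 x y)"
  proof (rule nn_lborel_cong[where c = 0], rule nn_integral_cong)
    fix x y :: 'a assume y: "y \<noteq> 0"
    have "(NPINT r. ?F r x y) = (NPINT r. ennreal (exp (- (norm x)\<^sup>2) * ?k x y * (r powr (b / 2 - 1) * gauss r y)))"
      by (simp only: mult_1_left mult_ac)
    also have "\<dots> = ?h1 x y"
      by (rule norm_powr_subordination_mult[symmetric]) (use b y weighted_kernel_nonneg[OF \<alpha>'] in auto)
    finally show "(NPINT r. ?F r x y) = \<dots>" .
  qed
  also have "\<dots> = (NBINT x. NBINT y. ?h1 x y)"
    by (rule lborel_pair.Fubini') measurable
  also have "\<dots> = (NBINT x. ennreal (Gamma (b / 2) * sharp_const DIM('a) \<alpha> * ?h2 x))"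
  proof (rule nn_lborel_cong[where c = 0])
    fix x :: 'a assume x: "x \<noteq> 0"
    define A where "A = exp (- (norm x)\<^sup>2) * norm x powr (- ((\<alpha> + s) / 2)) * Gamma (b / 2)"
    have A: "0 \<le> A" unfolding A_def using G b by simp
    have "exp (- (norm x)\<^sup>2) * ?k x y * (Gamma (b / 2) * norm y powr (- b)) = A * ?h5 x y" for y
    proof -
      have "norm y powr (- ((real DIM('a) + \<alpha>) / 2)) = norm y powr (- ((\<alpha> + s) / 2)) * norm y powr (- b)"
        by (simp only: powr_add[symmetric]) (rule powr_exponent_cong, simp add: b_def N_def field_simps)
      then show ?thesis unfolding A_def weighted_kernel_def by (simp only: mult_ac)
    qed
    then have "(NBINT y. ?h1 x y) = ennreal A * (NBINT y. ennreal (?h5 x y))"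
      using A by (simp only:) (subst nn_cmult_real, auto)
    also have "\<dots> = ennreal A * ennreal (?h4 x)"
      unfolding nn_riesz_ground_state[OF \<alpha>' x] ..
    also have "\<dots> = ennreal (A * ?h4 x)"
      by (rule ennreal_mult'[OF A, symmetric])
    also have "A * ?h4 x = Gamma (b / 2) * sharp_const DIM('a) \<alpha> * ?h2 x"
    proof -
      have "norm x powr (- ((N + s) / 2)) = norm x powr (- ((\<alpha> + s) / 2)) * norm x powr (- ((real DIM('a) - \<alpha>) / 2))"
        by (simp only: powr_add[symmetric]) (rule powr_exponent_cong, simp add: N_def field_simps)
      then show ?thesis unfolding A_def by (simp only: mult_ac)
    qed
    finally show "(NBINT y. ?h1 x y) = ennreal (Gamma (b / 2) * sharp_const DIM('a) \<alpha> * ?h2 x)" .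
  qed
  also have "\<dots> = ennreal (Gamma (b / 2) * sharp_const DIM('a) \<alpha>) * (NBINT x. ennreal (?h2 x))"
    using G b sharp_const_pos[OF \<alpha>'] by (intro nn_cmult_real) auto
  also have "(NBINT x. ennreal (?h2 x)) = ennreal ?h3"
  proof -
    have e: "(N - (N + s) / 2) / 2 = (N - s) / 4" by (simp add: field_simps)
    show ?thesis using nn_norm_powr_gauss[of "(N + s) / 2", where 'a = 'a, folded N_def, unfolded e] s by simp
  qed
  also have "ennreal (Gamma (b / 2) * sharp_const DIM('a) \<alpha>) * ennreal ?h3 = ennreal (Gamma (b / 2) * sharp_const DIM('a) \<alpha> * ?h3)"
    by (rule ennreal_mult'[symmetric]) (use G b sharp_const_pos[OF \<alpha>'] in simp)
  also have "Gamma (b / 2) * sharp_const DIM('a) \<alpha> * ?h3 =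
    sharp_const DIM('a) \<alpha> * pi powr (N / 2) * (Gamma ((N - s) / 4))\<^sup>2 / Gamma (N / 2)"
    unfolding b(2) by (simp add: power2_eq_square)
  finally show ?thesis unfolding b(2) .
qed

lemma riesz_form_mixture:
  fixes \<phi> :: "'a::euclidean_space \<Rightarrow> real"
  assumes \<alpha>: "0 < \<alpha>" "\<alpha> < real DIM('a)" and m [measurable]: "m \<in> borel_measurable borel" and m0: "\<And>u. 0 \<le> m u"
    and \<phi>0: "\<And>x. 0 \<le> \<phi> x" and rep: "\<And>x. ennreal (\<phi> x) = (NPINT u. ennreal (m u * gauss u x))"
  shows "riesz_form \<alpha> s \<phi> = (NPINT u. NPINT v. ennreal (m u * m v) * gauss_form TYPE('a) \<alpha> s u v)"
proof -
  note k0 = weighted_kernel_nonneg[OF \<alpha>]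
  let ?k = "weighted_kernel \<alpha> s :: 'a \<Rightarrow> 'a \<Rightarrow> real"
  let ?F = "\<lambda>u v x y :: 'a. ennreal (m u * m v) * ennreal (gauss u x * (?k x y * gauss v y))"
  have "riesz_form \<alpha> s \<phi> = (NBINT y. NBINT x. NPINT u. NPINT v. ?F u v x y)"
    unfolding riesz_form_def
  proof (intro nn_integral_cong)
    fix x y
    have "ennreal \<bar>weighted_riesz_kernel \<alpha> s \<phi> x y\<bar> = ennreal (?k x y) * (ennreal (\<phi> x) * ennreal (\<phi> y))"
      using k0[of s x y] \<phi>0 by (simp add: weighted_riesz_kernel_eq abs_mult ennreal_mult')
    also have "\<dots> = ennreal (?k x y) * (NPINT u. ennreal (m u * gauss u x) * (NPINT v. ennreal (m v * gauss v y)))"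
      unfolding rep by (simp add: nn_integral_multc)
    also have "\<dots> = (NPINT u. NPINT v. ennreal (?k x y) * (ennreal (m u * gauss u x) * ennreal (m v * gauss v y)))"
      by (simp add: nn_integral_cmult)
    also have "\<dots> = (NPINT u. NPINT v. ?F u v x y)"
      using k0[of s x y] m0 by (simp add: ennreal_mult' mult_ac)
    finally show "ennreal \<bar>weighted_riesz_kernel \<alpha> s \<phi> x y\<bar> = (NPINT u. NPINT v. ?F u v x y)" .
  qed
  also have "\<dots> = (NBINT y. NPINT u. NBINT x. NPINT v. ?F u v x y)"
    by (intro nn_integral_cong lpos_lborel.Fubini') measurable
  also have "\<dots> = (NPINT u. NBINT y. NBINT x. NPINT v. ?F u v x y)"
    by (rule lpos_lborel.Fubini') measurable
  also have "\<dots> = (NPINT u. NBINT y. NPINT v. NBINT x. ?F u v x y)"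
    by (intro nn_integral_cong lpos_lborel.Fubini') measurable
  also have "\<dots> = (NPINT u. NPINT v. NBINT y. NBINT x. ?F u v x y)"
    by (rule nn_integral_cong, rule lpos_lborel.Fubini') measurable
  also have "\<dots> = (NPINT u. NPINT v. ennreal (m u * m v) * gauss_form TYPE('a) \<alpha> s u v)"
    unfolding gauss_form_def by (simp add: nn_integral_cmult)
  finally show ?thesis .
qed

text \<open>The pairs \<open>u\<close>, \<open>u * r\<close> both lie in \<open>{1..M}\<close> on an
  interval whose logarithmic length is \<open>ln M\<close> reduced by the shift; when
  \<open>r\<close> is too large or too small the length is negative and \<open>ennreal\<close> gives
  0.\<close>

lemma log_window_mass:
  assumes r: "0 < r" and M: "1 \<le> M"
  shows "(NPINT u. ennreal (u * (log_density b M u * log_density b M (u * r)) * u powr (- b))) =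
    ennreal (r powr (b / 2 - 1)) * ennreal (ln M - \<bar>ln r\<bar>)"
proof -
  let ?h1 = "\<lambda>u. indicator {max 1 (1 / r)..min M (M / r)} u / u"
  let ?h2 = "\<lambda>u. log_density b M u * log_density b M (u * r)"
  have "(NPINT u. ennreal (u * ?h2 u * u powr (- b))) = (NPINT u. ennreal (r powr (b / 2 - 1) * ?h1 u))"
  proof (rule nn_lpos_cong)
    fix u :: real assume u: "0 < u"
    have iff: "(u \<in> {1..M} \<and> u * r \<in> {1..M}) \<longleftrightarrow> u \<in> {max 1 (1 / r)..min M (M / r)}"
      using r by (auto simp: field_simps)
    have "indicator {1..M} u * indicator {1..M} (u * r) = (if u \<in> {1..M} \<and> u * r \<in> {1..M} then 1 else 0 :: real)"
      by (simp add: indicator_def)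
    also have "\<dots> = indicator {max 1 (1 / r)..min M (M / r)} u"
      unfolding iff indicator_def of_bool_def ..
    finally have i: "indicator {1..M} u * indicator {1..M} (u * r) = (indicator {max 1 (1 / r)..min M (M / r)} u :: real)" .
    have 1: "(u * r) powr (b / 2 - 1) = u powr (b / 2 - 1) * r powr (b / 2 - 1)" by (rule powr_mult)
    have "1 / u = u powr (- 1)" using u by (simp add: powr_minus_divide)
    also have "\<dots> = u powr 1 * u powr (b / 2 - 1) * u powr (b / 2 - 1) * u powr (- b)"
      by (simp only: powr_add[symmetric]) (rule powr_exponent_cong, simp)
    finally have 2: "1 / u = u * u powr (b / 2 - 1) * u powr (b / 2 - 1) * u powr (- b)" using u by simp
    have "u * ?h2 u * u powr (- b) =
      r powr (b / 2 - 1) * (indicator {1..M} u * indicator {1..M} (u * r) * (u * u powr (b / 2 - 1) * u powr (b / 2 - 1) * u powr (- b)))"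
      unfolding log_density_def 1 by (simp only: mult_ac)
    also have "\<dots> = r powr (b / 2 - 1) * ?h1 u"
      unfolding i 2[symmetric] by simp
    finally show "ennreal (u * ?h2 u * u powr (- b)) = ennreal (r powr (b / 2 - 1) * ?h1 u)"
      by simp
  qed
  also have "\<dots> = ennreal (r powr (b / 2 - 1)) * (NPINT u. ennreal (?h1 u))"
    by (rule nn_cmult_real) auto
  also have "(NPINT u. ennreal (?h1 u)) = ennreal (ln (min M (M / r)) - ln (max 1 (1 / r)))"
    by (rule log_uniform_mass) (use r M in \<open>auto simp: less_max_iff_disj\<close>)
  also have "ln (min M (M / r)) - ln (max 1 (1 / r)) = ln M - \<bar>ln r\<bar>"
  proof (cases "1 \<le> r")
    case True
    then have "min M (M / r) = M / r" "max 1 (1 / r) = 1" using M by (auto simp: min_def max_def field_simps)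
    then show ?thesis using True M by (simp add: ln_div)
  next
    case False
    then have "1 < 1 / r" using r by simp
    moreover have "M \<le> M / r" using False r M by (simp add: field_simps)
    ultimately have "min M (M / r) = M" "max 1 (1 / r) = 1 / r" by auto
    moreover have "ln r < 0" using False r by simp
    ultimately show ?thesis using r by (simp add: ln_div)
  qed
  finally show ?thesis .
qed

text \<open>In the variables \<open>u\<close> and \<open>r = v / u\<close> scaling separates the
  form. Unlike the energy it must not be estimated from above, so the window constraint is kept and
  appears as the weight in \<open>ln r\<close>.\<close>

lemma riesz_form_log_profile:
  fixes \<alpha> s M :: real
  defines "N \<equiv> real DIM('a::euclidean_space)"
  assumes \<alpha>: "0 < \<alpha>" "\<alpha> < N" and M: "1 \<le> M"
  shows "riesz_form \<alpha> s (log_profile ((N - s) / 2) M :: 'a \<Rightarrow> real) =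
    (NPINT r. ennreal (ln M - \<bar>ln r\<bar>) * (ennreal (r powr ((N - s) / 4 - 1)) * gauss_form TYPE('a) \<alpha> s 1 r))"
proof -
  define b where "b = (N - s) / 2"
  have b: "b / 2 = (N - s) / 4" by (simp add: b_def)
  let ?m = "log_density b M"
  let ?G = "gauss_form TYPE('a) \<alpha> s"
  have [measurable]: "?G u \<in> borel_measurable borel" for u
    unfolding gauss_form_def by measurable
  let ?h1 = "\<lambda>u r. ennreal (u * (?m u * ?m (u * r)) * u powr (- b))"
  let ?h2 = "\<lambda>u. NPINT v. ennreal (?m u * ?m v) * ?G u v"
  have "riesz_form \<alpha> s (log_profile b M :: 'a \<Rightarrow> real) = (NPINT u. ?h2 u)"
    using \<alpha> unfolding N_def
    by (intro riesz_form_mixture log_density_nonneg log_profile_nonneg log_profile_nn) auto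
  also have "\<dots> = (NPINT u. NPINT r. ?h1 u r * ?G 1 r)"
  proof (rule nn_lpos_cong)
    fix u :: real assume u: "0 < u"
    have "(?h2 u) = ennreal u * (NPINT r. ennreal (?m u * ?m (u * r)) * ?G u (u * r))"
      using u by (subst nn_lpos_scale[of _ u]) auto
    also have "\<dots> = (NPINT r. ennreal u * (ennreal (?m u * ?m (u * r)) * ?G u (u * r)))"
      by (rule nn_integral_cmult[symmetric]) measurable
    also have "\<dots> = (NPINT r. ?h1 u r * ?G 1 r)"
    proof (rule nn_lpos_cong)
      fix r :: real
      have "?h1 u r = ennreal u * ennreal (?m u * ?m (u * r)) * ennreal (u powr (- b))"
        using u by (simp only: ennreal_mult' ennreal_mult'' powr_ge_zero less_imp_le)
      then show "ennreal u * (ennreal (?m u * ?m (u * r)) * ?G u (u * r)) = ?h1 u r * ?G 1 r"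
        unfolding gauss_form_scale[OF u] b_def N_def by (simp only: mult_ac)
    qed
    finally show "(?h2 u) = \<dots>" .
  qed
  also have "\<dots> = (NPINT r. NPINT u. ?h1 u r * ?G 1 r)"
    by (rule lpos_lpos.Fubini') measurable
  also have "\<dots> = (NPINT r. (NPINT u. ?h1 u r) * ?G 1 r)"
    by (simp add: nn_integral_multc)
  also have "\<dots> = (NPINT r. ennreal (ln M - \<bar>ln r\<bar>) * (ennreal (r powr ((N - s) / 4 - 1)) * ?G 1 r))"
  proof (rule nn_lpos_cong)
    fix r :: real assume r: "0 < r"
    show "(NPINT u. ?h1 u r) * ?G 1 r = ennreal (ln M - \<bar>ln r\<bar>) * (ennreal (r powr ((N - s) / 4 - 1)) * ?G 1 r)"
      unfolding log_window_mass[OF r M] b by (simp only: mult_ac)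
  qed
  finally show ?thesis unfolding b_def .
qed

text \<open>Both sides are divided by \<open>ln M\<close>. The weight in the form becomes
  \<open>1 - |ln r| / ln M\<close>, which tends to 1, and Fatou's lemma bounds the full Mellin
  integral \<open>K'\<close> by \<open>S\<close> times the slope \<open>K\<close> of the
  energy.\<close>

lemma sharp_const_le:
  fixes \<alpha> s S :: real
  assumes \<alpha>: "0 < \<alpha>" "\<alpha> < real DIM('a::euclidean_space)" and s: "0 < s" "s < 2" "s < real DIM('a)" and S0: "0 \<le> S"
    and S: "\<And>f :: 'a \<Rightarrow> real. f \<in> test_functions \<Longrightarrow> (\<And>x. 0 \<le> f x) \<Longrightarrow> riesz_form \<alpha> s f \<le> ennreal S * hs_energy s f"
  shows "sharp_const DIM('a) \<alpha> * sharp_const DIM('a) s \<le> S"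
proof -
  define N where "N = real DIM('a)"
  define p where "p = (N - s) / 4 - 1"
  have sN: "s < N" using s by (simp add: N_def)
  have G: "0 < Gamma (N / 2)" "0 < Gamma ((N - s) / 4)" "0 < Gamma ((N + s) / 4)" using s sN by auto
  define K where "K = 2 powr s * pi powr (N / 2) * (Gamma ((N + s) / 4))\<^sup>2 / Gamma (N / 2)"
  define K' where "K' = sharp_const DIM('a) \<alpha> * pi powr (N / 2) * (Gamma ((N - s) / 4))\<^sup>2 / Gamma (N / 2)"
  have K: "0 < K" unfolding K_def using G by simp
  define g where "g = (\<lambda>r. ennreal (r powr p) * gauss_form TYPE('a) \<alpha> s 1 r)"
  have "gauss_form TYPE('a) \<alpha> s 1 \<in> borel_measurable borel" unfolding gauss_form_def by measurable
  then have [measurable]: "g \<in> borel_measurable borel" unfolding g_def by measurable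
  have gI: "(NPINT r. g r) = ennreal K'"
    using gauss_form_mellin[of \<alpha> s, where 'a = 'a, folded N_def] \<alpha> s sN
    unfolding g_def p_def K'_def N_def[symmetric] by simp
  have bound: "(NPINT r. ennreal (1 - \<bar>ln r\<bar> / real (Suc n)) * g r) \<le> ennreal (S * K)" for n
  proof -
    define k where "k = real (Suc n)"
    have k: "0 < k" by (simp add: k_def)
    \<comment> \<open>Makes \<open>ln M\<close> the integer \<open>n + 1\<close>, so the limit in
      \<open>M\<close> becomes a limit along a sequence.\<close>
    define M where "M = exp k"
    have M: "1 \<le> M" "ln M = k" using k by (auto simp: M_def)
    have E: "hs_energy s (log_profile ((N - s) / 2) M :: 'a \<Rightarrow> real) \<le> ennreal (K * k)"
      unfolding K_def N_def M(2)[symmetric] by (rule log_profile_energy[OF s M(1)])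
    have "(NPINT r. ennreal (k - \<bar>ln r\<bar>) * g r) = riesz_form \<alpha> s (log_profile ((N - s) / 2) M :: 'a \<Rightarrow> real)"
      unfolding g_def p_def N_def riesz_form_log_profile[OF \<alpha> M(1)] M(2) ..
    also have "\<dots> \<le> ennreal S * hs_energy s (log_profile ((N - s) / 2) M :: 'a \<Rightarrow> real)"
    proof (rule riesz_form_le_of_test_functions[OF radial_alg_log_profile log_profile_nonneg s(1,2) log_profile_L2 _ S])
      show "hs_energy s (log_profile ((N - s) / 2) M :: 'a \<Rightarrow> real) < \<infinity>"
        using E by (rule le_less_trans) simp
    qed
    also have "\<dots> \<le> ennreal S * ennreal (K * k)" by (rule mult_left_mono[OF E]) simp
    also have "\<dots> = ennreal (S * (K * k))" by (rule ennreal_mult'[OF S0, symmetric])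
    finally have *: "(NPINT r. ennreal (k - \<bar>ln r\<bar>) * g r) \<le> ennreal (S * (K * k))" .
    have "(NPINT r. ennreal (1 - \<bar>ln r\<bar> / k) * g r) = (NPINT r. ennreal (1 / k) * (ennreal (k - \<bar>ln r\<bar>) * g r))"
    proof (rule nn_integral_cong)
      fix r
      have "1 - \<bar>ln r\<bar> / k = 1 / k * (k - \<bar>ln r\<bar>)" using k by (simp add: field_simps)
      moreover have "0 \<le> 1 / k" using k by simp
      ultimately show "ennreal (1 - \<bar>ln r\<bar> / k) * g r = ennreal (1 / k) * (ennreal (k - \<bar>ln r\<bar>) * g r)"
        by (simp only: ennreal_mult' mult.assoc)
    qed
    also have "\<dots> = ennreal (1 / k) * (NPINT r. ennreal (k - \<bar>ln r\<bar>) * g r)"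
      by (rule nn_integral_cmult) measurable
    also have "\<dots> \<le> ennreal (1 / k) * ennreal (S * (K * k))" by (rule mult_left_mono[OF *]) simp
    also have "\<dots> = ennreal (S * K)" using k by (subst ennreal_mult'[symmetric]) auto
    finally show ?thesis unfolding k_def .
  qed
  \<comment> \<open>Multiplication in \<open>ennreal\<close> by a convergent sequence is continuous
    only for a finite factor; finiteness almost everywhere follows from the finite Mellin
    integral.\<close>
  have "AE r in lpos. g r \<noteq> \<infinity>"
    by (rule nn_integral_noteq_infinite) (auto simp: gI)
  then have "(NPINT r. g r) = (NPINT r. liminf (\<lambda>n. ennreal (1 - \<bar>ln r\<bar> / real (Suc n)) * g r))"
  proof (rule nn_integral_cong_AE[OF AE_mp], intro AE_I2 impI)
    fix r assume fin: "g r \<noteq> \<infinity>"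
    have "(\<lambda>n. 1 - \<bar>ln r\<bar> / real (Suc n)) \<longlonglongrightarrow> 1" by real_asymp
    then have "(\<lambda>n. g r * ennreal (1 - \<bar>ln r\<bar> / real (Suc n))) \<longlonglongrightarrow> g r * ennreal 1"
      using fin by (intro ennreal_tendsto_cmult tendsto_ennrealI) (auto simp: less_top)
    then have "(\<lambda>n. ennreal (1 - \<bar>ln r\<bar> / real (Suc n)) * g r) \<longlonglongrightarrow> g r"
      by (simp add: mult.commute)
    then show "g r = liminf (\<lambda>n. ennreal (1 - \<bar>ln r\<bar> / real (Suc n)) * g r)"
      by (intro lim_imp_Liminf[symmetric]) auto
  qed
  also have "\<dots> \<le> liminf (\<lambda>n. (NPINT r. ennreal (1 - \<bar>ln r\<bar> / real (Suc n)) * g r))"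
    by (rule nn_integral_liminf) measurable
  also have "\<dots> \<le> ennreal (S * K)"
    by (rule Liminf_le[OF _ always_eventually[OF allI[OF bound]]]) simp
  finally have "ennreal K' \<le> ennreal (S * K)" unfolding gI .
  then have "K' \<le> S * K" using S0 K by (subst (asm) ennreal_le_iff) auto
  then have "K' / K \<le> S" using K by (simp add: field_simps)
  \<comment> \<open>The powers of \<open>pi\<close> and \<open>Gamma (N / 2)\<close> cancel, and
    what is left besides the factor for \<open>\<alpha>\<close> is Herbst's constant of order
    \<open>s\<close>.\<close>
  also have "K' / K = sharp_const DIM('a) \<alpha> * sharp_const DIM('a) s"
    unfolding K'_def K_def sharp_const_def[of _ s] N_def[symmetric] using G by (simp add: power2_eq_square)
  finally show ?thesis .
qed

section \<open>Normalising test functions and evaluating the supremum\<close>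

lemma C_k_cmult:
  fixes f :: "'a::euclidean_space \<Rightarrow> real"
  shows "C_k k f \<Longrightarrow> C_k k (\<lambda>x. c * f x)"
proof (induction k arbitrary: f)
  case 0
  then show ?case by (auto intro: continuous_on_mult_left)
next
  case (Suc k)
  have D: "((\<lambda>x. c * f x) has_derivative (\<lambda>v. c * frechet_derivative f (at x) v)) (at x)" for x
    using Suc.prems by (intro has_derivative_mult_right) (simp add: frechet_derivative_works[symmetric])
  have "frechet_derivative (\<lambda>x. c * f x) (at x) = (\<lambda>v. c * frechet_derivative f (at x) v)" for x
    using frechet_derivative_at[OF D] by simp
  moreover have "(\<lambda>x. c * f x) differentiable (at x)" for x using D by (auto simp: differentiable_def)
  ultimately show ?case using Suc by simp
qed

lemma test_functions_cmult:
  assumes "f \<in> test_functions"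
  shows "(\<lambda>x. c * f x) \<in> test_functions"
proof -
  have "closure (support_on UNIV (\<lambda>x. c * f x)) \<subseteq> closure (support_on UNIV f)"
    by (rule closure_mono) (auto simp: support_on_def)
  then have "compact (closure (support_on UNIV (\<lambda>x. c * f x)))"
    using assms compact_Int_closed[of "closure (support_on UNIV f)" "closure (support_on UNIV (\<lambda>x. c * f x))"]
    by (simp add: test_functions_def Int_absorb1)
  then show ?thesis using assms C_k_cmult by (auto simp: test_functions_def)
qed

lemma test_functions_subset_hom_sobolev: "test_functions \<subseteq> hom_sobolev s"
proof
  fix f :: "'a \<Rightarrow> real" assume f: "f \<in> test_functions"
  have "hs_energy s (\<lambda>x. f x - f x) = 0" by (simp add: hs_energy_def)
  then show "f \<in> hom_sobolev s"
    using f test_function_measurable[OF f] unfolding hom_sobolev_def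
    by (auto intro!: exI[of _ "\<lambda>_. f"])
qed

lemma zero_test_function: "(\<lambda>x. 0) \<in> test_functions"
  by (rule test_functionI[OF radial_alg.const]) simp

text \<open>The Bochner integral of a non-integrable function is 0 by default, so integrability on
  the product space is asserted along with the value. The supremum is taken in \<open>ereal\<close>,
  where it exists without a boundedness proof.\<close>

theorem theoremC:
  fixes \<alpha> s :: real
  assumes "0 < \<alpha>" and "\<alpha> < real DIM('a::euclidean_space)"
    and "0 < s" and "s < 2" and "s < real DIM('a)"
  shows "(\<forall>\<phi> \<in> (hom_sobolev s :: ('a \<Rightarrow> real) set).
            integrable (lborel \<Otimes>\<^sub>M lborel) (\<lambda>(x, y). weighted_riesz_kernel \<alpha> s \<phi> x y)) \<and>
         (SUP \<phi> \<in> {\<phi> \<in> (hom_sobolev s :: ('a \<Rightarrow> real) set). hs_norm s \<phi> \<le> 1}.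
            ereal (LINT y|lborel. LINT x|lborel. weighted_riesz_kernel \<alpha> s \<phi> x y)) = ereal (1 / 2 powr (\<alpha> + s) *
           (Gamma ((real DIM('a) - s) / 4) * Gamma ((real DIM('a) - \<alpha>) / 4) /
            (Gamma ((real DIM('a) + s) / 4) * Gamma ((real DIM('a) + \<alpha>) / 4)))\<^sup>2)"
proof -
  note s = assms(3-5) and \<alpha> = assms(1,2)
  define C where "C = sharp_const DIM('a) \<alpha> * sharp_const DIM('a) s"
  have C: "0 < C" unfolding C_def using sharp_const_pos[OF \<alpha>] sharp_const_pos[OF s(1,3)] by simp
  have C_eq: "1 / 2 powr (\<alpha> + s) * (Gamma ((real DIM('a) - s) / 4) * Gamma ((real DIM('a) - \<alpha>) / 4) /
            (Gamma ((real DIM('a) + s) / 4) * Gamma ((real DIM('a) + \<alpha>) / 4)))\<^sup>2 = C"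
    unfolding C_def sharp_const_def by (simp add: powr_add power_mult_distrib power_divide mult_ac)
  let ?H = "hom_sobolev s :: ('a \<Rightarrow> real) set"
  let ?B = "{\<phi> \<in> ?H. hs_norm s \<phi> \<le> 1}"
  let ?J = "\<lambda>\<phi> :: 'a \<Rightarrow> real. LINT y|lborel. LINT x|lborel. weighted_riesz_kernel \<alpha> s \<phi> x y"
  have meas: "\<phi> \<in> borel_measurable borel" if "\<phi> \<in> ?H" for \<phi>
    using that by (simp add: hom_sobolev_def)
  have le: "riesz_form \<alpha> s \<phi> \<le> ennreal C * hs_energy s \<phi>" if "\<phi> \<in> ?H" for \<phi>
    unfolding C_def by (rule riesz_form_le[OF that s \<alpha>])
  have fin: "riesz_form \<alpha> s \<phi> < \<infinity>" if "\<phi> \<in> ?H" for \<phi>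
    using le[OF that] hom_sobolev_energy_finite[OF that s] by (auto intro: le_less_trans simp: ennreal_mult_less_top)
  define V where "V = (SUP \<phi>\<in>?B. ereal (?J \<phi>))"
  have "V \<le> ereal C"
    unfolding V_def
  proof (rule SUP_least)
    fix \<phi> assume "\<phi> \<in> ?B"
    then have \<phi>: "\<phi> \<in> ?H" "hs_norm s \<phi> \<le> 1" by auto
    obtain e where e: "hs_energy s \<phi> = ennreal e" "0 \<le> e"
      using hom_sobolev_energy_finite[OF \<phi>(1) s] by (cases "hs_energy s \<phi>") auto
    \<comment> \<open>\<open>hs_norm\<close> passes through \<open>enn2real\<close>, which would
      send an infinite energy to 0; the finite representative \<open>e\<close> excludes
      this.\<close>
    have "e \<le> 1" using \<phi>(2) e by (simp add: hs_norm_def)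
    have "riesz_form \<alpha> s \<phi> \<le> ennreal (C * e)" using le[OF \<phi>(1)] C e by (simp add: ennreal_mult')
    also have "\<dots> \<le> ennreal C" using C \<open>e \<le> 1\<close> by (intro ennreal_leI) (simp add: mult_left_le)
    finally have "enn2real (riesz_form \<alpha> s \<phi>) \<le> C" using C by (intro enn2real_leI) auto
    then show "ereal (?J \<phi>) \<le> ereal C"
      using weighted_riesz_kernel_LINT_le[OF meas[OF \<phi>(1)] fin[OF \<phi>(1)]] by simp
  qed
  moreover have "ereal C \<le> V"
  proof -
    have T: "f \<in> ?H" if "f \<in> test_functions" for f
      using that test_functions_subset_hom_sobolev by blast
    \<comment> \<open>The zero function keeps the supremum from being minus infinity, so that with
      the upper bound it is a nonnegative real \<open>S\<close>.\<close>
    have "ereal (?J (\<lambda>x. 0)) \<le> V"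
      unfolding V_def by (rule SUP_upper) (auto intro: T zero_test_function simp: hs_norm_def hs_energy_def)
    then have "0 \<le> V" by (simp add: weighted_riesz_kernel_def zero_ereal_def)
    with \<open>V \<le> ereal C\<close> obtain S where S: "V = ereal S" "0 \<le> S" by (cases V) auto
    have "C \<le> S"
      unfolding C_def
    proof (rule sharp_const_le[OF \<alpha> s S(2)])
      fix f :: "'a \<Rightarrow> real" assume f: "f \<in> test_functions" "\<And>x. 0 \<le> f x"
      have fm: "f \<in> borel_measurable borel" by (rule test_function_measurable[OF f(1)])
      obtain e where e: "hs_energy s f = ennreal e" "0 \<le> e"
        using test_function_energy_finite[OF f(1) s(1,2)] by (cases "hs_energy s f") auto
      show "riesz_form \<alpha> s f \<le> ennreal S * hs_energy s f"
      proof (cases "e = 0")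
        case True
        \<comment> \<open>Zero energy cannot be normalised, but the upper bound already makes the
          form vanish.\<close>
        then show ?thesis using le[OF T[OF f(1)]] e by simp
      next
        case False
        then have e0: "0 < e" using e by simp
        \<comment> \<open>Both the energy and the form scale by \<open>c^2\<close>, so this
          normalises the energy to 1 and admits the multiple to the supremum.\<close>
        define c where "c = 1 / sqrt e"
        have c: "0 < c" "c\<^sup>2 = 1 / e" using e0 by (auto simp: c_def power_divide)
        let ?g = "\<lambda>x. c * f x"
        have g: "?g \<in> test_functions" by (rule test_functions_cmult[OF f(1)])
        have "hs_energy s ?g = ennreal 1"
          unfolding hs_energy_scale[OF fm] e(1) c(2) using e0 by (simp add: ennreal_mult'[symmetric])
        then have "?g \<in> ?B" using T[OF g] by (simp add: hs_norm_def)
        then have "ereal (?J ?g) \<le> V" unfolding V_def by (rule SUP_upper)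
        then have "?J ?g \<le> S" using S by simp
        \<comment> \<open>Nonnegativity of \<open>f\<close> is used here: only then does the signed
          form agree with the one with absolute values.\<close>
        moreover have "?J ?g = enn2real (riesz_form \<alpha> s ?g)"
        proof (rule weighted_riesz_kernel_LINT_eq[OF meas[OF T[OF g]] fin[OF T[OF g]]])
          show "0 \<le> weighted_riesz_kernel \<alpha> s ?g x y" for x y
            unfolding weighted_riesz_kernel_eq using weighted_kernel_nonneg[OF \<alpha>] f(2) c by simp
        qed
        ultimately have j: "enn2real (riesz_form \<alpha> s ?g) \<le> S" by simp
        have "ennreal (1 / e) * riesz_form \<alpha> s f = riesz_form \<alpha> s ?g"
          unfolding riesz_form_scale[OF fm] c(2) ..
        also have "\<dots> \<le> ennreal S"
          using j fin[OF T[OF g]] S(2) by (cases "riesz_form \<alpha> s ?g") (auto intro: ennreal_leI)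
        finally have "ennreal e * (ennreal (1 / e) * riesz_form \<alpha> s f) \<le> ennreal e * ennreal S"
          by (rule mult_left_mono) simp
        moreover have "ennreal e * (ennreal (1 / e) * riesz_form \<alpha> s f) = riesz_form \<alpha> s f"
          using e0 by (simp add: mult.assoc[symmetric] ennreal_mult'[symmetric])
        ultimately show ?thesis unfolding e(1) by (simp add: mult.commute)
      qed
    qed
    then show ?thesis unfolding S by simp
  qed
  ultimately have "V = ereal C" by (rule antisym)
  then show ?thesis
    unfolding C_eq V_def using weighted_riesz_kernel_integrable[OF meas fin] by blast
qed

end
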